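(* Let \[ \mathbb M_{19}=\{\mathfrak L(L,M):\ M^2=-I_2,\ L>0,\ L^{-1}+2MR_\perp<0\} \] and, for $\gamma_0\in\mathbb R$, \[ P_{\gamma_0}(L,M)=\gamma_0ML^{-1}M^T+(1+\gamma_0)L^{-1}+2\gamma_0MR_\perp . \] Define $\Phi_{\gamma_0}(\mathfrak L(L,M))=\mathfrak L\big(P_{\gamma_0}(L,M)^{-1},M\big)$ for those $\mathfrak L(L,M)\in\mathbb M_{19}$ for which \[ P_{\gamma_0}(L,M)>0,\qquad P_{\gamma_0}(L,M)+2MR_\perp<0 . \] Then $\Phi_{\gamma_0}$ takes values in $\mathbb M_{19}$ and is a link: if $\mathsf L(x)$ is a composite with values in $\mathbb M_{19}$ at which these two inequalities hold for a.e. $x$, and $\Phi_{\gamma_0}(\mathsf L(x))$ is also a composite, then $\Phi_{\gamma_0}$ is defined at $\mathsf L^*$ and \[ \big(\Phi_{\gamma_0}(\mathsf L(\cdot))\big)^*=\Phi_{\gamma_0}(\mathsf L^* ). \] For $\gamma_0=-\frac12$ the map $\Phi_{\gamma_0}$ is not a bijection of $\mathbb M_{19}$, but it is still a link in this sense, between $\mathbb M_{19}$ and \[ \mathbb M_{18}=\{\mathfrak L(L,M):\ M^2=-I_2,\ ML^{-1}-L^{-1}M^T=2R_\perp,\ L>0\}. \]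
   Context: Let $R_\perp=\begin{pmatrix}0&-1\\1&0\end{pmatrix}$ and let $I_2$ be the $2\times2$ identity. Let $\mathcal T=\mathbb R^2\oplus\mathbb R^2$. Operators on $\mathcal T$ are written as $2\times2$ block matrices with real $2\times 2$ blocks, and $A\otimes B$ is the block matrix with blocks $A_{ij}B$. Put $\mathsf T=R_\perp\otimes R_\perp$. $\mathrm{Sym}^+(\mathcal T)$ is the set of symmetric positive definite operators on $\mathcal T$. For real $2\times2$ matrices $L=L^T$ and $M$, \[ \mathfrak L(L,M)=\begin{pmatrix} L & LM \\ {M^T}L & {M^T}LM \end{pmatrix}+\mathsf T . \] In the sets in the claim $L$ ranges over real symmetric and $M$ over real $2\times2$ matrices. Inequalities between matrices are in the sense of quadratic forms. A composite is a $[0,1]^2$-periodic measurable map $\mathsf L:\mathbb R^2\to\mathrm{Sym}^+(\mathcal T)$ with values in a compact subset of $\mathrm{Sym}^+(\mathcal T)$. Its effective tensor $\mathsf L^*\in\mathrm{Sym}^+(\mathcal T)$, also written $(\mathsf L(\cdot))^*$, is defined by $\mathsf L^*E_0=\int_{[0,1]^2}\mathsf L(x)E(x)\,dx$ for $E_0\in\mathcal T$, where $E=E_0+(\nabla\varphi_1,\nabla\varphi_2)$ with $\varphi_1,\varphi_2\in H^1_{\rm per}$ is the unique such field for which both $\mathbb R^2$-components of $\mathsf L E$ are divergence-free. *)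

theory Defs
  imports "HOL-Analysis.Analysis"
begin

section \<open>Matrices\<close>

type_synonym vec2 = "real^2"
type_synonym mat2 = "real^2^2"

text \<open>
  A vector of \<open>\<real>\<^sup>2 \<oplus> \<real>\<^sup>2\<close> has components \<open>E $ (i, k)\<close>, where \<open>i\<close> selects the copy of \<open>\<real>\<^sup>2\<close>
  and \<open>k\<close> the component inside it. An operator accordingly has the entries
  \<open>A $ (i, k) $ (j, l)\<close>, the \<open>(k, l)\<close> entry of the block in position \<open>(i, j)\<close>.
  Products of matrices are always written \<open>**\<close>: the library's \<open>*\<close>, \<open>^\<close> and \<open>inverse\<close>
  are not the matrix operations.
\<close>

type_synonym tvec = "real^(2 \<times> 2)"
type_synonym tmat = "real^(2 \<times> 2)^(2 \<times> 2)"

definition block_matrix :: "mat2 \<Rightarrow> mat2 \<Rightarrow> mat2 \<Rightarrow> mat2 \<Rightarrow> tmat" where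
  "block_matrix A B C D =
    (\<chi> p q. (if fst p = 1 then (if fst q = 1 then A else B)
                         else (if fst q = 1 then C else D)) $ snd p $ snd q)"

definition kron :: "mat2 \<Rightarrow> mat2 \<Rightarrow> tmat" where
  "kron A B = block_matrix ((A$1$1) *\<^sub>R B) ((A$1$2) *\<^sub>R B) ((A$2$1) *\<^sub>R B) ((A$2$2) *\<^sub>R B)"

definition sym_mat :: "real^'n^'n \<Rightarrow> bool" where
  "sym_mat A \<longleftrightarrow> transpose A = A"

definition pos_def :: "real^'n^'n \<Rightarrow> bool" where
  "pos_def A \<longleftrightarrow> (\<forall>v. v \<noteq> 0 \<longrightarrow> v \<bullet> (A *v v) > 0)"

definition neg_def :: "real^'n^'n \<Rightarrow> bool" where
  "neg_def A \<longleftrightarrow> (\<forall>v. v \<noteq> 0 \<longrightarrow> v \<bullet> (A *v v) < 0)"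

definition Sym_plus :: "tmat set" where
  "Sym_plus = {A. sym_mat A \<and> pos_def A}"

definition R_perp :: mat2 where
  "R_perp = vector [vector [0, -1], vector [1, 0]]"

definition T_mat :: tmat where
  "T_mat = kron R_perp R_perp"


section \<open>The sets and the map\<close>

definition frakL :: "mat2 \<Rightarrow> mat2 \<Rightarrow> tmat" where
  "frakL L M = block_matrix L (L ** M) (transpose M ** L) (transpose M ** L ** M) + T_mat"

definition params19 :: "mat2 \<Rightarrow> mat2 \<Rightarrow> bool" where
  "params19 L M \<longleftrightarrow> sym_mat L \<and> M ** M = - mat 1 \<and> pos_def L
     \<and> neg_def (matrix_inv L + 2 *\<^sub>R (M ** R_perp))"

definition M19 :: "tmat set" where
  "M19 = {frakL L M | L M. params19 L M}"

definition M18 :: "tmat set" where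
  "M18 = {frakL L M | L M. sym_mat L \<and> M ** M = - mat 1
     \<and> M ** matrix_inv L - matrix_inv L ** transpose M = 2 *\<^sub>R R_perp \<and> pos_def L}"

definition P_mat :: "real \<Rightarrow> mat2 \<Rightarrow> mat2 \<Rightarrow> mat2" where
  "P_mat \<gamma> L M = \<gamma> *\<^sub>R (M ** matrix_inv L ** transpose M) + (1 + \<gamma>) *\<^sub>R matrix_inv L
     + (2 * \<gamma>) *\<^sub>R (M ** R_perp)"

definition Phi_params :: "real \<Rightarrow> mat2 \<Rightarrow> mat2 \<Rightarrow> bool" where
  "Phi_params \<gamma> L M \<longleftrightarrow> params19 L M \<and> pos_def (P_mat \<gamma> L M)
     \<and> neg_def (P_mat \<gamma> L M + 2 *\<^sub>R (M ** R_perp))"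

definition Phi_dom :: "real \<Rightarrow> tmat set" where
  "Phi_dom \<gamma> = {frakL L M | L M. Phi_params \<gamma> L M}"

text \<open>Meaningful only on \<open>Phi_dom \<gamma>\<close>; there the value is given by \<open>Phi_frakL\<close> below.\<close>

definition Phi :: "real \<Rightarrow> tmat \<Rightarrow> tmat" where
  "Phi \<gamma> A = (THE B. \<exists>L M. Phi_params \<gamma> L M \<and> A = frakL L M
     \<and> B = frakL (matrix_inv (P_mat \<gamma> L M)) M)"

lemma frakL_inj:
  assumes "frakL L M = frakL L' M'" "pos_def L"
  shows "L = L' \<and> M = M'"
proof -
  have eq: "block_matrix L (L ** M) (transpose M ** L) (transpose M ** L ** M)
      = block_matrix L' (L' ** M') (transpose M' ** L') (transpose M' ** L' ** M')"
    using assms(1) by (simp add: frakL_def)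
  have "L $ k $ l = L' $ k $ l" for k l
    using arg_cong[OF eq, of "\<lambda>A. A $ (1, k) $ (1, l)"] by (simp add: block_matrix_def)
  hence L: "L = L'" by (simp add: vec_eq_iff)
  have "(L ** M) $ k $ l = (L' ** M') $ k $ l" for k l
    using arg_cong[OF eq, of "\<lambda>A. A $ (1, k) $ (2, l)"] by (simp add: block_matrix_def)
  hence LM: "L ** M = L ** M'" by (simp add: vec_eq_iff L)
  have "\<And>x. L *v x = 0 \<Longrightarrow> x = 0"
    using assms(2) by (metis inner_zero_right less_irrefl pos_def_def)
  hence "\<exists>B. B ** L = mat 1" by (simp add: matrix_left_invertible_ker)
  then obtain B where "B ** L = mat 1" by blast
  hence "M = M'" using LM by (metis matrix_mul_assoc matrix_mul_lid)
  with L show ?thesis by simp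
qed

lemma Phi_frakL:
  assumes "Phi_params \<gamma> L M"
  shows "Phi \<gamma> (frakL L M) = frakL (matrix_inv (P_mat \<gamma> L M)) M"
  unfolding Phi_def
proof (rule the_equality)
  show "\<exists>L' M'. Phi_params \<gamma> L' M' \<and> frakL L M = frakL L' M' \<and>
      frakL (matrix_inv (P_mat \<gamma> L M)) M = frakL (matrix_inv (P_mat \<gamma> L' M')) M'"
    using assms by blast
next
  fix B assume "\<exists>L' M'. Phi_params \<gamma> L' M' \<and> frakL L M = frakL L' M' \<and>
      B = frakL (matrix_inv (P_mat \<gamma> L' M')) M'"
  moreover have "pos_def L" using assms by (simp add: Phi_params_def params19_def)
  ultimately show "B = frakL (matrix_inv (P_mat \<gamma> L M)) M"
    using frakL_inj by metis
qed


section \<open>Periodic functions and effective tensors\<close>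

definition unit_cell :: "vec2 set" where
  "unit_cell = cbox 0 1"

definition cell_periodic :: "(vec2 \<Rightarrow> 'b) \<Rightarrow> bool" where
  "cell_periodic f \<longleftrightarrow> (\<forall>x (k :: int^2). f (x + (\<chi> i. of_int (k $ i))) = f x)"

definition L2_per :: "(vec2 \<Rightarrow> 'b::euclidean_space) \<Rightarrow> bool" where
  "L2_per f \<longleftrightarrow> cell_periodic f \<and> f \<in> borel_measurable lebesgue
     \<and> set_integrable lebesgue unit_cell (\<lambda>x. (norm (f x))\<^sup>2)"

text \<open>\<open>D i j\<close> is the partial derivative of order \<open>i\<close> in the first and \<open>j\<close> in the second variable.\<close>

definition smooth_plane :: "(vec2 \<Rightarrow> real) \<Rightarrow> bool" where
  "smooth_plane f \<longleftrightarrow> (\<exists>D :: nat \<Rightarrow> nat \<Rightarrow> vec2 \<Rightarrow> real. D 0 0 = f \<and>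
     (\<forall>i j x. (D i j has_derivative (\<lambda>h. D (Suc i) j x * h$1 + D i (Suc j) x * h$2)) (at x)))"

definition test_function :: "(vec2 \<Rightarrow> real) \<Rightarrow> bool" where
  "test_function \<psi> \<longleftrightarrow> smooth_plane \<psi> \<and> cell_periodic \<psi>"

definition classical_grad :: "(vec2 \<Rightarrow> real) \<Rightarrow> vec2 \<Rightarrow> vec2" where
  "classical_grad \<psi> x = (\<chi> k. frechet_derivative \<psi> (at x) (axis k 1))"

text \<open>\<open>\<phi>\<close> is in \<open>H\<^sup>1\<close> of the torus, with distributional gradient \<open>g\<close>.\<close>

definition H1_per_grad :: "(vec2 \<Rightarrow> real) \<Rightarrow> (vec2 \<Rightarrow> vec2) \<Rightarrow> bool" where
  "H1_per_grad \<phi> g \<longleftrightarrow> L2_per \<phi> \<and> L2_per g \<and>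
     (\<forall>\<psi>. test_function \<psi> \<longrightarrow>
        (LINT x:unit_cell|lebesgue. \<phi> x *\<^sub>R classical_grad \<psi> x)
        = - (LINT x:unit_cell|lebesgue. \<psi> x *\<^sub>R g x))"

text \<open>Distributional divergence on the torus.\<close>

definition divergence_free :: "(vec2 \<Rightarrow> vec2) \<Rightarrow> bool" where
  "divergence_free J \<longleftrightarrow>
     (\<forall>\<psi>. test_function \<psi> \<longrightarrow> (LINT x:unit_cell|lebesgue. J x \<bullet> classical_grad \<psi> x) = 0)"

definition composite :: "(vec2 \<Rightarrow> tmat) \<Rightarrow> bool" where
  "composite L \<longleftrightarrow> cell_periodic L \<and> L \<in> borel_measurable lebesgue
     \<and> (\<exists>K. compact K \<and> K \<subseteq> Sym_plus \<and> range L \<subseteq> K)"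

definition component :: "2 \<Rightarrow> tvec \<Rightarrow> vec2" where
  "component i E = (\<chi> k. E $ (i, k))"

definition cell_field :: "(vec2 \<Rightarrow> tmat) \<Rightarrow> tvec \<Rightarrow> (vec2 \<Rightarrow> tvec) \<Rightarrow> bool" where
  "cell_field L E0 E \<longleftrightarrow>
     (\<exists>\<phi> g. (\<forall>i. H1_per_grad (\<phi> i) (g i)) \<and> (\<forall>x i k. E x $ (i, k) = E0 $ (i, k) + g i x $ k))
     \<and> (\<forall>i. divergence_free (\<lambda>x. component i (L x *v E x)))"

definition is_effective_tensor :: "(vec2 \<Rightarrow> tmat) \<Rightarrow> tmat \<Rightarrow> bool" where
  "is_effective_tensor L A \<longleftrightarrow>
     (\<forall>E0. \<exists>E. cell_field L E0 E
        \<and> (\<forall>E'. cell_field L E0 E' \<longrightarrow> (AE x in lebesgue. E' x = E x))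
        \<and> A *v E0 = (LINT x:unit_cell|lebesgue. L x *v E x))"

text \<open>
  \<open>F\<close>, considered on the set \<open>S\<close>, is a link with target \<open>N\<close>. Since \<open>F\<close> is a partial map and the
  values of \<open>L\<close> are only constrained almost everywhere, the composite with local tensor
  \<open>F (L x)\<close> is any composite \<open>L'\<close> that equals it almost everywhere.
\<close>

definition is_link :: "(tmat \<Rightarrow> tmat) \<Rightarrow> tmat set \<Rightarrow> tmat set \<Rightarrow> bool" where
  "is_link F S N \<longleftrightarrow> F ` S \<subseteq> N \<and>
     (\<forall>L L' A. composite L \<and> (AE x in lebesgue. L x \<in> S)
        \<and> composite L' \<and> (AE x in lebesgue. L' x = F (L x))
        \<and> is_effective_tensor L A
        \<longrightarrow> A \<in> S \<and> is_effective_tensor L' (F A))"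

end

theory Submission
  imports Defs
begin

text \<open>
  Write \<open>X = L\<^sup>-\<^sup>1\<close> and \<open>K = \<L>(L, M) - T\<close>. Since \<open>T\<close> maps gradients to solenoidal fields,
  \<open>E = (e\<^sub>1, e\<^sub>2)\<close> solves the cell problem iff \<open>K E = (j, M\<^sup>T j)\<close> is solenoidal, where
  \<open>X j = e\<^sub>1 + M e\<^sub>2\<close>. The space of solenoidal pairs \<open>(j, M\<^sup>T j)\<close> depends on \<open>M\<close> only, is closed
  under \<open>(j, M\<^sup>T j) \<mapsto> (M\<^sup>T j, - j)\<close>, and by the div-curl identity together with \<open>M R\<^sub>\<bottom> < 0\<close> each of
  its members is determined by the mean of \<open>j\<close>. So \<open>X\<^sup>*\<close> depends linearly on \<open>X\<close> for fixed \<open>M\<close>, and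
  each of the three terms of \<open>P\<close> applied to \<open>j\<close> is again of the form \<open>e\<^sub>1 + M e\<^sub>2\<close> with gradients
  \<open>e\<^sub>1, e\<^sub>2\<close>: if \<open>X M\<^sup>T j = f\<^sub>1 + M f\<^sub>2\<close>, then \<open>M X M\<^sup>T j = - f\<^sub>2 + M f\<^sub>1\<close>, and \<open>R\<^sub>\<bottom> j\<close> is a gradient.
  The potential of \<open>R\<^sub>\<bottom> j\<close> is taken from a solution of the cell problem with \<open>K E = 0\<close>, so no
  Poincare lemma is needed. The div-curl identity itself is Parseval's identity on the torus.
\<close>

subsection \<open>Square integrable functions\<close>

text \<open>That \<open>L\<close> has an effective tensor is a hypothesis, so cell fields for
  \<open>L\<close> are given and no existence theorem for elliptic systems enters: the fields for
  the new composite are assembled from those for the old one, and their uniqueness follows from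
  ellipticity. The main obstacle is that \<open>M\<close> may vary from point to point. At first the
  effective tensor is just some matrix, and neither its factored form nor a matrix
  \<open>M\<^sup>*\<close> with square \<open>- mat 1\<close> is available. Both are extracted from
  data \<open>(a, b)\<close> with zero energy: the form attached to \<open>K\<close> has rank two
  only, so such data need not vanish, and the corresponding fields satisfy
  \<open>e\<^sub>1 + M e\<^sub>2 = 0\<close>. The inequalities defining the domain carry over to the
  effective tensor since every term of the quadratic forms, evaluated at \<open>j\<close>,
  integrates to an expression in the means: two terms are energies, and the third,
  \<open>(M\<^sup>T j) \<bullet> R\<^sub>\<bottom> j\<close>, is a null Lagrangian by the div-curl
  identity.\<close>

definition square_integrable :: "'a measure \<Rightarrow> ('a \<Rightarrow> 'b::euclidean_space) \<Rightarrow> bool" where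
  "square_integrable M f \<longleftrightarrow> f \<in> borel_measurable M \<and> integrable M (\<lambda>x. (norm (f x))\<^sup>2)"

lemma norm_prod_le_sum_squares:
  fixes a b :: real
  shows "\<bar>a * b\<bar> \<le> a\<^sup>2 + b\<^sup>2"
proof -
  have "0 \<le> (\<bar>a\<bar> - \<bar>b\<bar>)\<^sup>2" by simp
  then have "2 * \<bar>a * b\<bar> \<le> a\<^sup>2 + b\<^sup>2" by (simp add: power2_diff abs_mult)
  then show ?thesis using abs_ge_zero[of "a * b"] by linarith
qed

lemma square_integrable_mult:
  fixes f g :: "'a \<Rightarrow> 'b::{euclidean_space, real_normed_field}"
  assumes "square_integrable M f" "square_integrable M g"
  shows "integrable M (\<lambda>x. f x * g x)"
proof (rule Bochner_Integration.integrable_bound)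
  show "integrable M (\<lambda>x. (norm (f x))\<^sup>2 + (norm (g x))\<^sup>2)"
    using assms by (auto simp: square_integrable_def)
  have [measurable]: "f \<in> borel_measurable M" "g \<in> borel_measurable M"
    using assms by (auto simp: square_integrable_def)
  show "(\<lambda>x. f x * g x) \<in> borel_measurable M" by measurable
  show "AE x in M. norm (f x * g x) \<le> norm ((norm (f x))\<^sup>2 + (norm (g x))\<^sup>2)"
    using norm_prod_le_sum_squares[of "norm (f _)" "norm (g _)"]
    by (auto simp: norm_mult abs_mult)
qed

lemma square_integrable_inner:
  assumes "square_integrable M f" "square_integrable M g"
  shows "integrable M (\<lambda>x. f x \<bullet> g x)"
proof (rule Bochner_Integration.integrable_bound)
  show "integrable M (\<lambda>x. (norm (f x))\<^sup>2 + (norm (g x))\<^sup>2)"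
    using assms by (auto simp: square_integrable_def)
  have [measurable]: "f \<in> borel_measurable M" "g \<in> borel_measurable M"
    using assms by (auto simp: square_integrable_def)
  show "(\<lambda>x. f x \<bullet> g x) \<in> borel_measurable M" by measurable
  show "AE x in M. norm (f x \<bullet> g x) \<le> norm ((norm (f x))\<^sup>2 + (norm (g x))\<^sup>2)"
  proof (rule AE_I2)
    fix x
    have "norm (f x \<bullet> g x) \<le> norm (f x) * norm (g x)" by (simp add: Cauchy_Schwarz_ineq2)
    also have "\<dots> \<le> (norm (f x))\<^sup>2 + (norm (g x))\<^sup>2"
      using norm_prod_le_sum_squares[of "norm (f x)" "norm (g x)"] by (simp add: abs_mult)
    finally show "norm (f x \<bullet> g x) \<le> norm ((norm (f x))\<^sup>2 + (norm (g x))\<^sup>2)" by simp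
  qed
qed

lemma norm_add_square_le:
  fixes a b :: "'a::real_normed_vector"
  shows "(norm (a + b))\<^sup>2 \<le> 2 * (norm a)\<^sup>2 + 2 * (norm b)\<^sup>2"
proof -
  have "(norm (a + b))\<^sup>2 \<le> (norm a + norm b)\<^sup>2" by (intro power_mono norm_triangle_ineq) auto
  also have "\<dots> \<le> 2 * (norm a)\<^sup>2 + 2 * (norm b)\<^sup>2"
    using zero_le_power2[of "norm a - norm b"] by (simp add: power2_sum power2_diff)
  finally show ?thesis .
qed

lemma square_integrable_add:
  assumes "square_integrable M f" "square_integrable M g"
  shows "square_integrable M (\<lambda>x. f x + g x)"
proof -
  have [measurable]: "f \<in> borel_measurable M" "g \<in> borel_measurable M"
    using assms by (auto simp: square_integrable_def)
  have "integrable M (\<lambda>x. (norm (f x + g x))\<^sup>2)"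
  proof (rule Bochner_Integration.integrable_bound)
    show "integrable M (\<lambda>x. 2 * (norm (f x))\<^sup>2 + 2 * (norm (g x))\<^sup>2)"
      using assms by (auto simp: square_integrable_def)
  qed (use norm_add_square_le in auto)
  then show ?thesis by (simp add: square_integrable_def)
qed

lemma square_integrable_bounded_linear:
  assumes "square_integrable M f" and h: "bounded_linear h"
  shows "square_integrable M (\<lambda>x. h (f x))"
proof -
  obtain K where K: "\<And>x. norm (h x) \<le> norm x * K" "K > 0"
    using bounded_linear.pos_bounded[OF h] by blast
  have [measurable]: "f \<in> borel_measurable M"
    using assms by (auto simp: square_integrable_def)
  have hm: "(\<lambda>x. h (f x)) \<in> borel_measurable M"
    using borel_measurable_continuous_onI[OF linear_continuous_on[OF h]] by measurable
  have "integrable M (\<lambda>x. (norm (h (f x)))\<^sup>2)"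
  proof (rule Bochner_Integration.integrable_bound)
    show "integrable M (\<lambda>x. K\<^sup>2 * (norm (f x))\<^sup>2)"
      using assms by (auto simp: square_integrable_def)
    have "(norm (h (f x)))\<^sup>2 \<le> K\<^sup>2 * (norm (f x))\<^sup>2" for x
      using power_mono[OF K(1)[of "f x"] norm_ge_zero, of 2]
      by (simp add: power_mult_distrib mult.commute)
    then show "AE x in M. norm ((norm (h (f x)))\<^sup>2) \<le> norm (K\<^sup>2 * (norm (f x))\<^sup>2)" by auto
  qed (use hm in measurable)
  with hm show ?thesis by (simp add: square_integrable_def)
qed

lemma square_integrable_zero [simp]: "square_integrable M (\<lambda>x. 0)"
  by (simp add: square_integrable_def)

lemma square_integrable_diff:
  assumes "square_integrable M f" "square_integrable M g"
  shows "square_integrable M (\<lambda>x. f x - g x)"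
  using square_integrable_add[OF assms(1)
      square_integrable_bounded_linear[OF assms(2) bounded_linear_minus[OF bounded_linear_ident]]]
  by simp

lemma square_integrable_sum:
  "(\<And>i. i \<in> I \<Longrightarrow> square_integrable M (f i)) \<Longrightarrow> square_integrable M (\<lambda>x. \<Sum>i\<in>I. f i x)"
  by (induction I rule: infinite_finite_induct) (auto intro: square_integrable_add)

lemma square_integrable_const:
  "finite_measure M \<Longrightarrow> square_integrable M (\<lambda>x. c)"
  by (simp add: square_integrable_def finite_measure.integrable_const)

lemma square_integrable_bounded:
  assumes "finite_measure M" "f \<in> borel_measurable M" "AE x in M. norm (f x) \<le> B"
  shows "square_integrable M f"
  unfolding square_integrable_def
proof (intro conjI assms finite_measure.integrable_const_bound)
  show "AE x in M. norm ((norm (f x))\<^sup>2) \<le> B\<^sup>2"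
    using assms(3) by eventually_elim (simp add: power_mono)
  show "(\<lambda>x. (norm (f x))\<^sup>2) \<in> borel_measurable M" using assms(2) by measurable
qed

lemma square_integrable_integrable:
  assumes "finite_measure M" "square_integrable M f"
  shows "integrable M f"
proof (rule Bochner_Integration.integrable_bound)
  show "integrable M (\<lambda>x. (norm (f x))\<^sup>2 + 1)"
    using assms by (auto simp: square_integrable_def finite_measure.integrable_const)
  have "norm (f x) \<le> (norm (f x))\<^sup>2 + 1" for x
    using norm_prod_le_sum_squares[of "norm (f x)" 1] by simp
  then show "AE x in M. norm (f x) \<le> norm ((norm (f x))\<^sup>2 + 1)" by auto
qed (use assms in \<open>auto simp: square_integrable_def\<close>)

subsection \<open>The unit cell\<close>

text \<open>The set integrals of the statement become plain Bochner integrals over a probability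
  measure, so that constants are integrable and equal to their own mean.\<close>

definition cell_measure :: "vec2 measure" where
  "cell_measure = restrict_space lebesgue unit_cell"

lemma unit_cell_sets [measurable, simp]: "unit_cell \<in> sets lebesgue"
  by (simp add: unit_cell_def)

lemma set_integral_cell:
  fixes f :: "vec2 \<Rightarrow> 'b::{banach, second_countable_topology}"
  shows "(LINT x:unit_cell|lebesgue. f x) = integral\<^sup>L cell_measure f"
  by (simp add: cell_measure_def integral_restrict_space set_lebesgue_integral_def)

lemma space_cell_measure [simp]: "space cell_measure = unit_cell"
  by (simp add: cell_measure_def space_restrict_space)

lemma emeasure_unit_cell: "emeasure lebesgue unit_cell = 1"
proof -
  have "(1::real) = measure lborel unit_cell"
    unfolding unit_cell_def by (subst content_cbox_cart) (auto simp: interval_eq_empty_cart)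
  moreover have "emeasure lborel (cbox 0 1 :: vec2 set) \<noteq> top"
    using emeasure_lborel_cbox_finite[of "0::vec2" 1] by auto
  from emeasure_eq_ennreal_measure[OF this]
  have "emeasure lebesgue unit_cell = ennreal (measure lborel unit_cell)"
    by (simp add: unit_cell_def)
  ultimately show ?thesis by simp
qed

lemma finite_measure_cell [simp]: "finite_measure cell_measure"
proof (rule finite_measureI)
  show "emeasure cell_measure (space cell_measure) \<noteq> \<infinity>"
    unfolding space_cell_measure unfolding cell_measure_def
    by (subst emeasure_restrict_space) (use emeasure_unit_cell unit_cell_sets in auto)
qed

lemma measure_cell [simp]: "measure cell_measure unit_cell = 1"
proof -
  have "emeasure cell_measure unit_cell = 1"
    unfolding cell_measure_def
    by (subst emeasure_restrict_space) (use emeasure_unit_cell unit_cell_sets in auto)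
  then show ?thesis by (simp add: measure_def)
qed

lemma AE_cell_iff: "(AE x in cell_measure. P x) \<longleftrightarrow> (AE x in lebesgue. x \<in> unit_cell \<longrightarrow> P x)"
  unfolding cell_measure_def by (rule AE_restrict_space_iff) (use unit_cell_sets in auto)

lemma borel_measurable_cellI:
  "f \<in> borel_measurable lebesgue \<Longrightarrow> f \<in> borel_measurable cell_measure"
  unfolding cell_measure_def by (rule measurable_restrict_space1)

lemma L2_per_square_integrable: "L2_per f \<Longrightarrow> square_integrable cell_measure f"
  unfolding L2_per_def square_integrable_def
  by (auto simp: borel_measurable_cellI set_integrable_eq cell_measure_def[symmetric])

lemma L2_perI:
  assumes "cell_periodic f" "f \<in> borel_measurable lebesgue" "square_integrable cell_measure f"
  shows "L2_per f"
  using assms unfolding L2_per_def square_integrable_def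
  by (auto simp: set_integrable_eq cell_measure_def[symmetric])

text \<open>The plane is covered by countably many integer translates of the cell, and translates of
  null sets are null. This is needed because uniqueness of cell fields is demanded on the whole
  plane, while energy arguments only see the cell.\<close>

lemma AE_cell_imp_AE_lebesgue:
  assumes "AE x in cell_measure. P x" and per: "\<And>x (k :: int^2). P (x + (\<chi> i. of_int (k $ i))) = P x"
  shows "AE x in lebesgue. P x"
proof -
  have "AE x in lebesgue. x \<in> unit_cell \<longrightarrow> P x" using assms(1) by (simp only: AE_cell_iff)
  then obtain N where N: "N \<in> null_sets lebesgue" "{x. \<not> (x \<in> unit_cell \<longrightarrow> P x)} \<subseteq> N"
    unfolding eventually_ae_filter by auto
  define sh :: "int^2 \<Rightarrow> vec2" where "sh k = (\<chi> i. of_int (k $ i))" for k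
  have "{x. \<not> P x} \<subseteq> (\<Union>k. (+) (sh k) ` N)"
  proof
    fix x assume x: "x \<in> {x. \<not> P x}"
    define k :: "int^2" where "k = (\<chi> i. \<lfloor>x $ i\<rfloor>)"
    define y where "y = x - sh k"
    have "y \<in> unit_cell"
      unfolding unit_cell_def mem_box_cart y_def sh_def k_def by (auto simp: less_imp_le) linarith
    moreover have "\<not> P y" using x per[of y k] by (simp add: y_def sh_def)
    ultimately have "y \<in> N" using N(2) by auto
    then show "x \<in> (\<Union>k. (+) (sh k) ` N)"
      by (intro UN_I[of k] image_eqI[of _ _ y]) (auto simp: y_def)
  qed
  moreover have "(\<Union>k. (+) (sh k) ` N) \<in> null_sets lebesgue"
  proof (rule null_sets_UN')
    show "countable (UNIV :: (int^2) set)" by (rule countableI_type)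
    show "(+) (sh k) ` N \<in> null_sets lebesgue" for k
      using N(1) negligible_translation[of N "sh k"] by (simp add: negligible_iff_null_sets)
  qed
  ultimately show ?thesis unfolding eventually_ae_filter by auto
qed

subsection \<open>Fourier coefficients on the torus\<close>

definition expi :: "int \<times> int \<Rightarrow> vec2 \<Rightarrow> complex" where
  "expi k x = cis (2 * pi * (of_int (fst k) * x $ 1 + of_int (snd k) * x $ 2))"

lemma norm_expi [simp]: "norm (expi k x) = 1" by (simp add: expi_def)

lemma expi_add: "expi (k + l) x = expi k x * expi l x"
  by (simp add: expi_def cis_mult algebra_simps)

lemma cnj_expi: "cnj (expi k x) = expi (- k) x"
  by (simp add: expi_def cis_cnj) (simp add: algebra_simps)

lemma expi_0 [simp]: "expi 0 x = 1" by (simp add: expi_def)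

lemma continuous_on_expi [continuous_intros]: "continuous_on A (expi k)"
  unfolding expi_def by (intro continuous_intros)

lemma measurable_expi [measurable]: "expi k \<in> borel_measurable borel"
  by (intro borel_measurable_continuous_onI continuous_on_expi)

lemma measurable_expi_cell [measurable]: "expi k \<in> borel_measurable cell_measure"
  by (intro borel_measurable_cellI measurable_completion) (simp add: measurable_expi)

text \<open>Fubini for products of one-variable functions: by definition \<open>lborel\<close> is
  the image of a product of one-dimensional measures.\<close>

lemma integral_lborel_prod:
  fixes g :: "'a::euclidean_space \<Rightarrow> real \<Rightarrow> complex"
  assumes "\<And>b. b \<in> Basis \<Longrightarrow> integrable lborel (g b)"
  shows "(\<integral>x. (\<Prod>b\<in>Basis. g b (x \<bullet> b)) \<partial>(lborel::'a measure)) = (\<Prod>b\<in>Basis. \<integral>t. g b t \<partial>lborel)"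
proof -
  interpret product_sigma_finite "\<lambda>_. lborel :: real measure" ..
  have [measurable]: "g b \<in> borel_measurable borel" if "b \<in> Basis" for b
    using assms[OF that] by auto
  have "(\<integral>x. (\<Prod>b\<in>Basis. g b (x \<bullet> b)) \<partial>(lborel::'a measure))
      = (\<integral>f. (\<Prod>b\<in>Basis. g b ((\<Sum>c\<in>Basis. f c *\<^sub>R c) \<bullet> b)) \<partial>(Pi\<^sub>M Basis (\<lambda>_. lborel)))"
    by (subst lborel_def, subst integral_distr) (simp_all add: lborel_eq_real)
  also have "\<dots> = (\<integral>f. (\<Prod>b\<in>Basis. g b (f b)) \<partial>(Pi\<^sub>M Basis (\<lambda>_. lborel)))"
    by (intro Bochner_Integration.integral_cong refl prod.cong) auto
  also have "\<dots> = (\<Prod>b\<in>Basis. \<integral>t. g b t \<partial>lborel)"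
    by (rule product_integral_prod) (use assms in auto)
  finally show ?thesis .
qed

lemma integral_cis_period:
  "(\<integral>t. indicator {0..1} t *\<^sub>R cis (2 * pi * of_int k * t) \<partial>lborel) = (if k = 0 then 1 else 0)"
proof (cases "k = 0")
  case False
  define F where "F t = cis (2 * pi * of_int k * t) / (2 * pi * \<i> * of_int k)" for t
  have d: "(F has_vector_derivative cis (2 * pi * of_int k * t)) (at t within {0..1})" for t
  proof -
    have "((\<lambda>t. cis (2 * pi * of_int k * t)) has_vector_derivative
        (2 * pi * of_int k) *\<^sub>R (\<i> * cis (2 * pi * of_int k * t))) (at t within {0..1})"
      unfolding has_vector_derivative_def
      by (auto intro!: derivative_eq_intros simp: scaleR_conv_of_real algebra_simps)
    from has_vector_derivative_divide[OF this, of "2 * pi * \<i> * of_int k"] show ?thesis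
      using False by (simp add: F_def[abs_def] scaleR_conv_of_real)
  qed
  have "(\<integral>t. indicator {0..1} t *\<^sub>R cis (2 * pi * of_int k * t) \<partial>lborel) = F 1 - F 0"
    by (intro integral_FTC_Icc d continuous_intros) auto
  also have "F 1 - F 0 = 0"
    using cis_multiple_2pi[of "of_int k"] by (simp add: F_def diff_divide_distrib[symmetric] mult.assoc)
  finally show ?thesis using False by simp
qed simp

lemma integral_expi: "integral\<^sup>L cell_measure (expi k) = (if k = 0 then 1 else 0)"
proof -
  define g :: "vec2 \<Rightarrow> real \<Rightarrow> complex" where
    "g b t = indicator {0..1} t *\<^sub>R cis (2 * pi * of_int (if b = axis 1 1 then fst k else snd k) * t)" for b t
  have B: "(Basis :: vec2 set) = {axis 1 1, axis 2 1}" "axis 1 1 \<noteq> (axis 2 1 :: vec2)"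
    by (auto simp: Basis_vec_def axis_eq_axis) (use exhaust_2 in blast)
  have int: "integrable lborel (g b)" for b
    unfolding g_def by (intro borel_integrable_compact continuous_intros) auto
  have "integral\<^sup>L cell_measure (expi k) = (\<integral>x. indicator unit_cell x *\<^sub>R expi k x \<partial>lebesgue)"
    using set_integral_cell[of "expi k"] by (simp add: set_lebesgue_integral_def)
  also have "\<dots> = (\<integral>x. indicator unit_cell x *\<^sub>R expi k x \<partial>lborel)"
    by (rule integral_completion) (use measurable_expi in \<open>auto simp: unit_cell_def\<close>)
  also have "\<dots> = (\<integral>x. (\<Prod>b\<in>Basis. g b (x \<bullet> b)) \<partial>lborel)"
  proof (rule Bochner_Integration.integral_cong[OF refl])
    fix x :: vec2
    have "indicator unit_cell x = (indicator {0..1} (x $ 1) * indicator {0..1} (x $ 2) :: real)"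
      by (auto simp: unit_cell_def mem_box_cart indicator_def forall_2)
    then show "indicator unit_cell x *\<^sub>R expi k x = (\<Prod>b\<in>Basis. g b (x \<bullet> b))"
      using B(2) by (simp add: B(1) g_def expi_def cis_mult[symmetric] distrib_left inner_axis mult.assoc)
  qed
  also have "\<dots> = (\<Prod>b\<in>Basis. \<integral>t. g b t \<partial>lborel)"
    by (rule integral_lborel_prod) (rule int)
  also have "\<dots> = (if k = 0 then 1 else 0)"
    using B(2) integral_cis_period[of "fst k"] integral_cis_period[of "snd k"]
    by (simp add: B(1) g_def prod_eq_iff)
  finally show ?thesis .
qed

lemma expi_square_integrable: "square_integrable cell_measure (expi k)"
  by (rule square_integrable_bounded[where B = 1]) auto

lemma square_integrable_of_real:
  "square_integrable M f \<Longrightarrow> square_integrable M (\<lambda>x. complex_of_real (f x))"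
  by (rule square_integrable_bounded_linear[OF _ bounded_linear_of_real])

lemma square_integrable_cmult:
  fixes f :: "'a \<Rightarrow> complex"
  shows "square_integrable M f \<Longrightarrow> square_integrable M (\<lambda>x. c * f x)"
  by (rule square_integrable_bounded_linear[OF _ bounded_linear_mult_right])

lemma square_integrable_cnj:
  "square_integrable M f \<Longrightarrow> square_integrable M (\<lambda>x. cnj (f x))"
  by (rule square_integrable_bounded_linear[OF _ bounded_linear_cnj])

text \<open>The kernel is \<open>expi k\<close> and not its conjugate, so this is the usual
  coefficient at \<open>- k\<close>. Accordingly the Fourier series of \<open>f\<close> has the
  terms \<open>fourier f k * cnj (expi k x)\<close>.\<close>

definition fourier :: "(vec2 \<Rightarrow> real) \<Rightarrow> int \<times> int \<Rightarrow> complex" where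
  "fourier f k = (\<integral>x. of_real (f x) * expi k x \<partial>cell_measure)"

definition trig_poly :: "(int \<times> int) set \<Rightarrow> (int \<times> int \<Rightarrow> complex) \<Rightarrow> vec2 \<Rightarrow> complex" where
  "trig_poly F a x = (\<Sum>k\<in>F. a k * expi k x)"

lemma trig_poly_square_integrable: "square_integrable cell_measure (trig_poly F a)"
  unfolding trig_poly_def[abs_def]
  by (intro square_integrable_sum square_integrable_cmult expi_square_integrable)

lemma trig_poly_superset:
  assumes "finite F'" "F \<subseteq> F'"
  shows "trig_poly F a = trig_poly F' (\<lambda>k. if k \<in> F then a k else 0)"
proof
  fix x
  have "trig_poly F' (\<lambda>k. if k \<in> F then a k else 0) x = (\<Sum>k\<in>F'. if k \<in> F then a k * expi k x else 0)"
    unfolding trig_poly_def by (intro sum.cong) auto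
  also have "\<dots> = trig_poly F a x"
    unfolding trig_poly_def using assms by (simp add: sum.inter_restrict[symmetric] Int_absorb1)
  finally show "trig_poly F a x = trig_poly F' (\<lambda>k. if k \<in> F then a k else 0) x" ..
qed

section \<open>Density of trigonometric polynomials in the square integrable functions\<close>

definition trig_real :: "(vec2 \<Rightarrow> real) \<Rightarrow> bool" where
  "trig_real f \<longleftrightarrow> (\<exists>F a. finite F \<and> (\<forall>x. complex_of_real (f x) = trig_poly F a x))"

lemma trig_real_add:
  assumes "trig_real f" "trig_real g"
  shows "trig_real (\<lambda>x. f x + g x)"
proof -
  obtain F a G b where F: "finite F" "\<And>x. complex_of_real (f x) = trig_poly F a x"
    and G: "finite G" "\<And>x. complex_of_real (g x) = trig_poly G b x"
    using assms unfolding trig_real_def by blast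
  define a' where "a' k = (if k \<in> F then a k else 0) + (if k \<in> G then b k else 0)" for k
  have "complex_of_real (f x + g x) = trig_poly (F \<union> G) a' x" for x
    using trig_poly_superset[of "F \<union> G" F a] trig_poly_superset[of "F \<union> G" G b] F G
    by (simp add: trig_poly_def a'_def distrib_right sum.distrib)
  then show ?thesis using F(1) G(1) unfolding trig_real_def by blast
qed

lemma trig_poly_mult_closed:
  assumes "finite F" "finite G"
  obtains c where "\<And>x. trig_poly F a x * trig_poly G b x = trig_poly ((\<lambda>(k, l). k + l) ` (F \<times> G)) c x"
proof -
  define c where "c m = (\<Sum>p | p \<in> F \<times> G \<and> fst p + snd p = m. a (fst p) * b (snd p))" for m
  have "trig_poly F a x * trig_poly G b x = trig_poly ((\<lambda>(k, l). k + l) ` (F \<times> G)) c x" for x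
  proof -
    have "trig_poly F a x * trig_poly G b x
        = (\<Sum>p\<in>F \<times> G. a (fst p) * b (snd p) * expi (fst p + snd p) x)"
      unfolding trig_poly_def sum_product sum.cartesian_product
      by (intro sum.cong) (auto simp: expi_add)
    also have "\<dots> = (\<Sum>m\<in>(\<lambda>(k, l). k + l) ` (F \<times> G).
        \<Sum>p | p \<in> F \<times> G \<and> (\<lambda>(k, l). k + l) p = m. a (fst p) * b (snd p) * expi (fst p + snd p) x)"
      by (rule sum.image_gen) (use assms in auto)
    also have "\<dots> = trig_poly ((\<lambda>(k, l). k + l) ` (F \<times> G)) c x"
      unfolding trig_poly_def c_def sum_distrib_right
      by (intro sum.cong) (auto simp: case_prod_beta)
    finally show ?thesis .
  qed
  then show ?thesis by (rule that)
qed

lemma trig_real_mult: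
  assumes "trig_real f" "trig_real g"
  shows "trig_real (\<lambda>x. f x * g x)"
proof -
  obtain F a G b where F: "finite F" "\<And>x. complex_of_real (f x) = trig_poly F a x"
    and G: "finite G" "\<And>x. complex_of_real (g x) = trig_poly G b x"
    using assms unfolding trig_real_def by blast
  obtain c where "\<And>x. trig_poly F a x * trig_poly G b x = trig_poly ((\<lambda>(k, l). k + l) ` (F \<times> G)) c x"
    using trig_poly_mult_closed[OF F(1) G(1)] by blast
  then have "\<forall>x. complex_of_real (f x * g x) = trig_poly ((\<lambda>(k, l). k + l) ` (F \<times> G)) c x"
    using F G by simp
  moreover have "finite ((\<lambda>(k, l). k + l) ` (F \<times> G))" using F(1) G(1) by simp
  ultimately show ?thesis unfolding trig_real_def by (intro exI conjI)
qed

lemma trig_real_const: "trig_real (\<lambda>x. c)"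
  unfolding trig_real_def
  by (rule exI[of _ "{0}"], rule exI[of _ "\<lambda>_. of_real c"]) (simp add: trig_poly_def)

lemma trig_real_Re: "trig_real (\<lambda>x. Re (c * expi k x))"
proof (cases "k = - k")
  \<comment> \<open>For \<open>k = - k\<close> the set \<open>{k, - k}\<close> is a singleton, and
    the two-term formula of the other case would lose one of its halves.\<close>
  case True
  then have "k = 0" by (simp add: prod_eq_iff)
  then show ?thesis using trig_real_const by simp
next
  case False
  have re: "complex_of_real (Re (c * z)) = c / 2 * z + cnj c / 2 * cnj z" for z
    by (auto simp: complex_eq_iff field_simps)
  have "complex_of_real (Re (c * expi k x)) = trig_poly {k, - k} (\<lambda>l. if l = k then c / 2 else cnj c / 2) x" for x
    unfolding re trig_poly_def using False by (simp add: cnj_expi)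
  then show ?thesis unfolding trig_real_def
    by (intro exI[of _ "{k, - k}"] exI[of _ "\<lambda>l. if l = k then c / 2 else cnj c / 2"]) simp
qed

text \<open>A real-linear functional of complex variables is the real part of a complex-linear one.
  The minus signs in the coefficients compensate \<open>\<i> * \<i> = - 1\<close>.\<close>

lemma bounded_linear_complex_pair:
  fixes f :: "complex \<times> complex \<Rightarrow> real"
  assumes "bounded_linear f"
  shows "f (z, w) = Re (Complex (f (1, 0)) (- f (\<i>, 0)) * z) + Re (Complex (f (0, 1)) (- f (0, \<i>)) * w)"
proof -
  interpret bounded_linear f by fact
  have "(z, w) = Re z *\<^sub>R (1, 0) + Im z *\<^sub>R (\<i>, 0) + (Re w *\<^sub>R (0, 1) + Im w *\<^sub>R (0, \<i>))"
    by (auto simp: complex_eq_iff)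
  then have "f (z, w) = f (Re z *\<^sub>R (1, 0) + Im z *\<^sub>R (\<i>, 0) + (Re w *\<^sub>R (0, 1) + Im w *\<^sub>R (0, \<i>)))"
    by (rule arg_cong)
  also have "\<dots> = f (Re z *\<^sub>R (1, 0)) + f (Im z *\<^sub>R (\<i>, 0)) + (f (Re w *\<^sub>R (0, 1)) + f (Im w *\<^sub>R (0, \<i>)))"
    by (simp only: add)
  also have "\<dots> = Re z * f (1, 0) + Im z * f (\<i>, 0) + (Re w * f (0, 1) + Im w * f (0, \<i>))"
    by (simp only: scaleR real_scaleR_def)
  finally show ?thesis by (simp only: times_complex.simps complex.sel mult.commute)
qed
text \<open>Embeds the torus into two complex coordinates. Polynomials in the real coordinates of
  the image pull back to trigonometric polynomials, which is how Stone-Weierstrass becomes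
  applicable.\<close>

definition torus_map :: "vec2 \<Rightarrow> complex \<times> complex" where
  "torus_map x = (expi (1, 0) x, expi (0, 1) x)"

lemma trig_real_polynomial:
  "real_polynomial_function p \<Longrightarrow> trig_real (\<lambda>x. p (torus_map x))"
proof (induction rule: real_polynomial_function.induct)
  case (linear f)
  have "(\<lambda>x. f (torus_map x)) = (\<lambda>x. Re (Complex (f (1, 0)) (- f (\<i>, 0)) * expi (1, 0) x)
      + Re (Complex (f (0, 1)) (- f (0, \<i>)) * expi (0, 1) x))"
    unfolding torus_map_def by (rule ext) (rule bounded_linear_complex_pair[OF linear])
  then show ?case
    by (rule ssubst[where P = trig_real]) (rule trig_real_add[OF trig_real_Re trig_real_Re])
next
  case (const c)
  show ?case by (rule trig_real_const)
next
  case (add f g)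
  from trig_real_add[OF add.IH] show ?case .
next
  case (mult f g)
  from trig_real_mult[OF mult.IH] show ?case .
qed

definition trig_approx :: "(vec2 \<Rightarrow> real) \<Rightarrow> bool" where
  "trig_approx f \<longleftrightarrow> square_integrable cell_measure f \<and>
     (\<forall>e>0. \<exists>q. trig_real q \<and> (\<integral>x. (f x - q x)\<^sup>2 \<partial>cell_measure) < e)"

lemma trig_real_square_integrable:
  assumes "trig_real q"
  shows "square_integrable cell_measure q"
proof -
  obtain F a where "\<And>x. complex_of_real (q x) = trig_poly F a x"
    using assms unfolding trig_real_def by blast
  then have "q = (\<lambda>x. Re (trig_poly F a x))" by (metis Re_complex_of_real)
  then show ?thesis
    using square_integrable_bounded_linear[OF trig_poly_square_integrable bounded_linear_Re] by simp
qed

lemma trig_approx_limit: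
  assumes f: "square_integrable cell_measure f" and u: "\<And>n. trig_approx (u n)"
    and lim: "(\<lambda>n. \<integral>x. (f x - u n x)\<^sup>2 \<partial>cell_measure) \<longlonglongrightarrow> 0"
  shows "trig_approx f"
  unfolding trig_approx_def
proof (intro conjI f allI impI)
  fix e :: real assume "e > 0"
  \<comment> \<open>A quarter of \<open>e\<close> for each error, since
    \<open>norm_add_square_le\<close> doubles both.\<close>
  then have "eventually (\<lambda>n. (\<integral>x. (f x - u n x)\<^sup>2 \<partial>cell_measure) < e / 4) sequentially"
    by (intro order_tendstoD(2)[OF lim]) auto
  then obtain n where n: "(\<integral>x. (f x - u n x)\<^sup>2 \<partial>cell_measure) < e / 4"
    by (auto simp: eventually_sequentially)
  have su: "square_integrable cell_measure (u n)"
    using u[of n] by (simp add: trig_approx_def)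
  obtain q where q: "trig_real q" "(\<integral>x. (u n x - q x)\<^sup>2 \<partial>cell_measure) < e / 4"
    using u[of n] \<open>e > 0\<close> unfolding trig_approx_def by (meson divide_pos_pos zero_less_numeral)
  note sq = trig_real_square_integrable[OF q(1)]
  have i: "integrable cell_measure (\<lambda>x. (f x - u n x)\<^sup>2)" "integrable cell_measure (\<lambda>x. (u n x - q x)\<^sup>2)"
    "integrable cell_measure (\<lambda>x. (f x - q x)\<^sup>2)"
    using square_integrable_diff[OF f su] square_integrable_diff[OF su sq] square_integrable_diff[OF f sq]
    by (simp_all add: square_integrable_def)
  have "(\<integral>x. (f x - q x)\<^sup>2 \<partial>cell_measure) \<le> (\<integral>x. 2 * (f x - u n x)\<^sup>2 + 2 * (u n x - q x)\<^sup>2 \<partial>cell_measure)"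
  proof (rule integral_mono)
    fix x
    show "(f x - q x)\<^sup>2 \<le> 2 * (f x - u n x)\<^sup>2 + 2 * (u n x - q x)\<^sup>2"
      using norm_add_square_le[of "f x - u n x" "u n x - q x"] by simp
  qed (use i in auto)
  also have "\<dots> = 2 * (\<integral>x. (f x - u n x)\<^sup>2 \<partial>cell_measure) + 2 * (\<integral>x. (u n x - q x)\<^sup>2 \<partial>cell_measure)"
    using i by simp
  also have "\<dots> < e" using n q(2) by simp
  finally show "\<exists>q. trig_real q \<and> (\<integral>x. (f x - q x)\<^sup>2 \<partial>cell_measure) < e" using q(1) by blast
qed

text \<open>A continuous map from a compact space to a Hausdorff space is closed, hence a quotient
  map onto its image, so functions constant on its fibres descend continuously.\<close>

lemma continuous_on_factor_compact:
  fixes f :: "'a::topological_space \<Rightarrow> 'b::t2_space" and u :: "'a \<Rightarrow> 'c::topological_space"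
  assumes S: "compact S" and f: "continuous_on S f" and u: "continuous_on S u"
    and fib: "\<And>x y. x \<in> S \<Longrightarrow> y \<in> S \<Longrightarrow> f x = f y \<Longrightarrow> u x = u y"
  obtains F where "continuous_on (f ` S) F" "\<And>x. x \<in> S \<Longrightarrow> F (f x) = u x"
proof -
  define F where "F z = u (SOME x. x \<in> S \<and> f x = z)" for z
  have F: "F (f x) = u x" if "x \<in> S" for x
  proof -
    have "(SOME y. y \<in> S \<and> f y = f x) \<in> S \<and> f (SOME y. y \<in> S \<and> f y = f x) = f x"
      by (rule someI[of "\<lambda>y. y \<in> S \<and> f y = f x" x]) (use that in simp)
    then show ?thesis unfolding F_def using fib that by metis
  qed
  have "continuous_on (f ` S) F"
  proof (subst continuous_on_closed_invariant, intro allI impI)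
    fix B :: "'c set" assume B: "closed B"
    obtain A where A: "closed A" "A \<inter> S = u -` B \<inter> S"
      using u B unfolding continuous_on_closed_invariant by blast
    have "compact (f ` (A \<inter> S))"
      using S A(1) by (intro compact_continuous_image continuous_on_subset[OF f])
        (auto simp: Int_commute compact_Int_closed)
    then have "closed (f ` (A \<inter> S))" by (rule compact_imp_closed)
    moreover have "f ` (A \<inter> S) \<inter> f ` S = F -` B \<inter> f ` S"
      unfolding A(2) using F by auto
    ultimately show "\<exists>A. closed A \<and> A \<inter> f ` S = F -` B \<inter> f ` S" by blast
  qed
  then show ?thesis using F that by blast
qed

lemma cis_two_pi_eq_imp:
  assumes "cis (2 * pi * s) = cis (2 * pi * t)" "s \<in> {0..1}" "t \<in> {0..1}" "s \<noteq> t"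
  shows "s \<in> {0, 1} \<and> t \<in> {0, 1}"
proof -
  have "sin (2 * pi * s) = sin (2 * pi * t) \<and> cos (2 * pi * s) = cos (2 * pi * t)"
    using assms(1) by (simp add: complex_eq_iff)
  then obtain n :: int where "2 * pi * s = 2 * pi * t + 2 * pi * n"
    unfolding sin_cos_eq_iff by blast
  then have "2 * pi * s = 2 * pi * (t + n)" by (simp add: distrib_left)
  then have s: "s = t + of_int n" by simp
  then have "\<bar>of_int n :: real\<bar> \<le> of_int 1" "n \<noteq> 0" using assms by auto
  then have "\<bar>n\<bar> \<le> 1" by linarith
  with \<open>n \<noteq> 0\<close> have "n = 1 \<or> n = -1" by auto
  then show ?thesis using s assms by auto
qed

lemma continuous_on_torus_map: "continuous_on A torus_map"
  unfolding torus_map_def[abs_def] by (intro continuous_intros)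

text \<open>Inside the cell, two different values of a coordinate with the same exponential must be
  0 and 1, so only boundary points are identified.\<close>

lemma torus_map_eq_imp:
  assumes "torus_map x = torus_map y" "x \<in> unit_cell" "y \<in> unit_cell" "x \<noteq> y"
  shows "x \<notin> box 0 1 \<and> y \<notin> box 0 1"
proof -
  have c: "cis (2 * pi * x $ i) = cis (2 * pi * y $ i)" for i
    using assms(1) exhaust_2[of i] by (auto simp: torus_map_def expi_def)
  obtain i where "x $ i \<noteq> y $ i" using assms(4) by (auto simp: vec_eq_iff)
  with cis_two_pi_eq_imp[OF c[of i]] assms(2,3) have "x $ i \<in> {0, 1} \<and> y $ i \<in> {0, 1}"
    by (auto simp: unit_cell_def mem_box_cart)
  then show ?thesis by (auto simp: mem_box_cart intro!: exI[of _ i])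
qed

lemma continuous_square_integrable_cell:
  fixes f :: "vec2 \<Rightarrow> real"
  assumes "continuous_on unit_cell f"
  shows "square_integrable cell_measure f"
proof -
  have "bounded (f ` unit_cell)"
    using assms by (intro compact_imp_bounded compact_continuous_image) (auto simp: unit_cell_def)
  then obtain B where "\<And>x. x \<in> unit_cell \<Longrightarrow> norm (f x) \<le> B"
    unfolding bounded_iff by auto
  then show ?thesis
    by (intro square_integrable_bounded[where B = B] AE_I2)
      (auto simp: continuous_imp_measurable_on_sets_lebesgue[OF assms unit_cell_sets, folded cell_measure_def])
qed

text \<open>The zero boundary values make \<open>u\<close> factor through the torus, where Stone-Weierstrass applies.\<close>

lemma trig_approx_continuous:
  assumes u: "continuous_on unit_cell u" and zero: "\<And>x. x \<notin> box 0 1 \<Longrightarrow> u x = 0"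
  shows "trig_approx u"
  unfolding trig_approx_def
proof (intro conjI allI impI)
  show su: "square_integrable cell_measure u" by (rule continuous_square_integrable_cell[OF u])
  fix e :: real assume "e > 0"
  have cell: "compact unit_cell" by (simp add: unit_cell_def)
  have fib: "u x = u y" if "x \<in> unit_cell" "y \<in> unit_cell" "torus_map x = torus_map y" for x y
    using torus_map_eq_imp[OF that(3,1,2)] zero by (cases "x = y") auto
  obtain F where F: "continuous_on (torus_map ` unit_cell) F" "\<And>x. x \<in> unit_cell \<Longrightarrow> F (torus_map x) = u x"
    using continuous_on_factor_compact[OF cell continuous_on_torus_map u fib] by blast
  \<comment> \<open>The cap at 1 gives \<open>d\<^sup>2 \<le> d\<close>, so a uniform error below
    \<open>d\<close> yields a mean square error of at most \<open>d\<close>, which is less than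
    \<open>e\<close>.\<close>
  define d where "d = min 1 (e / 2)"
  have d: "d > 0" "d \<le> 1" "d < e" using \<open>e > 0\<close> by (auto simp: d_def)
  have "compact (torus_map ` unit_cell)"
    by (intro compact_continuous_image continuous_on_torus_map cell)
  from Stone_Weierstrass_real_polynomial_function[OF this F(1) d(1)]
  obtain p where p: "real_polynomial_function p" "\<And>z. z \<in> torus_map ` unit_cell \<Longrightarrow> \<bar>F z - p z\<bar> < d"
    by blast
  have q: "trig_real (\<lambda>x. p (torus_map x))" by (rule trig_real_polynomial[OF p(1)])
  have b: "(u x - p (torus_map x))\<^sup>2 \<le> d" if "x \<in> unit_cell" for x
  proof -
    have "\<bar>u x - p (torus_map x)\<bar> \<le> d" using p(2)[of "torus_map x"] F(2)[of x] that by auto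
    from power_mono[OF this, of 2] have "(u x - p (torus_map x))\<^sup>2 \<le> d\<^sup>2" by simp
    also have "\<dots> \<le> d" using d mult_left_le[of d d] by (simp add: power2_eq_square)
    finally show ?thesis .
  qed
  have "(\<integral>x. (u x - p (torus_map x))\<^sup>2 \<partial>cell_measure) \<le> (\<integral>x. d \<partial>cell_measure)"
    using square_integrable_diff[OF su trig_real_square_integrable[OF q]] b
    by (intro integral_mono) (auto simp: square_integrable_def finite_measure.integrable_const)
  also have "\<dots> = d" by simp
  finally show "\<exists>q. trig_real q \<and> (\<integral>x. (u x - q x)\<^sup>2 \<partial>cell_measure) < e" using q d(3) by force
qed

lemma AE_cell_box: "AE x in cell_measure. x \<in> box 0 1"
proof -
  have "cbox 0 1 - box 0 1 \<in> null_sets (lebesgue :: vec2 measure)"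
    using negligible_frontier_interval by (simp add: negligible_iff_null_sets)
  then show ?thesis
    unfolding AE_cell_iff unfolding eventually_ae_filter unit_cell_def
    by (intro bexI[of _ "cbox 0 1 - box 0 1"]) auto
qed

text \<open>A Lebesgue measurable function is an a.e. limit of continuous ones. After a modification
  that keeps them bounded and makes them vanish on the boundary of the cell, dominated convergence
  turns this into convergence in mean square.\<close>

lemma trig_approx_bounded:
  fixes f :: "vec2 \<Rightarrow> real"
  assumes f: "f \<in> borel_measurable cell_measure" and K: "\<And>x. \<bar>f x\<bar> \<le> K"
  shows "trig_approx f"
proof -
  have f0: "(\<lambda>x. if x \<in> unit_cell then f x else 0) \<in> borel_measurable lebesgue"
    using f unfolding cell_measure_def by (subst borel_measurable_if) auto
  obtain N g where N: "negligible N" and g: "\<And>n. continuous_on UNIV (g n)"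
    and lim: "\<And>x. x \<notin> N \<Longrightarrow> (\<lambda>n. g n x) \<longlonglongrightarrow> (if x \<in> unit_cell then f x else 0)"
    using lebesgue_measurable_imp_measurable_on[OF f0, of UNIV] unfolding measurable_on_def by auto
  \<comment> \<open>The first factor vanishes off the open cell and equals 1 eventually at each
    interior point. The clamp to \<open>[- K, K]\<close> supplies the dominating constant and does
    not affect the limit, as \<open>f\<close> stays in that interval.\<close>
  define u where "u n x = min 1 (real n * infdist x (- box 0 1)) * max (- K) (min K (g n x))" for n x
  have K0: "K \<ge> 0" using K[of 0] by linarith
  have cu: "continuous_on A (u n)" for n A
    unfolding u_def by (intro continuous_intros continuous_on_subset[OF g]) auto
  have ub: "\<bar>u n x\<bar> \<le> K" for n x
  proof -
    have "\<bar>max (- K) (min K (g n x))\<bar> \<le> K" using K0 by auto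
    moreover have "\<bar>min 1 (real n * infdist x (- box 0 1))\<bar> \<le> 1"
      using infdist_nonneg[of x "- box 0 1"] by (simp add: min_def)
    ultimately show ?thesis
      unfolding u_def abs_mult using mult_mono[of "\<bar>min 1 (real n * infdist x (- box 0 1))\<bar>" 1 "\<bar>max (- K) (min K (g n x))\<bar>" K] by simp
  qed
  have "u n x = 0" if "x \<notin> box 0 1" for n x
    using that by (simp add: u_def infdist_zero)
  then have ta: "trig_approx (u n)" for n by (intro trig_approx_continuous cu)
  have uf: "AE x in cell_measure. (\<lambda>n. u n x) \<longlonglongrightarrow> f x"
  proof -
    have "AE x in cell_measure. x \<notin> N"
      using N unfolding AE_cell_iff unfolding negligible_iff_null_sets eventually_ae_filter by (intro bexI[of _ N]) auto
    with AE_cell_box show ?thesis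
    proof eventually_elim
      case (elim x)
      have xc: "x \<in> unit_cell" using elim(1) box_subset_cbox unfolding unit_cell_def by blast
      have l1: "(\<lambda>n. g n x) \<longlonglongrightarrow> f x" using lim[OF elim(2)] xc by simp
      have "(\<lambda>n. max (- K) (min K (g n x))) \<longlonglongrightarrow> max (- K) (min K (f x))"
        by (intro tendsto_intros l1)
      moreover have "max (- K) (min K (f x)) = f x" using K[of x] by auto
      ultimately have l2: "(\<lambda>n. max (- K) (min K (g n x))) \<longlonglongrightarrow> f x" by simp
      have "(0::vec2) \<in> - box 0 1" by (simp add: mem_box_cart)
      then have "infdist x (- box 0 1) \<noteq> 0"
        using in_closed_iff_infdist_zero[of "- box (0::vec2) 1" x] elim(1) by (auto simp: open_box)
      then have pos: "infdist x (- box 0 1) > 0" using infdist_nonneg[of x "- box 0 1"] by linarith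
      obtain m :: nat where m: "1 / infdist x (- box 0 1) < real m" using reals_Archimedean2 by blast
      have "1 \<le> real n * infdist x (- box 0 1)" if "n \<ge> m" for n
      proof -
        have "1 / infdist x (- box 0 1) \<le> real n" using m that by linarith
        then show ?thesis using pos by (simp add: field_simps)
      qed
      then have "eventually (\<lambda>n. max (- K) (min K (g n x)) = u n x) sequentially"
        unfolding eventually_sequentially u_def by (intro exI[of _ m]) auto
      then show ?case using l2 by (rule Lim_transform_eventually[rotated])
    qed
  qed
  have fs: "square_integrable cell_measure f"
    using K by (intro square_integrable_bounded[where B = K] f) auto
  have um: "u n \<in> borel_measurable cell_measure" for n
    using ta[of n] by (simp add: trig_approx_def square_integrable_def)
  have "(\<lambda>n. \<integral>x. (f x - u n x)\<^sup>2 \<partial>cell_measure) \<longlonglongrightarrow> (\<integral>x. 0 \<partial>cell_measure)"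
  proof (rule integral_dominated_convergence[where w = "\<lambda>x. (2 * K)\<^sup>2"])
    show "AE x in cell_measure. (\<lambda>n. (f x - u n x)\<^sup>2) \<longlonglongrightarrow> 0"
      using uf
    proof eventually_elim
      case (elim x)
      from tendsto_power[OF tendsto_diff[OF tendsto_const elim], of "f x" 2] show ?case by simp
    qed
    fix n
    have "norm ((f x - u n x)\<^sup>2) \<le> (2 * K)\<^sup>2" for x
    proof -
      have "\<bar>f x - u n x\<bar> \<le> 2 * K" using K[of x] ub[of n x] by linarith
      from power_mono[OF this, of 2] show ?thesis by simp
    qed
    then show "AE x in cell_measure. norm ((f x - u n x)\<^sup>2) \<le> (2 * K)\<^sup>2" by simp
  qed (use f um in \<open>auto simp: finite_measure.integrable_const\<close>)
  then show ?thesis by (intro trig_approx_limit[OF fs ta]) simp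
qed

text \<open>Truncation at height \<open>n\<close> changes \<open>f\<close> by at most
  \<open>\<bar>f\<bar>\<close> and not at all, pointwise, once \<open>n\<close> is large; so the
  truncations converge in mean square.\<close>

lemma trig_approx_square_integrable:
  fixes f :: "vec2 \<Rightarrow> real"
  assumes fs: "square_integrable cell_measure f"
  shows "trig_approx f"
proof -
  define u where "u n x = max (- real n) (min (real n) (f x))" for n x
  have f: "f \<in> borel_measurable cell_measure" using fs by (simp add: square_integrable_def)
  have um: "u n \<in> borel_measurable cell_measure" for n
    unfolding u_def using f by measurable
  have ta: "trig_approx (u n)" for n
    by (rule trig_approx_bounded[OF um, of _ "real n"]) (auto simp: u_def)
  have "(\<lambda>n. \<integral>x. (f x - u n x)\<^sup>2 \<partial>cell_measure) \<longlonglongrightarrow> (\<integral>x. 0 \<partial>cell_measure)"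
  proof (rule integral_dominated_convergence[where w = "\<lambda>x. (f x)\<^sup>2"])
    show "AE x in cell_measure. (\<lambda>n. (f x - u n x)\<^sup>2) \<longlonglongrightarrow> 0"
    proof (rule AE_I2)
      fix x
      obtain m :: nat where m: "\<bar>f x\<bar> < real m" using reals_Archimedean2 by blast
      have "eventually (\<lambda>n. (f x - u n x)\<^sup>2 = 0) sequentially"
        unfolding eventually_sequentially u_def using m by (intro exI[of _ m]) auto
      then show "(\<lambda>n. (f x - u n x)\<^sup>2) \<longlonglongrightarrow> 0" by (rule tendsto_eventually)
    qed
    fix n
    have "norm ((f x - u n x)\<^sup>2) \<le> (f x)\<^sup>2" for x
    proof -
      have "\<bar>f x - u n x\<bar> \<le> \<bar>f x\<bar>" unfolding u_def by (auto simp: max_def min_def)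
      from power_mono[OF this, of 2] show ?thesis by simp
    qed
    then show "AE x in cell_measure. norm ((f x - u n x)\<^sup>2) \<le> (f x)\<^sup>2" by simp
  qed (use f fs um in \<open>auto simp: square_integrable_def\<close>)
  then show ?thesis by (intro trig_approx_limit[OF fs ta]) simp
qed

section \<open>Bessel's inequality and Parseval's identity\<close>

lemma fourier_0: "fourier f 0 = of_real (integral\<^sup>L cell_measure f)"
  by (simp add: fourier_def)

lemma cnj_fourier: "cnj (fourier f k) = (\<integral>x. of_real (f x) * cnj (expi k x) \<partial>cell_measure)"
  unfolding fourier_def by (subst Bochner_Integration.integral_cnj[symmetric]) simp

context
  fixes h :: "vec2 \<Rightarrow> real" and Y :: "(int \<times> int) set" and r :: "vec2 \<Rightarrow> complex"
  assumes h: "square_integrable cell_measure h" and Y: "finite Y"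
    and r_def: "r = (\<lambda>x. of_real (h x) - (\<Sum>k\<in>Y. fourier h k * cnj (expi k x)))"
begin

lemma remainder_square_integrable: "square_integrable cell_measure r"
  unfolding r_def
  by (intro square_integrable_diff square_integrable_of_real square_integrable_sum square_integrable_cmult
      square_integrable_cnj expi_square_integrable h)

lemma integral_mult_remainder:
  assumes f: "square_integrable cell_measure f"
  shows "(\<integral>x. f x * r x \<partial>cell_measure)
    = (\<integral>x. f x * of_real (h x) \<partial>cell_measure) - (\<Sum>k\<in>Y. fourier h k * (\<integral>x. f x * cnj (expi k x) \<partial>cell_measure))"
proof -
  note i = square_integrable_mult[OF f square_integrable_of_real[OF h]]
    square_integrable_mult[OF f square_integrable_cnj[OF expi_square_integrable]]
  have "(\<integral>x. f x * r x \<partial>cell_measure)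
      = (\<integral>x. f x * of_real (h x) - (\<Sum>k\<in>Y. fourier h k * (f x * cnj (expi k x))) \<partial>cell_measure)"
    by (intro Bochner_Integration.integral_cong refl) (simp add: r_def right_diff_distrib sum_distrib_left mult_ac)
  also have "\<dots> = (\<integral>x. f x * of_real (h x) \<partial>cell_measure)
      - (\<integral>x. (\<Sum>k\<in>Y. fourier h k * (f x * cnj (expi k x))) \<partial>cell_measure)"
    by (intro Bochner_Integration.integral_diff Bochner_Integration.integrable_sum integrable_mult_right i)
  also have "(\<integral>x. (\<Sum>k\<in>Y. fourier h k * (f x * cnj (expi k x))) \<partial>cell_measure)
      = (\<Sum>k\<in>Y. fourier h k * (\<integral>x. f x * cnj (expi k x) \<partial>cell_measure))"
    by (subst Bochner_Integration.integral_sum) (auto intro!: integrable_mult_right i)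
  finally show ?thesis .
qed

text \<open>\<open>r\<close> is \<open>h\<close> minus its Fourier partial sum over
  \<open>Y\<close>. The pairing carries no conjugation, but the partial sum is written in the
  functions \<open>cnj (expi k)\<close>, so orthonormality of the characters removes exactly the
  coefficient at \<open>l\<close>.\<close>

lemma integral_expi_remainder:
  assumes "l \<in> Y"
  shows "(\<integral>x. expi l x * r x \<partial>cell_measure) = 0"
proof -
  have o: "(\<integral>x. expi l x * cnj (expi k x) \<partial>cell_measure) = (if k = l then 1 else 0)" for k
    using integral_expi[of "l - k"] by (auto simp: cnj_expi expi_add[symmetric])
  have "(\<integral>x. expi l x * of_real (h x) \<partial>cell_measure) = fourier h l"
    by (simp add: fourier_def mult.commute)
  then show ?thesis
    unfolding integral_mult_remainder[OF expi_square_integrable] o using assms Y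
    by (simp add: if_distrib cong: if_cong)
qed

lemma integral_trig_poly_remainder: "(\<integral>x. trig_poly Y a x * r x \<partial>cell_measure) = 0"
proof -
  have "(\<integral>x. trig_poly Y a x * r x \<partial>cell_measure) = (\<integral>x. (\<Sum>k\<in>Y. a k * (expi k x * r x)) \<partial>cell_measure)"
    unfolding trig_poly_def by (simp add: sum_distrib_right mult.assoc)
  also have "\<dots> = (\<Sum>k\<in>Y. a k * (\<integral>x. expi k x * r x \<partial>cell_measure))"
    by (subst Bochner_Integration.integral_sum)
      (auto intro!: integrable_mult_right square_integrable_mult expi_square_integrable remainder_square_integrable)
  also have "\<dots> = 0" by (simp add: integral_expi_remainder)
  finally show ?thesis .
qed

lemma integral_real_mult_remainder:
  assumes f: "square_integrable cell_measure f"
  shows "(\<integral>x. of_real (f x) * r x \<partial>cell_measure)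
    = of_real (\<integral>x. f x * h x \<partial>cell_measure) - (\<Sum>k\<in>Y. cnj (fourier f k) * fourier h k)"
  unfolding integral_mult_remainder[OF square_integrable_of_real[OF f]] cnj_fourier
  by (simp add: mult.commute flip: of_real_mult)

text \<open>The conjugate of \<open>r\<close> is \<open>h\<close> minus a trigonometric polynomial
  over \<open>Y\<close>, and \<open>r\<close> is orthogonal to the latter. This gives the exact norm
  of \<open>r\<close>, of which only a bound uniform in \<open>Y\<close> is kept.\<close>

lemma bessel: "(\<integral>x. (norm (r x))\<^sup>2 \<partial>cell_measure) \<le> (\<integral>x. (h x)\<^sup>2 \<partial>cell_measure)"
proof -
  have c: "cnj (r x) = of_real (h x) - trig_poly Y (\<lambda>k. cnj (fourier h k)) x" for x
    by (simp add: r_def trig_poly_def)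
  have "complex_of_real (\<integral>x. (norm (r x))\<^sup>2 \<partial>cell_measure) = (\<integral>x. cnj (r x) * r x \<partial>cell_measure)"
    unfolding integral_complex_of_real[symmetric]
    by (intro Bochner_Integration.integral_cong refl) (simp only: complex_norm_square mult.commute)
  also have "\<dots> = (\<integral>x. of_real (h x) * r x - trig_poly Y (\<lambda>k. cnj (fourier h k)) x * r x \<partial>cell_measure)"
    unfolding c by (simp add: left_diff_distrib)
  also have "\<dots> = (\<integral>x. of_real (h x) * r x \<partial>cell_measure)"
    by (subst Bochner_Integration.integral_diff)
      (auto intro!: square_integrable_mult square_integrable_of_real h remainder_square_integrable
        trig_poly_square_integrable simp: integral_trig_poly_remainder)
  also have "\<dots> = of_real ((\<integral>x. (h x)\<^sup>2 \<partial>cell_measure) - (\<Sum>k\<in>Y. (norm (fourier h k))\<^sup>2))"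
    unfolding integral_real_mult_remainder[OF h]
    by (simp add: complex_norm_square power2_eq_square[of "h _"] mult.commute del: of_real_power)
  finally have "(\<integral>x. (norm (r x))\<^sup>2 \<partial>cell_measure) = (\<integral>x. (h x)\<^sup>2 \<partial>cell_measure) - (\<Sum>k\<in>Y. (norm (fourier h k))\<^sup>2)"
    by (simp only: of_real_eq_iff)
  then show ?thesis by (simp add: sum_nonneg)
qed

end

text \<open>The error of the partial sum over \<open>Y\<close> is the integral of \<open>f\<close>
  against the remainder of \<open>h\<close>. Once \<open>Y\<close> contains the frequencies of a
  trigonometric polynomial \<open>q\<close>, the remainder is orthogonal to \<open>q\<close>, so
  \<open>f\<close> may be replaced by the small difference \<open>f - q\<close>, while Bessel
  controls the remainder.\<close>

lemma parseval:
  assumes f: "square_integrable cell_measure f" and h: "square_integrable cell_measure h"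
  shows "((\<lambda>k. cnj (fourier f k) * fourier h k) has_sum of_real (\<integral>x. f x * h x \<partial>cell_measure)) UNIV"
  unfolding has_sum_def
proof (rule tendstoI)
  fix e :: real assume e: "e > 0"
  \<comment> \<open>\<open>s\<close> is the weight in Young's inequality. The two resulting terms
    are bounded by \<open>s / 2 * (e / s)\<close> and \<open>C / (2 * s)\<close>, and
    \<open>s = C / e\<close> makes each of them \<open>e / 2\<close>. The summand 1 makes
    \<open>C\<close> positive and the bound strict.\<close>
  define C where "C = (\<integral>x. (h x)\<^sup>2 \<partial>cell_measure) + 1"
  define s where "s = C / e"
  have C: "C > 0" unfolding C_def by (simp add: add_nonneg_pos)
  then have s: "s > 0" using e by (simp add: s_def)
  obtain q where q: "trig_real q" "(\<integral>x. (f x - q x)\<^sup>2 \<partial>cell_measure) < e / s"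
    using trig_approx_square_integrable[OF f] e s unfolding trig_approx_def by (meson divide_pos_pos)
  obtain F a where F: "finite F" "\<And>x. complex_of_real (q x) = trig_poly F a x"
    using q(1) unfolding trig_real_def by blast
  have qs: "square_integrable cell_measure q" by (rule trig_real_square_integrable[OF q(1)])
  have fq: "square_integrable cell_measure (\<lambda>x. f x - q x)" by (rule square_integrable_diff[OF f qs])
  have "dist (\<Sum>k\<in>Y. cnj (fourier f k) * fourier h k) (of_real (\<integral>x. f x * h x \<partial>cell_measure)) < e"
    if Y: "finite Y" "F \<subseteq> Y" for Y
  proof -
    define r where "r = (\<lambda>x. complex_of_real (h x) - (\<Sum>k\<in>Y. fourier h k * cnj (expi k x)))"
    note rs = remainder_square_integrable[OF h Y(1) r_def]
    have q0: "(\<integral>x. of_real (q x) * r x \<partial>cell_measure) = 0"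
      unfolding F(2) trig_poly_superset[OF Y] by (rule integral_trig_poly_remainder[OF h Y(1) r_def])
    have "of_real (\<integral>x. f x * h x \<partial>cell_measure) - (\<Sum>k\<in>Y. cnj (fourier f k) * fourier h k)
        = (\<integral>x. of_real (f x) * r x \<partial>cell_measure)"
      by (rule integral_real_mult_remainder[OF h Y(1) r_def f, symmetric])
    also have "\<dots> = (\<integral>x. of_real (f x) * r x - of_real (q x) * r x \<partial>cell_measure)"
      by (subst Bochner_Integration.integral_diff)
        (auto intro!: square_integrable_mult square_integrable_of_real f qs rs simp: q0)
    also have "norm \<dots> \<le> (\<integral>x. norm (of_real (f x) * r x - of_real (q x) * r x) \<partial>cell_measure)"
      by (rule integral_norm_bound)
    also have "\<dots> \<le> (\<integral>x. s / 2 * (f x - q x)\<^sup>2 + 1 / (2 * s) * (norm (r x))\<^sup>2 \<partial>cell_measure)"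
    proof (rule integral_mono')
      show "integrable cell_measure (\<lambda>x. s / 2 * (f x - q x)\<^sup>2 + 1 / (2 * s) * (norm (r x))\<^sup>2)"
        using fq rs by (auto simp: square_integrable_def)
      fix x
      have "0 \<le> (s * \<bar>f x - q x\<bar> - norm (r x))\<^sup>2 / (2 * s)" using s by simp
      also have "\<dots> = s / 2 * (f x - q x)\<^sup>2 + 1 / (2 * s) * (norm (r x))\<^sup>2 - \<bar>f x - q x\<bar> * norm (r x)"
        using s by (simp add: field_simps power2_eq_square)
      also have "\<bar>f x - q x\<bar> * norm (r x) = norm (of_real (f x) * r x - of_real (q x) * r x)"
        by (simp flip: left_diff_distrib of_real_diff add: norm_mult)
      finally show "norm (of_real (f x) * r x - of_real (q x) * r x)
          \<le> s / 2 * (f x - q x)\<^sup>2 + 1 / (2 * s) * (norm (r x))\<^sup>2" by simp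
    qed (use s in auto)
    also have "\<dots> = s / 2 * (\<integral>x. (f x - q x)\<^sup>2 \<partial>cell_measure) + 1 / (2 * s) * (\<integral>x. (norm (r x))\<^sup>2 \<partial>cell_measure)"
      using fq rs by (simp add: square_integrable_def)
    also have "\<dots> < s / 2 * (e / s) + 1 / (2 * s) * C"
    proof (rule add_strict_mono)
      show "s / 2 * (\<integral>x. (f x - q x)\<^sup>2 \<partial>cell_measure) < s / 2 * (e / s)"
        using q(2) s by (intro mult_strict_left_mono) auto
      show "1 / (2 * s) * (\<integral>x. (norm (r x))\<^sup>2 \<partial>cell_measure) < 1 / (2 * s) * C"
        using bessel[OF h Y(1) r_def] s by (intro mult_strict_left_mono) (auto simp: C_def)
    qed
    also have "\<dots> = e" using s e C by (simp add: s_def)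
    finally show ?thesis by (simp add: dist_norm norm_minus_commute)
  qed
  then show "\<forall>\<^sub>F Y in finite_subsets_at_top UNIV.
      dist (\<Sum>k\<in>Y. cnj (fourier f k) * fourier h k) (of_real (\<integral>x. f x * h x \<partial>cell_measure)) < e"
    unfolding eventually_finite_subsets_at_top using F(1) by (intro exI[of _ F]) auto
qed

subsection \<open>Test functions and solenoidal fields\<close>

lemma expi_has_derivative [derivative_intros]:
  "(expi k has_derivative (\<lambda>h. (2 * pi * \<i> * of_int (fst k) * of_real (h $ 1)
      + 2 * pi * \<i> * of_int (snd k) * of_real (h $ 2)) * expi k x)) (at x)"
  unfolding expi_def[abs_def]
  by (rule derivative_eq_intros bounded_linear.has_derivative[OF bounded_linear_vec_nth] | simp)+
    (auto simp: fun_eq_iff scaleR_conv_of_real algebra_simps)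

text \<open>Each partial derivative only multiplies an exponential by its frequency factor, which
  produces the whole table of derivatives demanded by \<open>smooth_plane\<close> at once.\<close>

lemma trig_D_has_derivative:
  fixes c :: complex and k :: "int \<times> int"
  defines "D \<equiv> \<lambda>i j x. Re (c * (2 * pi * \<i> * of_int (fst k)) ^ i * (2 * pi * \<i> * of_int (snd k)) ^ j * expi k x)"
  shows "(D i j has_derivative (\<lambda>h. D (Suc i) j x * h $ 1 + D i (Suc j) x * h $ 2)) (at x)"
proof -
  define w1 w2 where w: "w1 = 2 * pi * \<i> * of_int (fst k)" "w2 = 2 * pi * \<i> * of_int (snd k)"
  define b where "b = c * w1 ^ i * w2 ^ j"
  have Dw: "D i j x = Re (c * w1 ^ i * w2 ^ j * expi k x)" for i j x
    by (simp only: D_def w)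
  have D: "D i j = (\<lambda>x. Re (b * expi k x))" "D (Suc i) j x = Re (b * w1 * expi k x)"
    "D i (Suc j) x = Re (b * w2 * expi k x)"
    by (simp_all only: Dw b_def power_Suc mult_ac fun_eq_iff simp_thms)
  have "((\<lambda>x. Re (b * expi k x)) has_derivative
      (\<lambda>h. Re (b * ((w1 * of_real (h $ 1) + w2 * of_real (h $ 2)) * expi k x)))) (at x)"
    unfolding w
    by (intro bounded_linear.has_derivative[OF bounded_linear_Re]
        bounded_linear.has_derivative[OF bounded_linear_mult_right] expi_has_derivative)
  also have "(\<lambda>h. Re (b * ((w1 * of_real (h $ 1) + w2 * of_real (h $ 2)) * expi k x)))
      = (\<lambda>h. Re (b * w1 * expi k x) * h $ 1 + Re (b * w2 * expi k x) * h $ 2)"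
    by (rule ext) (simp add: algebra_simps)
  finally show ?thesis unfolding D .
qed

lemma classical_grad_eq:
  assumes "(f has_derivative (\<lambda>h. a * h $ 1 + b * h $ 2)) (at x)"
  shows "classical_grad f x $ 1 = a" "classical_grad f x $ 2 = b"
  using frechet_derivative_at[OF assms, symmetric] by (simp_all add: classical_grad_def axis_def)

lemma expi_periodic: "expi k (x + (\<chi> i. of_int (l $ i))) = expi k x"
proof -
  have "expi k (x + (\<chi> i. of_int (l $ i))) = expi k x * cis (2 * pi * of_int (fst k * l $ 1 + snd k * l $ 2))"
    by (simp add: expi_def cis_mult algebra_simps)
  then show ?thesis by (simp add: cis_multiple_2pi)
qed

lemma test_function_trig: "test_function (\<lambda>x. Re (c * expi k x))"
  unfolding test_function_def smooth_plane_def cell_periodic_def expi_periodic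
  by (intro conjI allI refl exI[of _ "\<lambda>i j x. Re (c * (2 * pi * \<i> * of_int (fst k)) ^ i
      * (2 * pi * \<i> * of_int (snd k)) ^ j * expi k x)"] trig_D_has_derivative) simp

lemma integral_vec_nth:
  fixes f :: "'a \<Rightarrow> real^'n"
  shows "integrable M f \<Longrightarrow> (\<integral>x. f x \<partial>M) $ i = (\<integral>x. f x $ i \<partial>M)"
  using integral_bounded_linear[OF bounded_linear_vec_nth, of M f i] by simp

lemma square_integrable_nth:
  fixes f :: "'a \<Rightarrow> real^'n"
  shows "square_integrable M f \<Longrightarrow> square_integrable M (\<lambda>x. f x $ i)"
  by (rule square_integrable_bounded_linear[OF _ bounded_linear_vec_nth])

text \<open>Test functions are real, so \<open>J\<close> is tested with
  \<open>Re (c * expi k x)\<close>. The choices \<open>c = 1\<close> and \<open>c = \<i>\<close>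
  recover the real and the imaginary part of the complex identity.\<close>

lemma fourier_divergence_free:
  assumes J: "square_integrable cell_measure J" and div: "divergence_free J"
  shows "of_int (fst k) * fourier (\<lambda>x. J x $ 1) k + of_int (snd k) * fourier (\<lambda>x. J x $ 2) k = 0"
proof -
  define w1 w2 where w: "w1 = 2 * pi * \<i> * of_int (fst k)" "w2 = 2 * pi * \<i> * of_int (snd k)"
  define z where "z = w1 * fourier (\<lambda>x. J x $ 1) k + w2 * fourier (\<lambda>x. J x $ 2) k"
  have i: "integrable cell_measure (\<lambda>x. of_real (J x $ m) * expi k x)" for m
    by (intro square_integrable_mult square_integrable_of_real square_integrable_nth J expi_square_integrable)
  have "Re (c * z) = 0" for c
  proof -
    have g: "classical_grad (\<lambda>x. Re (c * expi k x)) x $ 1 = Re (c * w1 * expi k x)"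
      "classical_grad (\<lambda>x. Re (c * expi k x)) x $ 2 = Re (c * w2 * expi k x)" for x
      using classical_grad_eq[OF trig_D_has_derivative[of c k 0 0 x]] by (simp_all add: w mult_ac)
    have "0 = (\<integral>x. J x \<bullet> classical_grad (\<lambda>x. Re (c * expi k x)) x \<partial>cell_measure)"
      using div test_function_trig[of c k] by (simp add: divergence_free_def set_integral_cell)
    also have "\<dots> = (\<integral>x. Re (c * (w1 * (of_real (J x $ 1) * expi k x) + w2 * (of_real (J x $ 2) * expi k x))) \<partial>cell_measure)"
      by (intro Bochner_Integration.integral_cong refl)
        (simp only: inner_vec_def sum_2 g, simp add: algebra_simps)
    also have "\<dots> = Re (\<integral>x. c * (w1 * (of_real (J x $ 1) * expi k x) + w2 * (of_real (J x $ 2) * expi k x)) \<partial>cell_measure)"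
      by (rule integral_Re) (intro integrable_mult_right Bochner_Integration.integrable_add i)
    also have "(\<integral>x. c * (w1 * (of_real (J x $ 1) * expi k x) + w2 * (of_real (J x $ 2) * expi k x)) \<partial>cell_measure) = c * z"
      unfolding z_def fourier_def using i by simp
    finally show ?thesis by simp
  qed
  from this[of 1] this[of \<i>] have "z = 0" by (simp add: complex_eq_iff)
  also have "z = 2 * pi * \<i> * (of_int (fst k) * fourier (\<lambda>x. J x $ 1) k + of_int (snd k) * fourier (\<lambda>x. J x $ 2) k)"
    by (simp add: z_def w algebra_simps)
  finally show ?thesis by simp
qed

lemma R_perp_mult [simp]: "(R_perp *v v) $ 1 = - v $ 2" "(R_perp *v v) $ 2 = v $ 1"
  by (simp_all add: R_perp_def matrix_vector_mult_def sum_2)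

text \<open>For \<open>k \<noteq> 0\<close> the coefficients of both fields are multiples of the same vector orthogonal to \<open>k\<close>, so
  only the means contribute to Parseval's identity.\<close>

lemma div_curl:
  assumes J: "square_integrable cell_measure J" "divergence_free J"
    and H: "square_integrable cell_measure H" "divergence_free H"
  shows "(\<integral>x. J x \<bullet> (R_perp *v H x) \<partial>cell_measure)
    = integral\<^sup>L cell_measure J \<bullet> (R_perp *v integral\<^sup>L cell_measure H)"
proof -
  let ?J = "\<lambda>m. fourier (\<lambda>x. J x $ m)" and ?H = "\<lambda>m. fourier (\<lambda>x. H x $ m)"
  note c = square_integrable_nth[OF J(1)] square_integrable_nth[OF H(1)]
  have "((\<lambda>k. cnj (?J 2 k) * ?H 1 k - cnj (?J 1 k) * ?H 2 k) has_sum
      (of_real (\<integral>x. J x $ 2 * H x $ 1 \<partial>cell_measure) - of_real (\<integral>x. J x $ 1 * H x $ 2 \<partial>cell_measure))) UNIV"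
    using has_sum_add[OF parseval[OF c(1)[of 2] c(2)[of 1]] has_sum_cmult_right[where c = "- 1", OF parseval[OF c(1)[of 1] c(2)[of 2]]]]
    by simp
  moreover have "((\<lambda>k. cnj (?J 2 k) * ?H 1 k - cnj (?J 1 k) * ?H 2 k) has_sum
      (cnj (?J 2 0) * ?H 1 0 - cnj (?J 1 0) * ?H 2 0)) UNIV"
  proof (rule has_sum_finite_neutralI[of "{0}"])
    fix k :: "int \<times> int" assume "k \<in> UNIV - {0}"
    then consider "fst k \<noteq> 0" | "snd k \<noteq> 0" by (auto simp: prod_eq_iff)
    moreover have "cnj (of_int (fst k) * ?J 1 k + of_int (snd k) * ?J 2 k) = 0"
      "of_int (fst k) * ?H 1 k + of_int (snd k) * ?H 2 k = 0"
      using fourier_divergence_free[OF J] fourier_divergence_free[OF H] by simp_all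
    then have "of_int (fst k) * cnj (?J 1 k) = - of_int (snd k) * cnj (?J 2 k)"
      "of_int (fst k) * ?H 1 k = - of_int (snd k) * ?H 2 k"
      by (simp_all add: add_eq_0_iff)
    then have "of_int (fst k) * (cnj (?J 2 k) * ?H 1 k - cnj (?J 1 k) * ?H 2 k) = 0"
      "of_int (snd k) * (cnj (?J 2 k) * ?H 1 k - cnj (?J 1 k) * ?H 2 k) = 0"
      by algebra+
    ultimately show "cnj (?J 2 k) * ?H 1 k - cnj (?J 1 k) * ?H 2 k = 0" by cases auto
  qed auto
  ultimately have "of_real (\<integral>x. J x $ 2 * H x $ 1 \<partial>cell_measure) - of_real (\<integral>x. J x $ 1 * H x $ 2 \<partial>cell_measure)
      = cnj (?J 2 0) * ?H 1 0 - cnj (?J 1 0) * ?H 2 0"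
    by (rule has_sum_unique)
  also have "\<dots> = of_real ((\<integral>x. J x $ 2 \<partial>cell_measure) * (\<integral>x. H x $ 1 \<partial>cell_measure)
      - (\<integral>x. J x $ 1 \<partial>cell_measure) * (\<integral>x. H x $ 2 \<partial>cell_measure))"
    by (simp add: fourier_0)
  finally have "(\<integral>x. J x $ 2 * H x $ 1 \<partial>cell_measure) - (\<integral>x. J x $ 1 * H x $ 2 \<partial>cell_measure)
      = (\<integral>x. J x $ 2 \<partial>cell_measure) * (\<integral>x. H x $ 1 \<partial>cell_measure)
      - (\<integral>x. J x $ 1 \<partial>cell_measure) * (\<integral>x. H x $ 2 \<partial>cell_measure)"
    by (simp only: of_real_diff[symmetric] of_real_eq_iff)
  moreover have "(\<integral>x. J x \<bullet> (R_perp *v H x) \<partial>cell_measure)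
      = (\<integral>x. J x $ 2 * H x $ 1 - J x $ 1 * H x $ 2 \<partial>cell_measure)"
    by (intro Bochner_Integration.integral_cong refl) (simp add: inner_vec_def sum_2)
  moreover have "\<dots> = (\<integral>x. J x $ 2 * H x $ 1 \<partial>cell_measure) - (\<integral>x. J x $ 1 * H x $ 2 \<partial>cell_measure)"
    by (intro Bochner_Integration.integral_diff square_integrable_mult c)
  ultimately show ?thesis
    using J(1) H(1) by (simp add: inner_vec_def sum_2 integral_vec_nth square_integrable_integrable)
qed

section \<open>Means of derivatives of periodic functions, and linear operations on solenoidal
  fields\<close>

lemma continuous_imp_square_integrable_cell:
  fixes f :: "vec2 \<Rightarrow> real"
  assumes "continuous_on UNIV f"
  shows "square_integrable cell_measure f"
  by (rule continuous_square_integrable_cell) (rule continuous_on_subset[OF assms subset_UNIV])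

text \<open>Fubini singles out the coordinate \<open>i\<close>; the inner integral is a difference
  of \<open>\<psi>\<close> at two points that are one period apart. This is what makes constant
  fields solenoidal.\<close>

lemma integral_directional_derivative_periodic:
  fixes \<psi> d :: "vec2 \<Rightarrow> real"
  assumes per: "cell_periodic \<psi>" and d: "continuous_on UNIV d"
    and deriv: "\<And>x t. ((\<lambda>t. \<psi> (x + t *\<^sub>R axis i 1)) has_real_derivative d (x + t *\<^sub>R axis i 1)) (at t)"
  shows "integral\<^sup>L cell_measure d = 0"
proof -
  interpret product_sigma_finite "\<lambda>_. lborel :: real measure" ..
  define b :: vec2 where "b = axis i 1"
  define B where "B = (Basis :: vec2 set) - {b}"
  have B: "Basis = insert b B" "b \<notin> B" "finite B"
    unfolding B_def b_def by (auto simp: axis_in_Basis_iff)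
  define G where "G x = indicator unit_cell x *\<^sub>R d x" for x
  have dm: "d \<in> borel_measurable borel" by (rule borel_measurable_continuous_onI[OF d])
  have Gm: "G \<in> borel_measurable borel"
    unfolding G_def by (intro borel_measurable_scaleR dm borel_measurable_indicator) (simp add: unit_cell_def)
  have Gi: "integrable lborel G"
    unfolding G_def by (intro borel_integrable_compact continuous_on_subset[OF d]) (auto simp: unit_cell_def)
  have "integral\<^sup>L cell_measure d = (\<integral>x. G x \<partial>lebesgue)"
    using set_integral_cell[of d] by (simp add: set_lebesgue_integral_def G_def)
  also have "\<dots> = (\<integral>x. G x \<partial>lborel)"
    by (rule integral_completion) (use Gm in simp)
  also have "\<dots> = (\<integral>f. G (\<Sum>c\<in>Basis. f c *\<^sub>R c) \<partial>(Pi\<^sub>M Basis (\<lambda>_. lborel)))"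
    using Gm by (subst lborel_def, subst integral_distr) (simp_all add: lborel_eq_real)
  also have "\<dots> = (\<integral>f. (\<integral>y. G (\<Sum>c\<in>Basis. (f(b := y)) c *\<^sub>R c) \<partial>lborel) \<partial>(Pi\<^sub>M B (\<lambda>_. lborel)))"
  proof -
    have "integrable (Pi\<^sub>M Basis (\<lambda>_. lborel)) (\<lambda>f. G (\<Sum>c\<in>Basis. f c *\<^sub>R c))"
      using Gi Gm by (subst (asm) lborel_def, subst (asm) integrable_distr_eq) (simp_all add: lborel_eq_real)
    then show ?thesis
      unfolding B(1) using product_integral_insert[OF B(3,2)] by blast
  qed
  also have "\<dots> = 0"
  proof -
    have "(\<integral>y. G (\<Sum>c\<in>Basis. (f(b := y)) c *\<^sub>R c) \<partial>lborel) = 0" for f :: "vec2 \<Rightarrow> real"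
    proof -
      define p where "p = (\<Sum>c\<in>B. f c *\<^sub>R c)"
      define \<kappa> :: real where "\<kappa> = (if \<forall>j. j \<noteq> i \<longrightarrow> 0 \<le> p $ j \<and> p $ j \<le> 1 then 1 else 0)"
      have s: "(\<Sum>c\<in>Basis. (f(b := y)) c *\<^sub>R c) = p + y *\<^sub>R b" for y
      proof -
        have "(\<Sum>c\<in>B. (f(b := y)) c *\<^sub>R c) = p"
          unfolding p_def using B(2) by (intro sum.cong) auto
        then show ?thesis unfolding B(1) using B(2,3) by (simp add: add.commute)
      qed
      have "p \<bullet> b = 0"
        unfolding p_def inner_sum_left B_def by (intro sum.neutral) (auto simp: b_def inner_Basis axis_in_Basis_iff)
      then have p0: "p $ i = 0" by (simp add: b_def inner_axis)
      have "indicator unit_cell (p + y *\<^sub>R b) = \<kappa> * indicator {0..1} y" for y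
        using p0 by (auto simp: unit_cell_def mem_box_cart \<kappa>_def b_def axis_def indicator_def)
      then have "(\<integral>y. G (\<Sum>c\<in>Basis. (f(b := y)) c *\<^sub>R c) \<partial>lborel)
          = \<kappa> * (\<integral>y. indicator {0..1} y *\<^sub>R d (p + y *\<^sub>R b) \<partial>lborel)"
        unfolding s G_def by (simp add: mult.assoc)
      also have "(\<integral>y. indicator {0..1} y *\<^sub>R d (p + y *\<^sub>R b) \<partial>lborel) = \<psi> (p + 1 *\<^sub>R b) - \<psi> (p + 0 *\<^sub>R b)"
      proof (rule integral_FTC_Icc)
        show "continuous_on {0..1} (\<lambda>y. d (p + y *\<^sub>R b))"
          by (intro continuous_on_compose2[OF d] continuous_intros) auto
        show "((\<lambda>y. \<psi> (p + y *\<^sub>R b)) has_vector_derivative d (p + y *\<^sub>R b)) (at y within {0..1})" for y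
          using has_field_derivative_at_within[OF deriv[of p y]]
          by (simp add: b_def has_real_derivative_iff_has_vector_derivative)
      qed simp
      also have "\<psi> (p + 1 *\<^sub>R b) = \<psi> p"
      proof -
        have "p + 1 *\<^sub>R b = p + (\<chi> j. of_int ((axis i 1 :: int^2) $ j))"
          by (simp add: b_def vec_eq_iff axis_def)
        then show ?thesis using per unfolding cell_periodic_def by metis
      qed
      finally show ?thesis by simp
    qed
    then show ?thesis by simp
  qed
  finally show ?thesis .
qed

lemma smooth_planeE:
  assumes "smooth_plane \<psi>"
  obtains D where "D 0 0 = \<psi>" "\<And>i j x. (D i j has_derivative (\<lambda>h. D (Suc i) j x * h$1 + D i (Suc j) x * h$2)) (at x)"
    "\<And>i j. continuous_on UNIV (D i j)"
proof -
  obtain D where D: "D 0 0 = \<psi>" "\<And>i j x. (D i j has_derivative (\<lambda>h. D (Suc i) j x * h$1 + D i (Suc j) x * h$2)) (at x)"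
    using assms unfolding smooth_plane_def by blast
  have "continuous_on UNIV (D i j)" for i j
    by (rule has_derivative_continuous_on) (use D(2) has_derivative_at_withinI in blast)
  with D that show ?thesis by blast
qed

lemma has_derivative_along_axis:
  fixes f :: "vec2 \<Rightarrow> real"
  assumes "\<And>x. (f has_derivative (\<lambda>h. a x * h$1 + b x * h$2)) (at x)"
  shows "((\<lambda>t. f (x + t *\<^sub>R axis 1 1)) has_real_derivative a (x + t *\<^sub>R axis 1 1)) (at t)"
    "((\<lambda>t. f (x + t *\<^sub>R axis 2 1)) has_real_derivative b (x + t *\<^sub>R axis 2 1)) (at t)"
proof -
  have "((\<lambda>t. f (x + t *\<^sub>R v)) has_derivative (\<lambda>s. a (x + t *\<^sub>R v) * (s *\<^sub>R v)$1 + b (x + t *\<^sub>R v) * (s *\<^sub>R v)$2)) (at t)" for v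
    by (rule has_derivative_compose[OF _ assms]) (auto intro!: derivative_eq_intros)
  from this[of "axis 1 1"] this[of "axis 2 1"]
  show "((\<lambda>t. f (x + t *\<^sub>R axis 1 1)) has_real_derivative a (x + t *\<^sub>R axis 1 1)) (at t)"
    "((\<lambda>t. f (x + t *\<^sub>R axis 2 1)) has_real_derivative b (x + t *\<^sub>R axis 2 1)) (at t)"
    by (simp_all add: has_field_derivative_def axis_def mult.commute[of _ "a _"] mult.commute[of _ "b _"] mult_commute_abs)
qed

lemma classical_grad_smooth:
  assumes "smooth_plane \<psi>"
  shows "continuous_on UNIV (\<lambda>x. classical_grad \<psi> x $ k)"
proof -
  obtain D where D: "D 0 0 = \<psi>" "\<And>i j x. (D i j has_derivative (\<lambda>h. D (Suc i) j x * h$1 + D i (Suc j) x * h$2)) (at x)"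
    "\<And>i j. continuous_on UNIV (D i j)"
    using smooth_planeE[OF assms] by blast
  have "(\<lambda>x. classical_grad \<psi> x $ 1) = D (Suc 0) 0" "(\<lambda>x. classical_grad \<psi> x $ 2) = D 0 (Suc 0)"
    using classical_grad_eq[OF D(2)[of 0 0]] by (simp_all add: D(1))
  then show ?thesis using D(3) exhaust_2[of k] by metis
qed

lemma classical_grad_square_integrable:
  assumes "test_function \<psi>"
  shows "square_integrable cell_measure (classical_grad \<psi>)"
proof -
  have "smooth_plane \<psi>" using assms by (simp add: test_function_def)
  note c = continuous_imp_square_integrable_cell[OF classical_grad_smooth[OF this]]
  have "classical_grad \<psi> = (\<lambda>x. (classical_grad \<psi> x $ 1) *\<^sub>R axis 1 1 + (classical_grad \<psi> x $ 2) *\<^sub>R axis 2 1)"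
    by (simp add: fun_eq_iff vec_eq_iff axis_def forall_2)
  moreover have "square_integrable cell_measure (\<lambda>x. (classical_grad \<psi> x $ 1) *\<^sub>R axis 1 1 + (classical_grad \<psi> x $ 2) *\<^sub>R (axis 2 1 :: vec2))"
    by (intro square_integrable_add square_integrable_bounded_linear[OF c bounded_linear_scaleR_left])
  ultimately show ?thesis by simp
qed

lemma integral_classical_grad:
  assumes "test_function \<psi>"
  shows "integral\<^sup>L cell_measure (classical_grad \<psi>) = 0"
proof -
  have s: "smooth_plane \<psi>" and per: "cell_periodic \<psi>" using assms by (simp_all add: test_function_def)
  obtain D where D: "D 0 0 = \<psi>" "\<And>i j x. (D i j has_derivative (\<lambda>h. D (Suc i) j x * h$1 + D i (Suc j) x * h$2)) (at x)"
    "\<And>i j. continuous_on UNIV (D i j)"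
    using smooth_planeE[OF s] by blast
  have g: "(\<lambda>x. classical_grad \<psi> x $ 1) = D (Suc 0) 0" "(\<lambda>x. classical_grad \<psi> x $ 2) = D 0 (Suc 0)"
    using classical_grad_eq[OF D(2)[of 0 0]] by (simp_all add: D(1))
  have "integral\<^sup>L cell_measure (D (Suc 0) 0) = 0"
    by (rule integral_directional_derivative_periodic[OF per D(3)])
      (rule has_derivative_along_axis(1)[OF D(2)[of 0 0], unfolded D(1)])
  moreover have "integral\<^sup>L cell_measure (D 0 (Suc 0)) = 0"
    by (rule integral_directional_derivative_periodic[OF per D(3)])
      (rule has_derivative_along_axis(2)[OF D(2)[of 0 0], unfolded D(1)])
  ultimately show ?thesis
    using square_integrable_integrable[OF _ classical_grad_square_integrable[OF assms]]
    by (simp add: vec_eq_iff forall_2 integral_vec_nth g)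
qed

lemma divergence_free_const: "divergence_free (\<lambda>x. c)"
proof -
  have "(\<integral>x. c \<bullet> classical_grad \<psi> x \<partial>cell_measure) = 0" if "test_function \<psi>" for \<psi>
    using square_integrable_integrable[OF _ classical_grad_square_integrable[OF that]]
    by (simp add: integral_classical_grad[OF that])
  then show ?thesis by (simp add: divergence_free_def set_integral_cell)
qed

lemma divergence_free_add:
  assumes "square_integrable cell_measure J" "divergence_free J"
    "square_integrable cell_measure H" "divergence_free H"
  shows "divergence_free (\<lambda>x. J x + H x)"
  unfolding divergence_free_def set_integral_cell
proof (intro allI impI)
  fix \<psi> assume t: "test_function \<psi>"
  note i = square_integrable_inner[OF assms(1) classical_grad_square_integrable[OF t]]
    square_integrable_inner[OF assms(3) classical_grad_square_integrable[OF t]]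
  show "(\<integral>x. (J x + H x) \<bullet> classical_grad \<psi> x \<partial>cell_measure) = 0"
    using assms(2,4) t i by (simp add: inner_add_left divergence_free_def set_integral_cell)
qed

lemma divergence_free_scaleR: "divergence_free J \<Longrightarrow> divergence_free (\<lambda>x. c *\<^sub>R J x)"
  by (simp add: divergence_free_def set_integral_cell)

lemma divergence_free_diff:
  assumes "square_integrable cell_measure J" "divergence_free J"
    "square_integrable cell_measure H" "divergence_free H"
  shows "divergence_free (\<lambda>x. J x - H x)"
  using divergence_free_add[OF assms(1,2) square_integrable_bounded_linear[OF assms(3) bounded_linear_scaleR_right[of "-1"]]
      divergence_free_scaleR[OF assms(4), of "-1"]] by simp

lemma divergence_free_cong:
  assumes "divergence_free J" "square_integrable cell_measure J" "square_integrable cell_measure H"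
    "AE x in cell_measure. H x = J x"
  shows "divergence_free H"
  unfolding divergence_free_def set_integral_cell
proof (intro allI impI)
  fix \<psi> assume t: "test_function \<psi>"
  note i = square_integrable_inner[OF assms(2) classical_grad_square_integrable[OF t]]
    square_integrable_inner[OF assms(3) classical_grad_square_integrable[OF t]]
  have "(\<integral>x. H x \<bullet> classical_grad \<psi> x \<partial>cell_measure) = (\<integral>x. J x \<bullet> classical_grad \<psi> x \<partial>cell_measure)"
    using assms(4) i by (intro integral_cong_AE) auto
  then show "(\<integral>x. H x \<bullet> classical_grad \<psi> x \<partial>cell_measure) = 0"
    using assms(1) t by (simp add: divergence_free_def set_integral_cell)
qed

subsection \<open>Periodic gradient fields\<close>

text \<open>One of the two components of a field in \<open>cell_field\<close>. Periodic gradients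
  have mean zero, so \<open>c\<close> is the mean of \<open>e\<close>.\<close>

definition grad_field :: "vec2 \<Rightarrow> (vec2 \<Rightarrow> vec2) \<Rightarrow> bool" where
  "grad_field c e \<longleftrightarrow> (\<exists>\<phi> g. H1_per_grad \<phi> g \<and> e = (\<lambda>x. c + g x))"

lemma L2_per_add: "L2_per f \<Longrightarrow> L2_per g \<Longrightarrow> L2_per (\<lambda>x. f x + g x)"
  by (rule L2_perI[OF _ _ square_integrable_add[OF L2_per_square_integrable L2_per_square_integrable]])
    (auto simp: L2_per_def cell_periodic_def)

lemma L2_per_scaleR: "L2_per f \<Longrightarrow> L2_per (\<lambda>x. a *\<^sub>R f x)"
  by (rule L2_perI[OF _ _ square_integrable_bounded_linear[OF L2_per_square_integrable bounded_linear_scaleR_right]])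
    (auto simp: L2_per_def cell_periodic_def)

lemma test_function_square_integrable:
  assumes "test_function \<psi>"
  shows "square_integrable cell_measure \<psi>"
proof -
  have "smooth_plane \<psi>" using assms by (simp add: test_function_def)
  from smooth_planeE[OF this] show ?thesis by (metis continuous_imp_square_integrable_cell)
qed

lemma integrable_scaleR_square_integrable:
  fixes f :: "vec2 \<Rightarrow> real" and g :: "vec2 \<Rightarrow> vec2"
  assumes "square_integrable M f" "square_integrable M g"
  shows "integrable M (\<lambda>x. f x *\<^sub>R g x)"
proof (rule Bochner_Integration.integrable_bound)
  show "integrable M (\<lambda>x. (norm (f x))\<^sup>2 + (norm (g x))\<^sup>2)"
    using assms by (auto simp: square_integrable_def)
  have [measurable]: "f \<in> borel_measurable M" "g \<in> borel_measurable M"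
    using assms by (auto simp: square_integrable_def)
  show "(\<lambda>x. f x *\<^sub>R g x) \<in> borel_measurable M" by measurable
  have "norm (f x *\<^sub>R g x) \<le> norm ((norm (f x))\<^sup>2 + (norm (g x))\<^sup>2)" for x
    using norm_prod_le_sum_squares[of "f x" "norm (g x)"] by (simp add: abs_mult)
  then show "AE x in M. norm (f x *\<^sub>R g x) \<le> norm ((norm (f x))\<^sup>2 + (norm (g x))\<^sup>2)" by simp
qed

lemma H1_per_grad_add:
  assumes "H1_per_grad \<phi> g" "H1_per_grad \<phi>' g'"
  shows "H1_per_grad (\<lambda>x. \<phi> x + \<phi>' x) (\<lambda>x. g x + g' x)"
  unfolding H1_per_grad_def set_integral_cell
proof (intro conjI allI impI)
  show "L2_per (\<lambda>x. \<phi> x + \<phi>' x)" "L2_per (\<lambda>x. g x + g' x)"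
    using assms by (auto simp: H1_per_grad_def intro: L2_per_add)
  fix \<psi> assume t: "test_function \<psi>"
  have L: "L2_per \<phi>" "L2_per g" "L2_per \<phi>'" "L2_per g'" using assms by (auto simp: H1_per_grad_def)
  note i = integrable_scaleR_square_integrable[OF L2_per_square_integrable[OF L(1)] classical_grad_square_integrable[OF t]]
    integrable_scaleR_square_integrable[OF L2_per_square_integrable[OF L(3)] classical_grad_square_integrable[OF t]]
    integrable_scaleR_square_integrable[OF test_function_square_integrable[OF t] L2_per_square_integrable[OF L(2)]]
    integrable_scaleR_square_integrable[OF test_function_square_integrable[OF t] L2_per_square_integrable[OF L(4)]]
  have "(\<integral>x. \<phi> x *\<^sub>R classical_grad \<psi> x \<partial>cell_measure) = - (\<integral>x. \<psi> x *\<^sub>R g x \<partial>cell_measure)"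
    "(\<integral>x. \<phi>' x *\<^sub>R classical_grad \<psi> x \<partial>cell_measure) = - (\<integral>x. \<psi> x *\<^sub>R g' x \<partial>cell_measure)"
    using assms t by (auto simp: H1_per_grad_def set_integral_cell)
  with i show "(\<integral>x. (\<phi> x + \<phi>' x) *\<^sub>R classical_grad \<psi> x \<partial>cell_measure) = - (\<integral>x. \<psi> x *\<^sub>R (g x + g' x) \<partial>cell_measure)"
    by (simp add: scaleR_add_left scaleR_add_right)
qed

lemma H1_per_grad_scaleR:
  assumes "H1_per_grad \<phi> g"
  shows "H1_per_grad (\<lambda>x. a *\<^sub>R \<phi> x) (\<lambda>x. a *\<^sub>R g x)"
  unfolding H1_per_grad_def set_integral_cell
proof (intro conjI allI impI)
  show "L2_per (\<lambda>x. a *\<^sub>R \<phi> x)" "L2_per (\<lambda>x. a *\<^sub>R g x)"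
    using assms by (auto simp only: H1_per_grad_def intro: L2_per_scaleR)
  fix \<psi> assume t: "test_function \<psi>"
  have "(\<integral>x. \<phi> x *\<^sub>R classical_grad \<psi> x \<partial>cell_measure) = - (\<integral>x. \<psi> x *\<^sub>R g x \<partial>cell_measure)"
    using assms t by (auto simp: H1_per_grad_def set_integral_cell)
  moreover have "(\<integral>x. (a *\<^sub>R \<phi> x) *\<^sub>R classical_grad \<psi> x \<partial>cell_measure) = a *\<^sub>R (\<integral>x. \<phi> x *\<^sub>R classical_grad \<psi> x \<partial>cell_measure)"
    by (simp flip: scaleR_scaleR add: integral_scaleR_right del: scaleR_scaleR)
  moreover have "(\<integral>x. \<psi> x *\<^sub>R (a *\<^sub>R g x) \<partial>cell_measure) = a *\<^sub>R (\<integral>x. \<psi> x *\<^sub>R g x \<partial>cell_measure)"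
    by (subst scaleR_left_commute) (rule integral_scaleR_right)
  ultimately show "(\<integral>x. (a *\<^sub>R \<phi> x) *\<^sub>R classical_grad \<psi> x \<partial>cell_measure) = - (\<integral>x. \<psi> x *\<^sub>R (a *\<^sub>R g x) \<partial>cell_measure)"
    by simp
qed

lemma grad_field_add:
  assumes "grad_field c e" "grad_field c' e'"
  shows "grad_field (c + c') (\<lambda>x. e x + e' x)"
proof -
  obtain \<phi> g \<phi>' g' where "H1_per_grad \<phi> g" "e = (\<lambda>x. c + g x)" "H1_per_grad \<phi>' g'" "e' = (\<lambda>x. c' + g' x)"
    using assms unfolding grad_field_def by blast
  then show ?thesis
    unfolding grad_field_def by (intro exI conjI, rule_tac H1_per_grad_add) (auto simp: algebra_simps)
qed

lemma grad_field_scaleR: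
  assumes "grad_field c e"
  shows "grad_field (a *\<^sub>R c) (\<lambda>x. a *\<^sub>R e x)"
proof -
  obtain \<phi> g where "H1_per_grad \<phi> g" "e = (\<lambda>x. c + g x)"
    using assms unfolding grad_field_def by blast
  then show ?thesis
    unfolding grad_field_def by (intro exI conjI, rule_tac H1_per_grad_scaleR) (auto simp: algebra_simps)
qed

lemma H1_per_grad_mean:
  assumes "H1_per_grad \<phi> g"
  shows "integral\<^sup>L cell_measure g = 0"
proof -
  have "classical_grad (\<lambda>x. 1) x = 0" for x
    by (simp add: classical_grad_def vec_eq_iff)
  moreover have "test_function (\<lambda>x. 1)" using test_function_trig[of 1 0] by simp
  ultimately show ?thesis
    using assms by (force simp: H1_per_grad_def set_integral_cell)
qed

text \<open>Curl of a gradient vanishes. Both derivatives are moved to the test function: the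
  first-order derivatives of \<open>\<psi>\<close> are again test functions, and differentiating
  them in the respective other variable leads to the same entry of the table
  \<open>D\<close>.\<close>

lemma H1_per_grad_rotated:
  assumes H: "H1_per_grad \<phi> g"
  shows "divergence_free (\<lambda>x. R_perp *v g x)"
  unfolding divergence_free_def set_integral_cell
proof (intro allI impI)
  fix \<psi> assume t: "test_function \<psi>"
  then have s: "smooth_plane \<psi>" and per: "cell_periodic \<psi>" by (simp_all add: test_function_def)
  obtain D where D: "D 0 0 = \<psi>" "\<And>i j x. (D i j has_derivative (\<lambda>h. D (Suc i) j x * h$1 + D i (Suc j) x * h$2)) (at x)"
    "\<And>i j. continuous_on UNIV (D i j)"
    using smooth_planeE[OF s] by blast
  note cg = classical_grad_eq[OF D(2)]
  have perD: "cell_periodic (D (Suc 0) 0)" "cell_periodic (D 0 (Suc 0))"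
  proof -
    have "D (Suc 0) 0 (x + p) = D (Suc 0) 0 x \<and> D 0 (Suc 0) (x + p) = D 0 (Suc 0) x"
      if p: "\<And>y. \<psi> (y + p) = \<psi> y" for x p
    proof -
      have "((\<lambda>y. \<psi> (y + p)) has_derivative (\<lambda>h. D (Suc 0) 0 (x + p) * h$1 + D 0 (Suc 0) (x + p) * h$2)) (at x)"
      proof (rule has_derivative_compose[of "\<lambda>y. y + p" "\<lambda>h. h"])
        show "((\<lambda>y. y + p) has_derivative (\<lambda>h. h)) (at x)" by (auto intro!: derivative_eq_intros)
        show "(\<psi> has_derivative (\<lambda>h. D (Suc 0) 0 (x + p) * h$1 + D 0 (Suc 0) (x + p) * h$2)) (at (x + p))"
          using D(2)[of 0 0 "x + p"] D(1) by simp
      qed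
      then have "(\<psi> has_derivative (\<lambda>h. D (Suc 0) 0 (x + p) * h$1 + D 0 (Suc 0) (x + p) * h$2)) (at x)"
        using p by simp
      from classical_grad_eq[OF this] cg[of 0 0 x] D(1) show ?thesis by simp
    qed
    then show "cell_periodic (D (Suc 0) 0)" "cell_periodic (D 0 (Suc 0))"
      using per unfolding cell_periodic_def by blast+
  qed
  have tD: "test_function (D (Suc 0) 0)" "test_function (D 0 (Suc 0))"
    unfolding test_function_def smooth_plane_def using perD D(2)
    by (auto intro: exI[of _ "\<lambda>i j. D (Suc i) j"] exI[of _ "\<lambda>i j. D i (Suc j)"])
  have L: "square_integrable cell_measure \<phi>" "square_integrable cell_measure g"
    using H by (auto simp: H1_per_grad_def intro: L2_per_square_integrable)
  have eq: "(\<integral>x. \<phi> x * classical_grad \<eta> x $ m \<partial>cell_measure) = - (\<integral>x. \<eta> x * g x $ m \<partial>cell_measure)"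
    if "test_function \<eta>" for \<eta> m
  proof -
    have "(\<integral>x. \<phi> x *\<^sub>R classical_grad \<eta> x \<partial>cell_measure) $ m = - (\<integral>x. \<eta> x *\<^sub>R g x \<partial>cell_measure) $ m"
      using H that by (simp add: H1_per_grad_def set_integral_cell)
    then show ?thesis
      using integrable_scaleR_square_integrable[OF L(1) classical_grad_square_integrable[OF that]]
        integrable_scaleR_square_integrable[OF test_function_square_integrable[OF that] L(2)]
      by (simp add: integral_vec_nth)
  qed
  have "(\<integral>x. D (Suc 0) 0 x * g x $ 2 \<partial>cell_measure) = (\<integral>x. D 0 (Suc 0) x * g x $ 1 \<partial>cell_measure)"
    using eq[OF tD(1), of 2] eq[OF tD(2), of 1] by (simp add: cg)
  moreover have "integrable cell_measure (\<lambda>x. D (Suc 0) 0 x * g x $ 2)" "integrable cell_measure (\<lambda>x. D 0 (Suc 0) x * g x $ 1)"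
    by (intro square_integrable_mult test_function_square_integrable tD square_integrable_nth L)+
  moreover have "(\<integral>x. (R_perp *v g x) \<bullet> classical_grad \<psi> x \<partial>cell_measure)
      = (\<integral>x. D 0 (Suc 0) x * g x $ 1 - D (Suc 0) 0 x * g x $ 2 \<partial>cell_measure)"
    using cg[of 0 0] D(1) by (intro Bochner_Integration.integral_cong refl) (simp add: inner_vec_def sum_2 mult.commute)
  ultimately show "(\<integral>x. (R_perp *v g x) \<bullet> classical_grad \<psi> x \<partial>cell_measure) = 0" by simp
qed

lemma grad_field_properties:
  assumes "grad_field c e"
  shows "square_integrable cell_measure e" "integral\<^sup>L cell_measure e = c" "cell_periodic e"
    "divergence_free (\<lambda>x. R_perp *v e x)" "square_integrable cell_measure (\<lambda>x. R_perp *v e x)"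
proof -
  obtain \<phi> g where H: "H1_per_grad \<phi> g" and e: "e = (\<lambda>x. c + g x)"
    using assms unfolding grad_field_def by blast
  have L: "L2_per g" using H by (simp add: H1_per_grad_def)
  have g: "square_integrable cell_measure g" by (rule L2_per_square_integrable[OF L])
  show es: "square_integrable cell_measure e"
    unfolding e by (intro square_integrable_add g square_integrable_const) simp
  show "integral\<^sup>L cell_measure e = c"
    unfolding e using H1_per_grad_mean[OF H] square_integrable_integrable[OF _ g]
    by (simp add: finite_measure.integrable_const)
  show "cell_periodic e" using L unfolding e L2_per_def cell_periodic_def by simp
  have R: "bounded_linear ((*v) R_perp)" by (rule matrix_vector_mul_bounded_linear)
  show "square_integrable cell_measure (\<lambda>x. R_perp *v e x)"
    by (rule square_integrable_bounded_linear[OF es R])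
  have "divergence_free (\<lambda>x. R_perp *v c + R_perp *v g x)"
    by (intro divergence_free_add divergence_free_const H1_per_grad_rotated[OF H]
        square_integrable_bounded_linear[OF g R] square_integrable_const) simp
  then show "divergence_free (\<lambda>x. R_perp *v e x)" by (simp add: e matrix_vector_right_distrib)
qed

subsection \<open>Blocks\<close>

definition tpair :: "vec2 \<Rightarrow> vec2 \<Rightarrow> tvec" where
  "tpair a b = (\<chi> p. if fst p = 1 then a $ snd p else b $ snd p)"

definition block :: "tmat \<Rightarrow> 2 \<Rightarrow> 2 \<Rightarrow> mat2" where
  "block A i j = (\<chi> k l. A $ (i, k) $ (j, l))"

lemma component_tpair [simp]: "component 1 (tpair a b) = a" "component 2 (tpair a b) = b"
  by (simp_all add: component_def tpair_def vec_eq_iff)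

lemma tvec_eqI:
  assumes "component 1 E = component 1 F" "component 2 E = component 2 F"
  shows "E = F"
proof -
  have "E $ (i, k) = F $ (i, k)" for i k
    using assms exhaust_2[of i] by (auto simp: component_def vec_eq_iff)
  then show ?thesis by (auto simp: vec_eq_iff)
qed

lemma tpair_component [simp]: "tpair (component 1 E) (component 2 E) = E"
  by (rule tvec_eqI) simp_all

lemma sum_block_index: "(\<Sum>p\<in>(UNIV :: (2 \<times> 2) set). f p) = (\<Sum>k\<in>UNIV. f (1, k)) + (\<Sum>k\<in>UNIV. f (2, k))"
  for f :: "2 \<times> 2 \<Rightarrow> 'a::comm_monoid_add"
  by (simp add: UNIV_Times_UNIV[symmetric] sum.cartesian_product' sum_2 del: UNIV_Times_UNIV)

lemma inner_tvec: "E \<bullet> F = component 1 E \<bullet> component 1 F + component 2 E \<bullet> component 2 F"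
  by (simp add: inner_vec_def sum_block_index component_def)

lemma component_mult:
  "component i (A *v E) = block A i 1 *v component 1 E + block A i 2 *v component 2 E"
  by (simp add: component_def block_def vec_eq_iff matrix_vector_mult_def sum_block_index)

lemma component_linear:
  "component i (E + F) = component i E + component i F"
  "component i (E - F) = component i E - component i F"
  "component i 0 = 0"
  by (simp_all add: component_def vec_eq_iff)

lemma bounded_linear_component: "bounded_linear (component i)"
  by (rule linear_conv_bounded_linear[THEN iffD1])
    (simp add: linear_iff component_def vec_eq_iff)

lemma tmat_eqI: "(\<And>i j. block A i j = block B i j) \<Longrightarrow> A = B"
  by (auto simp: block_def vec_eq_iff)

lemma block_block_matrix [simp]:
  "block (block_matrix A B C D) 1 1 = A" "block (block_matrix A B C D) 1 2 = B"
  "block (block_matrix A B C D) 2 1 = C" "block (block_matrix A B C D) 2 2 = D"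
  by (simp_all add: block_def block_matrix_def vec_eq_iff)

lemma R_perp_entries [simp]: "R_perp $ 1 $ 1 = 0" "R_perp $ 1 $ 2 = -1" "R_perp $ 2 $ 1 = 1" "R_perp $ 2 $ 2 = 0"
  by (simp_all add: R_perp_def)

lemma block_T_mat [simp]:
  "block T_mat 1 1 = 0" "block T_mat 1 2 = - R_perp" "block T_mat 2 1 = R_perp" "block T_mat 2 2 = 0"
  by (simp_all add: T_mat_def kron_def)

lemma matrix_vector_mult_minus_left: "(- A) *v x = - (A *v x)"
  for A :: "real^'n^'m"
  by (simp add: vec_eq_iff matrix_vector_mult_def sum_negf)

lemma component_T_mat [simp]:
  "component 1 (T_mat *v E) = - (R_perp *v component 2 E)"
  "component 2 (T_mat *v E) = R_perp *v component 1 E"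
  by (simp_all add: component_mult matrix_vector_mult_minus_left)

text \<open>With \<open>j = L (e\<^sub>1 + M e\<^sub>2)\<close> the two components are
  \<open>j - R\<^sub>\<bottom> e\<^sub>2\<close> and
  \<open>M\<^sup>T j + R\<^sub>\<bottom> e\<^sub>1\<close>, which separates the unknown current from
  the part due to \<open>T_mat\<close>.\<close>

lemma component_frakL:
  "component 1 (frakL L M *v E) = L *v (component 1 E + M *v component 2 E) - R_perp *v component 2 E"
  "component 2 (frakL L M *v E) = transpose M *v (L *v (component 1 E + M *v component 2 E)) + R_perp *v component 1 E"
proof -
  have "frakL L M *v E = block_matrix L (L ** M) (transpose M ** L) (transpose M ** L ** M) *v E + T_mat *v E"
    by (simp add: frakL_def matrix_vector_mult_add_rdistrib)
  note eq = arg_cong[OF this, of "component _", unfolded component_linear, unfolded component_mult[of _ "block_matrix _ _ _ _"]]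
  show "component 1 (frakL L M *v E) = L *v (component 1 E + M *v component 2 E) - R_perp *v component 2 E"
    "component 2 (frakL L M *v E) = transpose M *v (L *v (component 1 E + M *v component 2 E)) + R_perp *v component 1 E"
    unfolding eq component_T_mat
    by (simp_all add: matrix_vector_right_distrib matrix_vector_mul_assoc matrix_mul_assoc)
qed

lemma frakL_eqI:
  assumes "block (A - T_mat) 1 1 = L" "block (A - T_mat) 1 2 = L ** M"
    "block (A - T_mat) 2 1 = transpose M ** L" "block (A - T_mat) 2 2 = transpose M ** L ** M"
  shows "A = frakL L M"
proof -
  have "A - T_mat = block_matrix L (L ** M) (transpose M ** L) (transpose M ** L ** M)"
  proof (rule tmat_eqI)
    show "block (A - T_mat) i j = block (block_matrix L (L ** M) (transpose M ** L) (transpose M ** L ** M)) i j" for i j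
      using assms exhaust_2[of i] exhaust_2[of j] by auto
  qed
  then show ?thesis by (simp add: frakL_def algebra_simps)
qed

lemma R_perp_R_perp [simp]: "R_perp *v (R_perp *v v) = - v"
  by (simp add: vec_eq_iff forall_2)

lemma inner_R_perp: "v \<bullet> (R_perp *v w) = - ((R_perp *v v) \<bullet> w)"
  by (simp add: inner_vec_def sum_2)

subsection \<open>Cell problems\<close>

lemma square_integrable_vecI:
  fixes f :: "'a \<Rightarrow> real^'n"
  assumes "\<And>k. square_integrable M (\<lambda>x. f x $ k)"
  shows "square_integrable M f"
proof -
  have "square_integrable M (\<lambda>x. \<Sum>k\<in>UNIV. (f x $ k) *\<^sub>R axis k (1::real))"
    by (intro square_integrable_sum square_integrable_bounded_linear[OF assms bounded_linear_scaleR_left])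
  moreover have eq: "(\<lambda>x. \<Sum>k\<in>UNIV. (f x $ k) *\<^sub>R axis k (1::real)) = f"
    by (simp add: fun_eq_iff vec_eq_iff axis_def if_distrib cong: if_cong)
  ultimately show ?thesis by (simp only: eq)
qed

lemma square_integrable_bounded_mult:
  fixes f g :: "'a \<Rightarrow> real"
  assumes [measurable]: "f \<in> borel_measurable M" and B: "\<And>x. \<bar>f x\<bar> \<le> B" and g: "square_integrable M g"
  shows "square_integrable M (\<lambda>x. f x * g x)"
  unfolding square_integrable_def
proof
  have [measurable]: "g \<in> borel_measurable M" using g by (simp add: square_integrable_def)
  show "(\<lambda>x. f x * g x) \<in> borel_measurable M" by measurable
  show "integrable M (\<lambda>x. (norm (f x * g x))\<^sup>2)"
  proof (rule Bochner_Integration.integrable_bound)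
    show "integrable M (\<lambda>x. B\<^sup>2 * (norm (g x))\<^sup>2)" using g by (simp add: square_integrable_def)
    have "(f x * g x)\<^sup>2 \<le> B\<^sup>2 * (g x)\<^sup>2" for x
      using power_mono[OF B[of x] abs_ge_zero, of 2] by (simp add: power_mult_distrib mult_right_mono)
    then show "AE x in M. norm ((norm (f x * g x))\<^sup>2) \<le> norm (B\<^sup>2 * (norm (g x))\<^sup>2)" by simp
  qed measurable
qed

lemma composite_mult_square_integrable:
  assumes L: "composite L" and E: "square_integrable cell_measure E"
  shows "square_integrable cell_measure (\<lambda>x. L x *v E x)"
proof (rule square_integrable_vecI)
  fix p
  obtain K where "compact K" "range L \<subseteq> K" using L unfolding composite_def by blast
  then obtain B where B: "\<And>x. norm (L x) \<le> B"
    by (meson bounded_iff compact_imp_bounded rangeI subsetD)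
  have "square_integrable cell_measure (\<lambda>x. L x $ p $ q * E x $ q)" for q
  proof (rule square_integrable_bounded_mult)
    have "L \<in> borel_measurable cell_measure"
      using L by (simp add: composite_def borel_measurable_cellI)
    then have "square_integrable cell_measure L"
      by (intro square_integrable_bounded[where B = B]) (use B in auto)
    then have "square_integrable cell_measure (\<lambda>x. L x $ p $ q)"
      using square_integrable_bounded_linear[OF _ bounded_linear_compose[OF bounded_linear_vec_nth bounded_linear_vec_nth]] by blast
    then show "(\<lambda>x. L x $ p $ q) \<in> borel_measurable cell_measure" by (simp add: square_integrable_def)
    show "\<bar>L x $ p $ q\<bar> \<le> B" for x
      using component_le_norm_cart[of "L x $ p" q] Finite_Cartesian_Product.norm_nth_le[of "L x" p] B[of x] by linarith
    show "square_integrable cell_measure (\<lambda>x. E x $ q)" by (rule square_integrable_nth[OF E])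
  qed
  then have "square_integrable cell_measure (\<lambda>x. \<Sum>q\<in>UNIV. L x $ p $ q * E x $ q)"
    by (intro square_integrable_sum)
  then show "square_integrable cell_measure (\<lambda>x. (L x *v E x) $ p)" by (simp add: matrix_vector_mult_def)
qed

text \<open>Since \<open>e = - R\<^sub>\<bottom> (R\<^sub>\<bottom> e)\<close> and
  \<open>R\<^sub>\<bottom> e\<close> is solenoidal, this is the div-curl identity once more. It
  permits pairing with gradients of \<open>H\<^sup>1\<close> potentials without approximating them
  by smooth functions.\<close>

lemma integral_grad_field:
  assumes e: "grad_field c e" and J: "square_integrable cell_measure J" "divergence_free J"
  shows "(\<integral>x. J x \<bullet> e x \<partial>cell_measure) = integral\<^sup>L cell_measure J \<bullet> c"
proof -
  note p = grad_field_properties[OF e]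
  have "(\<integral>x. R_perp *v e x \<partial>cell_measure) = R_perp *v c"
    using integral_bounded_linear[OF matrix_vector_mul_bounded_linear square_integrable_integrable[OF _ p(1)]] p(2) by simp
  then show ?thesis using div_curl[OF J p(5,4)] by (simp)
qed

lemma cell_field_iff:
  "cell_field L E0 E \<longleftrightarrow> (\<forall>i. grad_field (component i E0) (\<lambda>x. component i (E x)))
    \<and> (\<forall>i. divergence_free (\<lambda>x. component i (L x *v E x)))"
proof -
  have "(\<exists>\<phi> g. (\<forall>i. H1_per_grad (\<phi> i) (g i)) \<and> (\<forall>x i k. E x $ (i, k) = E0 $ (i, k) + g i x $ k))
      \<longleftrightarrow> (\<forall>i. grad_field (component i E0) (\<lambda>x. component i (E x)))" (is "?l = ?r")
  proof
    assume ?l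
    then obtain \<phi> g where *: "\<And>i. H1_per_grad (\<phi> i) (g i)" "\<And>x i k. E x $ (i, k) = E0 $ (i, k) + g i x $ k" by blast
    show ?r unfolding grad_field_def
    proof
      fix i
      show "\<exists>\<phi> g. H1_per_grad \<phi> g \<and> (\<lambda>x. component i (E x)) = (\<lambda>x. component i E0 + g x)"
        by (intro exI[of _ "\<phi> i"] exI[of _ "g i"]) (simp add: * component_def vec_eq_iff fun_eq_iff)
    qed
  next
    assume ?r
    then have "\<forall>i. \<exists>\<phi> g. H1_per_grad \<phi> g \<and> (\<lambda>x. component i (E x)) = (\<lambda>x. component i E0 + g x)"
      unfolding grad_field_def by blast
    then obtain \<phi> g where "\<And>i. H1_per_grad (\<phi> i) (g i) \<and> (\<lambda>x. component i (E x)) = (\<lambda>x. component i E0 + g i x)"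
      by metis
    then show ?l
      by (intro exI[of _ \<phi>] exI[of _ g]) (simp add: component_def vec_eq_iff fun_eq_iff)
  qed
  then show ?thesis by (simp add: cell_field_def)
qed

lemma square_integrable_tpair:
  assumes "square_integrable M e1" "square_integrable M e2"
  shows "square_integrable M (\<lambda>x. tpair (e1 x) (e2 x))"
proof (rule square_integrable_vecI)
  fix p
  show "square_integrable M (\<lambda>x. tpair (e1 x) (e2 x) $ p)"
    using square_integrable_nth[OF assms(1)] square_integrable_nth[OF assms(2)]
    by (cases "fst p = 1") (simp_all add: tpair_def)
qed

lemma cell_field_square_integrable:
  assumes "cell_field L E0 E"
  shows "square_integrable cell_measure E"
proof -
  have "grad_field (component i E0) (\<lambda>x. component i (E x))" for i
    using assms by (simp add: cell_field_iff)
  from square_integrable_tpair[OF grad_field_properties(1)[OF this[of 1]] grad_field_properties(1)[OF this[of 2]]]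
  show ?thesis by simp
qed

lemma cell_periodic_component:
  assumes "cell_periodic (\<lambda>x. component 1 (E x))" "cell_periodic (\<lambda>x. component 2 (E x))"
  shows "cell_periodic E"
  using assms unfolding cell_periodic_def by (blast intro: tvec_eqI)

text \<open>The difference of two solutions has gradients of mean zero and a solenoidal image under
  \<open>L\<close>, so its energy integrates to 0, while \<open>L x\<close> is positive definite.
  The new composite obtains its uniqueness clause from here as well.\<close>

lemma cell_field_unique:
  assumes L: "composite L" and E: "cell_field L E0 E" and F: "cell_field L E0 F"
  shows "AE x in lebesgue. F x = E x"
proof -
  define D where "D x = F x - E x" for x
  have gE: "grad_field (component i E0) (\<lambda>x. component i (E x))" "divergence_free (\<lambda>x. component i (L x *v E x))" for i
    using E by (simp_all add: cell_field_iff)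
  have gF: "grad_field (component i E0) (\<lambda>x. component i (F x))" "divergence_free (\<lambda>x. component i (L x *v F x))" for i
    using F by (simp_all add: cell_field_iff)
  have gD: "grad_field 0 (\<lambda>x. component i (D x))" for i
    using grad_field_add[OF gF(1)[of i] grad_field_scaleR[OF gE(1)[of i], of "-1"]]
    by (simp add: D_def component_linear)
  have LE: "square_integrable cell_measure (\<lambda>x. L x *v E x)"
    by (rule composite_mult_square_integrable[OF L cell_field_square_integrable[OF E]])
  have LF: "square_integrable cell_measure (\<lambda>x. L x *v F x)"
    by (rule composite_mult_square_integrable[OF L cell_field_square_integrable[OF F]])
  have Ds: "square_integrable cell_measure D"
    unfolding D_def[abs_def]
    by (intro square_integrable_diff cell_field_square_integrable[OF E] cell_field_square_integrable[OF F])
  have LD: "square_integrable cell_measure (\<lambda>x. L x *v D x)"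
    by (rule composite_mult_square_integrable[OF L Ds])
  have cLD: "square_integrable cell_measure (\<lambda>x. component i (L x *v D x))" for i
    by (rule square_integrable_bounded_linear[OF LD bounded_linear_component])
  have dD: "divergence_free (\<lambda>x. component i (L x *v D x))" for i
    using divergence_free_diff[OF square_integrable_bounded_linear[OF LF bounded_linear_component] gF(2)
        square_integrable_bounded_linear[OF LE bounded_linear_component] gE(2), of i]
    by (simp add: D_def matrix_vector_mult_diff_distrib component_linear)
  have "(\<integral>x. D x \<bullet> (L x *v D x) \<partial>cell_measure)
      = (\<integral>x. component 1 (L x *v D x) \<bullet> component 1 (D x) + component 2 (L x *v D x) \<bullet> component 2 (D x) \<partial>cell_measure)"
    by (simp add: inner_tvec inner_commute)
  also have "\<dots> = 0"
    using integral_grad_field[OF gD cLD dD] square_integrable_inner[OF cLD grad_field_properties(1)[OF gD]]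
    by simp
  finally have i0: "(\<integral>x. D x \<bullet> (L x *v D x) \<partial>cell_measure) = 0" .
  have pos: "pos_def (L x)" for x
    using L unfolding composite_def Sym_plus_def by auto
  then have "0 \<le> D x \<bullet> (L x *v D x)" for x
    unfolding pos_def_def by (cases "D x = 0") (auto simp: less_imp_le)
  then have "AE x in cell_measure. D x \<bullet> (L x *v D x) = 0"
    using i0 integral_nonneg_eq_0_iff_AE[OF square_integrable_inner[OF Ds LD]] by simp
  then have "AE x in cell_measure. F x = E x"
  proof eventually_elim
    case (elim x)
    then have "D x = 0" using pos[of x] unfolding pos_def_def by (metis less_irrefl)
    then show ?case by (simp add: D_def)
  qed
  moreover have "cell_periodic E" "cell_periodic F"
    using grad_field_properties(3)[OF gE(1)] grad_field_properties(3)[OF gF(1)]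
    by (auto intro: cell_periodic_component)
  ultimately show ?thesis
    by (intro AE_cell_imp_AE_lebesgue) (simp_all add: cell_periodic_def)
qed

definition current_pair :: "(vec2 \<Rightarrow> mat2) \<Rightarrow> (vec2 \<Rightarrow> vec2) \<Rightarrow> (vec2 \<Rightarrow> vec2) \<Rightarrow> bool" where
  "current_pair m j1 j2 \<longleftrightarrow> square_integrable cell_measure j1 \<and> square_integrable cell_measure j2
     \<and> divergence_free j1 \<and> divergence_free j2 \<and> (AE x in cell_measure. j2 x = transpose (m x) *v j1 x)"

text \<open>The fields \<open>j1\<close>, \<open>j2\<close> are the components of \<open>(L - T_mat) E\<close>, where \<open>E = (e1, e2)\<close>.\<close>

definition cell_solution where
  "cell_solution l m a b e1 e2 j1 j2 \<longleftrightarrow> grad_field a e1 \<and> grad_field b e2 \<and> current_pair m j1 j2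
     \<and> (AE x in cell_measure. j1 x = l x *v (e1 x + m x *v e2 x))"

lemma integral_bounded_linear_cell:
  "bounded_linear h \<Longrightarrow> square_integrable cell_measure f \<Longrightarrow> (\<integral>x. h (f x) \<partial>cell_measure) = h (integral\<^sup>L cell_measure f)"
  by (rule integral_bounded_linear) (simp_all add: square_integrable_integrable)

lemma cell_field_imp_solution:
  assumes L: "composite L" and lm: "AE x in cell_measure. L x = frakL (l x) (m x)" and E: "cell_field L E0 E"
  defines "j1 \<equiv> \<lambda>x. component 1 (L x *v E x) + R_perp *v component 2 (E x)"
    and "j2 \<equiv> \<lambda>x. component 2 (L x *v E x) - R_perp *v component 1 (E x)"
  shows "cell_solution l m (component 1 E0) (component 2 E0) (\<lambda>x. component 1 (E x)) (\<lambda>x. component 2 (E x)) j1 j2"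
proof -
  have g: "grad_field (component i E0) (\<lambda>x. component i (E x))" "divergence_free (\<lambda>x. component i (L x *v E x))" for i
    using E by (simp_all add: cell_field_iff)
  note p = grad_field_properties[OF g(1)]
  have s: "square_integrable cell_measure (\<lambda>x. component i (L x *v E x))" for i
    by (intro square_integrable_bounded_linear[OF _ bounded_linear_component] composite_mult_square_integrable[OF L]
        cell_field_square_integrable[OF E])
  have a: "AE x in cell_measure. j1 x = l x *v (component 1 (E x) + m x *v component 2 (E x))
      \<and> j2 x = transpose (m x) *v j1 x"
    using lm by eventually_elim (simp add: j1_def j2_def component_frakL)
  have "square_integrable cell_measure j1" "square_integrable cell_measure j2" "divergence_free j1" "divergence_free j2"
    unfolding j1_def j2_def
    by (intro square_integrable_add square_integrable_diff divergence_free_add divergence_free_diff s g p)+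
  with a g show ?thesis unfolding cell_solution_def current_pair_def by auto
qed

lemma cell_solution_imp_field:
  assumes L: "composite L" and lm: "AE x in cell_measure. L x = frakL (l x) (m x)"
    and sol: "cell_solution l m a b e1 e2 j1 j2"
  defines "E \<equiv> \<lambda>x. tpair (e1 x) (e2 x)"
  shows "cell_field L (tpair a b) E"
    "(\<integral>x. L x *v E x \<partial>cell_measure) = tpair (integral\<^sup>L cell_measure j1) (integral\<^sup>L cell_measure j2) + T_mat *v tpair a b"
proof -
  have g: "grad_field a e1" "grad_field b e2"
    and j: "square_integrable cell_measure j1" "square_integrable cell_measure j2" "divergence_free j1" "divergence_free j2"
    and a: "AE x in cell_measure. j2 x = transpose (m x) *v j1 x" "AE x in cell_measure. j1 x = l x *v (e1 x + m x *v e2 x)"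
    using sol by (auto simp: cell_solution_def current_pair_def)
  note p = grad_field_properties[OF g(1)] grad_field_properties[OF g(2)]
  have Es: "square_integrable cell_measure E" unfolding E_def by (intro square_integrable_tpair p)
  have LE: "square_integrable cell_measure (\<lambda>x. L x *v E x)" by (rule composite_mult_square_integrable[OF L Es])
  have s: "square_integrable cell_measure (\<lambda>x. component i (L x *v E x))" for i
    by (rule square_integrable_bounded_linear[OF LE bounded_linear_component])
  have c: "AE x in cell_measure. component 1 (L x *v E x) = j1 x - R_perp *v e2 x"
    "AE x in cell_measure. component 2 (L x *v E x) = j2 x + R_perp *v e1 x"
    using lm a by (eventually_elim, simp add: component_frakL E_def)+
  have d: "square_integrable cell_measure (\<lambda>x. j1 x - R_perp *v e2 x)" "square_integrable cell_measure (\<lambda>x. j2 x + R_perp *v e1 x)"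
    "divergence_free (\<lambda>x. j1 x - R_perp *v e2 x)" "divergence_free (\<lambda>x. j2 x + R_perp *v e1 x)"
    by (intro square_integrable_add square_integrable_diff divergence_free_add divergence_free_diff j p)+
  have "divergence_free (\<lambda>x. component i (L x *v E x))" for i
    using divergence_free_cong[OF d(3,1) s c(1)] divergence_free_cong[OF d(4,2) s c(2)] exhaust_2[of i] by auto
  moreover have "grad_field (component i (tpair a b)) (\<lambda>x. component i (E x))" for i
    using g exhaust_2[of i] by (auto simp: E_def)
  ultimately show "cell_field L (tpair a b) E" by (simp add: cell_field_iff)
  have I: "component i (\<integral>x. L x *v E x \<partial>cell_measure) = (\<integral>x. component i (L x *v E x) \<partial>cell_measure)" for i
    by (rule integral_bounded_linear_cell[OF bounded_linear_component LE, symmetric])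
  have R: "(\<integral>x. R_perp *v e1 x \<partial>cell_measure) = R_perp *v a" "(\<integral>x. R_perp *v e2 x \<partial>cell_measure) = R_perp *v b"
    using integral_bounded_linear_cell[OF matrix_vector_mul_bounded_linear p(1), of R_perp]
      integral_bounded_linear_cell[OF matrix_vector_mul_bounded_linear p(6), of R_perp] p(2,7) by simp_all
  note int = square_integrable_integrable[OF finite_measure_cell]
  have "(\<integral>x. component 1 (L x *v E x) \<partial>cell_measure) = (\<integral>x. j1 x - R_perp *v e2 x \<partial>cell_measure)"
    using c(1) s d(1) by (intro integral_cong_AE) (auto simp: square_integrable_def)
  moreover have "(\<integral>x. component 2 (L x *v E x) \<partial>cell_measure) = (\<integral>x. j2 x + R_perp *v e1 x \<partial>cell_measure)"
    using c(2) s d(2) by (intro integral_cong_AE) (auto simp: square_integrable_def)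
  ultimately show "(\<integral>x. L x *v E x \<partial>cell_measure)
      = tpair (integral\<^sup>L cell_measure j1) (integral\<^sup>L cell_measure j2) + T_mat *v tpair a b"
    using int[OF j(1)] int[OF j(2)] int[OF p(5)] int[OF p(10)]
    by (intro tvec_eqI) (simp_all add: I component_linear R)
qed

text \<open>By the uniqueness clause in the definition of \<open>A\<close>, the formula for the
  means holds for every solution with data \<open>(a, b)\<close>, however it was found.\<close>

lemma effective_tensorD:
  assumes L: "composite L" and lm: "AE x in cell_measure. L x = frakL (l x) (m x)" and A: "is_effective_tensor L A"
  shows "\<exists>e1 e2 j1 j2. cell_solution l m a b e1 e2 j1 j2"
    "cell_solution l m a b e1 e2 j1 j2 \<Longrightarrow>
      integral\<^sup>L cell_measure j1 = block (A - T_mat) 1 1 *v a + block (A - T_mat) 1 2 *v b \<and>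
      integral\<^sup>L cell_measure j2 = block (A - T_mat) 2 1 *v a + block (A - T_mat) 2 2 *v b"
proof -
  obtain E where E: "cell_field L (tpair a b) E" "\<And>E'. cell_field L (tpair a b) E' \<Longrightarrow> AE x in lebesgue. E' x = E x"
    "A *v tpair a b = (\<integral>x. L x *v E x \<partial>cell_measure)"
    using A unfolding is_effective_tensor_def set_integral_cell by blast
  show "\<exists>e1 e2 j1 j2. cell_solution l m a b e1 e2 j1 j2"
    using cell_field_imp_solution[OF L lm E(1)] by auto
  assume sol: "cell_solution l m a b e1 e2 j1 j2"
  note F = cell_solution_imp_field[OF L lm sol]
  have "AE x in cell_measure. tpair (e1 x) (e2 x) = E x"
    unfolding AE_cell_iff using E(2)[OF F(1)] by eventually_elim simp
  then have "(\<integral>x. L x *v tpair (e1 x) (e2 x) \<partial>cell_measure) = (\<integral>x. L x *v E x \<partial>cell_measure)"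
    using composite_mult_square_integrable[OF L cell_field_square_integrable[OF E(1)]]
      composite_mult_square_integrable[OF L cell_field_square_integrable[OF F(1)]]
    by (intro integral_cong_AE) (auto simp: square_integrable_def elim: eventually_mono)
  then have "tpair (integral\<^sup>L cell_measure j1) (integral\<^sup>L cell_measure j2) = (A - T_mat) *v tpair a b"
    using F(2) E(3) by (simp add: matrix_vector_mult_diff_rdistrib algebra_simps)
  from arg_cong[OF this, of "component 1"] arg_cong[OF this, of "component 2"]
  show "integral\<^sup>L cell_measure j1 = block (A - T_mat) 1 1 *v a + block (A - T_mat) 1 2 *v b \<and>
      integral\<^sup>L cell_measure j2 = block (A - T_mat) 2 1 *v a + block (A - T_mat) 2 2 *v b"
    unfolding component_mult[of _ "A - T_mat"] component_tpair by blast
qed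

lemma effective_tensorI:
  assumes L: "composite L" and lm: "AE x in cell_measure. L x = frakL (l x) (m x)"
    and sol: "\<And>a b. \<exists>e1 e2 j1 j2. cell_solution l m a b e1 e2 j1 j2
      \<and> integral\<^sup>L cell_measure j1 = L0 *v (a + M0 *v b)
      \<and> integral\<^sup>L cell_measure j2 = transpose M0 *v (L0 *v (a + M0 *v b))"
  shows "is_effective_tensor L (frakL L0 M0)"
  unfolding is_effective_tensor_def set_integral_cell
proof
  fix E0
  obtain e1 e2 j1 j2 where s: "cell_solution l m (component 1 E0) (component 2 E0) e1 e2 j1 j2"
    and j: "integral\<^sup>L cell_measure j1 = L0 *v (component 1 E0 + M0 *v component 2 E0)"
      "integral\<^sup>L cell_measure j2 = transpose M0 *v (L0 *v (component 1 E0 + M0 *v component 2 E0))"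
    using sol by blast
  note F = cell_solution_imp_field[OF L lm s, simplified]
  have "frakL L0 M0 *v E0 = (\<integral>x. L x *v tpair (e1 x) (e2 x) \<partial>cell_measure)"
    unfolding F(2) by (rule tvec_eqI) (simp_all add: component_frakL component_linear j)
  then show "\<exists>E. cell_field L E0 E \<and> (\<forall>E'. cell_field L E0 E' \<longrightarrow> (AE x in lebesgue. E' x = E x)) \<and>
      frakL L0 M0 *v E0 = (\<integral>x. L x *v E x \<partial>cell_measure)"
    using F(1) cell_field_unique[OF L] by blast
qed

subsection \<open>Matrix algebra\<close>

declare transpose_matrix_vector [simp del]

lemma matrix_vector_mult_minus_right: "A *v (- x) = - (A *v x)"
  for A :: "real^'n^'m"
  by (simp add: vec_eq_iff matrix_vector_mult_def sum_negf)

lemma inner_transpose: "(transpose A *v x) \<bullet> y = x \<bullet> (A *v y)"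
  for A :: "real^'n^'m"
  by (simp add: transpose_matrix_vector dot_lmul_matrix)

lemma matrix_eq_transposeI:
  fixes A :: "real^'n^'m"
  assumes "\<And>x y. y \<bullet> (A *v x) = x \<bullet> (B *v y)"
  shows "A = transpose B"
proof -
  have "y \<bullet> (A *v x - transpose B *v x) = 0" for x y
    using assms[of y x] inner_transpose[of B x y] by (simp add: inner_diff_right inner_commute)
  then have "A *v x = transpose B *v x" for x
    by (metis eq_iff_diff_eq_0 inner_eq_zero_iff)
  then show ?thesis by (simp add: matrix_eq)
qed

lemma matrix_inv_invertible:
  fixes A :: "real^'n^'n"
  assumes "invertible A"
  shows "A ** matrix_inv A = mat 1" "matrix_inv A ** A = mat 1"
  using someI_ex[OF assms[unfolded invertible_def]] by (simp_all add: matrix_inv_def)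

lemma pos_def_inverse:
  fixes L :: "real^'n^'n"
  assumes "pos_def L"
  shows "matrix_inv L ** L = mat 1" "L ** matrix_inv L = mat 1"
proof -
  have "\<And>x. L *v x = 0 \<Longrightarrow> x = 0"
    using assms by (metis inner_zero_right less_irrefl pos_def_def)
  then have "invertible L"
    by (metis invertible_left_inverse matrix_left_invertible_ker)
  then show "matrix_inv L ** L = mat 1" "L ** matrix_inv L = mat 1"
    using matrix_inv_invertible by auto
qed

lemma pos_def_inverse_mult [simp]:
  fixes L :: "real^'n^'n"
  assumes "pos_def L"
  shows "matrix_inv L *v (L *v v) = v" "L *v (matrix_inv L *v v) = v"
  using pos_def_inverse[OF assms] by (simp_all add: matrix_vector_mul_assoc)

lemma pos_def_matrix_inv:
  fixes L :: "real^'n^'n"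
  assumes "pos_def L"
  shows "pos_def (matrix_inv L)"
  unfolding pos_def_def
proof (intro allI impI)
  fix v :: "real^'n" assume "v \<noteq> 0"
  then have "matrix_inv L *v v \<noteq> 0" using pos_def_inverse_mult(2)[OF assms, of v] by auto
  then have "0 < (matrix_inv L *v v) \<bullet> (L *v (matrix_inv L *v v))"
    using assms unfolding pos_def_def by blast
  then show "0 < v \<bullet> (matrix_inv L *v v)" using assms by (simp add: inner_commute)
qed

lemma matrix_inv_eqI:
  fixes A B :: "real^'n^'n"
  assumes "A ** B = mat 1" "B ** A = mat 1"
  shows "matrix_inv A = B"
proof -
  have "invertible A" using assms by (auto simp: invertible_def)
  then have "matrix_inv A ** A = mat 1" using matrix_inv_invertible by auto
  then show ?thesis by (metis assms(1) matrix_mul_assoc matrix_mul_lid matrix_mul_rid)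
qed

lemma matrix_inv_matrix_inv:
  fixes L :: "real^'n^'n"
  shows "pos_def L \<Longrightarrow> matrix_inv (matrix_inv L) = L"
  by (intro matrix_inv_eqI pos_def_inverse)

lemma sym_mat_matrix_inv:
  fixes L :: "real^'n^'n"
  assumes "pos_def L" "sym_mat L"
  shows "sym_mat (matrix_inv L)"
  unfolding sym_mat_def
proof (rule matrix_inv_eqI[symmetric])
  have "transpose (matrix_inv L ** L) = mat 1" "transpose (L ** matrix_inv L) = mat 1"
    using assms(1) by (simp_all add: pos_def_inverse transpose_mat)
  then show "L ** transpose (matrix_inv L) = mat 1" "transpose (matrix_inv L) ** L = mat 1"
    using assms(2) by (simp_all add: matrix_transpose_mul sym_mat_def)
qed

lemma sym_mat_inner: "sym_mat L \<Longrightarrow> (L *v x) \<bullet> y = x \<bullet> (L *v y)"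
  for L :: "real^'n^'n"
  using inner_transpose[of L x y] by (simp add: sym_mat_def)

text \<open>The square being \<open>- mat 1\<close> forces trace 0 and determinant 1: the
  off-diagonal entry \<open>M $ 1 $ 2\<close> cannot vanish, as otherwise a real square would equal
  -1.\<close>

lemma complex_structure_entries:
  fixes M :: mat2
  assumes "M ** M = - mat 1"
  shows "M $ 2 $ 2 = - M $ 1 $ 1" "M $ 1 $ 2 * M $ 2 $ 1 = - 1 - M $ 1 $ 1 * M $ 1 $ 1"
proof -
  have "(M ** M) $ i $ j = (- mat 1 :: mat2) $ i $ j" for i j using assms by simp
  from this[of 1 1] this[of 1 2] this[of 2 1] this[of 2 2]
  have e: "M $ 1 $ 1 * M $ 1 $ 1 + M $ 1 $ 2 * M $ 2 $ 1 = - 1"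
    "M $ 1 $ 1 * M $ 1 $ 2 + M $ 1 $ 2 * M $ 2 $ 2 = 0"
    by (simp_all add: matrix_matrix_mult_def sum_2 mat_def)
  have "M $ 1 $ 2 * (M $ 1 $ 1 + M $ 2 $ 2) = 0" using e(2) by (simp add: algebra_simps)
  moreover have "M $ 1 $ 2 \<noteq> 0"
    using e(1) zero_le_square[of "M $ 1 $ 1"] by (metis add.right_neutral mult_zero_left not_one_le_zero neg_0_le_iff_le)
  ultimately show "M $ 2 $ 2 = - M $ 1 $ 1" by simp
  show "M $ 1 $ 2 * M $ 2 $ 1 = - 1 - M $ 1 $ 1 * M $ 1 $ 1" using e(1) by simp
qed

text \<open>The last two identities express that \<open>R_perp ** M\<close> and
  \<open>M ** R_perp\<close> are symmetric, which for a 2 by 2 matrix \<open>M\<close> amounts to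
  trace zero.\<close>

lemma complex_structure_mult:
  fixes M :: mat2
  assumes "M ** M = - mat 1"
  shows "M *v (M *v v) = - v" "transpose M *v (transpose M *v v) = - v"
    "R_perp *v (M *v v) = - (transpose M *v (R_perp *v v))"
    "M *v (R_perp *v v) = - (R_perp *v (transpose M *v v))"
proof -
  show "M *v (M *v v) = - v"
    by (simp add: matrix_vector_mul_assoc assms matrix_vector_mult_minus_left)
  have "transpose M ** transpose M = - mat 1"
    unfolding matrix_transpose_mul[symmetric] assms by (simp add: vec_eq_iff transpose_def mat_def)
  then show "transpose M *v (transpose M *v v) = - v"
    by (simp add: matrix_vector_mul_assoc matrix_vector_mult_minus_left)
  show "R_perp *v (M *v v) = - (transpose M *v (R_perp *v v))"
    "M *v (R_perp *v v) = - (R_perp *v (transpose M *v v))"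
    using complex_structure_entries[OF assms]
    by (simp_all add: vec_eq_iff forall_2 matrix_vector_mult_def transpose_def sum_2 algebra_simps)
qed

lemma P_mat_mult:
  "P_mat \<gamma> L M *v v = \<gamma> *\<^sub>R (M *v (matrix_inv L *v (transpose M *v v))) + (1 + \<gamma>) *\<^sub>R (matrix_inv L *v v)
    + (2 * \<gamma>) *\<^sub>R (M *v (R_perp *v v))"
  by (simp add: P_mat_def matrix_vector_mult_add_rdistrib scaleR_matrix_vector_assoc[symmetric] matrix_vector_mul_assoc
      matrix_mul_assoc)

text \<open>A single family for all forms whose sign matters. With \<open>X = matrix_inv L\<close>
  the triples \<open>(1, 0, 2)\<close>, \<open>(1 + \<gamma>, \<gamma>, 2 * \<gamma>)\<close> and
  \<open>(1 + \<gamma>, \<gamma>, 2 * \<gamma> + 2)\<close> give the three inequalities, and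
  negativity is positivity for the negated triple.\<close>

definition qform :: "real \<Rightarrow> real \<Rightarrow> real \<Rightarrow> mat2 \<Rightarrow> mat2 \<Rightarrow> vec2 \<Rightarrow> real" where
  "qform \<alpha> \<beta> \<delta> X M v = \<alpha> * (v \<bullet> (X *v v)) + \<beta> * ((transpose M *v v) \<bullet> (X *v (transpose M *v v)))
    + \<delta> * ((transpose M *v v) \<bullet> (R_perp *v v))"

lemma qform_P_mat:
  "v \<bullet> (P_mat \<gamma> L M *v v) = qform (1 + \<gamma>) \<gamma> (2 * \<gamma>) (matrix_inv L) M v"
  by (simp add: P_mat_mult qform_def inner_add_right inner_transpose)

lemma qform_shift:
  "qform \<alpha> \<beta> \<delta> X M v + v \<bullet> ((2 *\<^sub>R (M ** R_perp)) *v v) = qform \<alpha> \<beta> (\<delta> + 2) X M v"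
  by (simp add: qform_def inner_transpose scaleR_matrix_vector_assoc[symmetric] matrix_vector_mul_assoc[symmetric] algebra_simps)

lemma qform_neg: "qform (- \<alpha>) (- \<beta>) (- \<delta>) X M v = - qform \<alpha> \<beta> \<delta> X M v"
  by (simp add: qform_def)

lemma params19_iff_qform:
  "params19 L M \<longleftrightarrow> sym_mat L \<and> M ** M = - mat 1 \<and> pos_def L \<and> (\<forall>v. v \<noteq> 0 \<longrightarrow> qform 1 0 2 (matrix_inv L) M v < 0)"
  using qform_shift[of 1 0 0 "matrix_inv L" M]
  by (simp add: params19_def neg_def_def matrix_vector_mult_add_rdistrib inner_add_right qform_def)

lemma Phi_params_iff_qform:
  "Phi_params \<gamma> L M \<longleftrightarrow> params19 L M
    \<and> (\<forall>v. v \<noteq> 0 \<longrightarrow> qform (1 + \<gamma>) \<gamma> (2 * \<gamma>) (matrix_inv L) M v > 0)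
    \<and> (\<forall>v. v \<noteq> 0 \<longrightarrow> qform (1 + \<gamma>) \<gamma> (2 * \<gamma> + 2) (matrix_inv L) M v < 0)"
  unfolding Phi_params_def pos_def_def neg_def_def qform_P_mat qform_shift[symmetric]
  by (simp add: matrix_vector_mult_add_rdistrib inner_add_right qform_P_mat)

text \<open>\<open>2 M R\<^sub>\<bottom>\<close> is the negative definite
  \<open>X + 2 M R\<^sub>\<bottom>\<close> minus the positive definite \<open>X\<close>.\<close>

lemma params19_rotation_negative:
  assumes "params19 L M" "v \<noteq> 0"
  shows "(transpose M *v v) \<bullet> (R_perp *v v) < 0"
proof -
  have "0 < v \<bullet> (matrix_inv L *v v)" "qform 1 0 2 (matrix_inv L) M v < 0"
    using assms pos_def_matrix_inv[of L] by (auto simp: params19_iff_qform pos_def_def)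
  then show ?thesis by (simp add: qform_def)
qed

subsection \<open>The homogenized tensor\<close>

text \<open>The matrices stand for the blocks of \<open>A - T_mat\<close>. Only existence of
  solutions and the formula for their means are recorded; measurability is a property of the fields,
  so \<open>l\<close> and \<open>m\<close> may result from a pointwise choice.\<close>

locale homogenization =
  fixes l m :: "vec2 \<Rightarrow> mat2" and B11 B12 B21 B22 :: mat2
  assumes params: "AE x in cell_measure. params19 (l x) (m x)"
    and solution_exists: "\<And>a b. \<exists>e1 e2 j1 j2. cell_solution l m a b e1 e2 j1 j2"
    and solution_mean: "\<And>a b e1 e2 j1 j2. cell_solution l m a b e1 e2 j1 j2 \<Longrightarrow>
      integral\<^sup>L cell_measure j1 = B11 *v a + B12 *v b \<and> integral\<^sup>L cell_measure j2 = B21 *v a + B22 *v b"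
begin

text \<open>The integrand cancels pointwise because \<open>M ** R_perp\<close> is symmetric, and
  div-curl transfers the cancellation to the means. The result detects data of zero energy before
  anything is known about the effective tensor.\<close>

lemma current_pair_sym:
  assumes j: "current_pair m j1 j2" and k: "current_pair m k1 k2"
  shows "integral\<^sup>L cell_measure j1 \<bullet> (R_perp *v integral\<^sup>L cell_measure k2)
    + integral\<^sup>L cell_measure j2 \<bullet> (R_perp *v integral\<^sup>L cell_measure k1) = 0"
proof -
  have s: "square_integrable cell_measure j1" "square_integrable cell_measure j2"
    "square_integrable cell_measure k1" "square_integrable cell_measure k2"
    and d: "divergence_free j1" "divergence_free j2" "divergence_free k1" "divergence_free k2"
    and a: "AE x in cell_measure. j2 x = transpose (m x) *v j1 x" "AE x in cell_measure. k2 x = transpose (m x) *v k1 x"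
    using j k by (auto simp: current_pair_def)
  have R: "square_integrable cell_measure (\<lambda>x. R_perp *v k1 x)" "square_integrable cell_measure (\<lambda>x. R_perp *v k2 x)"
    by (intro square_integrable_bounded_linear[OF _ matrix_vector_mul_bounded_linear] s)+
  note i = square_integrable_inner[OF s(1) R(2)] square_integrable_inner[OF s(2) R(1)]
  have "integral\<^sup>L cell_measure j1 \<bullet> (R_perp *v integral\<^sup>L cell_measure k2)
      + integral\<^sup>L cell_measure j2 \<bullet> (R_perp *v integral\<^sup>L cell_measure k1)
    = (\<integral>x. j1 x \<bullet> (R_perp *v k2 x) + j2 x \<bullet> (R_perp *v k1 x) \<partial>cell_measure)"
    using div_curl[OF s(1) d(1) s(4) d(4)] div_curl[OF s(2) d(2) s(3) d(3)] i by simp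
  also have "\<dots> = (\<integral>x. 0 \<partial>cell_measure)"
  proof (rule integral_cong_AE)
    show "AE x in cell_measure. j1 x \<bullet> (R_perp *v k2 x) + j2 x \<bullet> (R_perp *v k1 x) = 0"
      using a params
    proof eventually_elim
      case (elim x)
      then have "m x ** m x = - mat 1" by (simp add: params19_def)
      from complex_structure_mult(4)[OF this] show ?case
        by (simp add: elim inner_transpose)
    qed
  qed (use i in auto)
  finally show ?thesis by simp
qed

lemma current_pair_zero:
  assumes j: "current_pair m j1 j2" and 0: "integral\<^sup>L cell_measure j1 = 0"
  shows "AE x in cell_measure. j1 x = 0"
proof -
  have s: "square_integrable cell_measure j1" "square_integrable cell_measure j2"
    and d: "divergence_free j1" "divergence_free j2"
    and a: "AE x in cell_measure. j2 x = transpose (m x) *v j1 x"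
    using j by (auto simp: current_pair_def)
  have R: "square_integrable cell_measure (\<lambda>x. R_perp *v j1 x)"
    by (intro square_integrable_bounded_linear[OF _ matrix_vector_mul_bounded_linear] s)
  note i = square_integrable_inner[OF s(2) R]
  have n: "AE x in cell_measure. 0 \<le> - (j2 x \<bullet> (R_perp *v j1 x)) \<and> (j2 x \<bullet> (R_perp *v j1 x) = 0 \<longrightarrow> j1 x = 0)"
    using a params
  proof eventually_elim
    case (elim x)
    then show ?case using params19_rotation_negative[OF elim(2), of "j1 x"] by (cases "j1 x = 0") auto
  qed
  have "(\<integral>x. - (j2 x \<bullet> (R_perp *v j1 x)) \<partial>cell_measure) = 0"
    using div_curl[OF s(2) d(2) s(1) d(1)] 0 by simp
  then have "AE x in cell_measure. - (j2 x \<bullet> (R_perp *v j1 x)) = 0"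
    using integral_nonneg_eq_0_iff_AE[of cell_measure "\<lambda>x. - (j2 x \<bullet> (R_perp *v j1 x))"] i n by auto
  with n show ?thesis by eventually_elim auto
qed

lemma current_pair_diff:
  assumes j: "current_pair m j1 j2" and k: "current_pair m k1 k2"
  shows "current_pair m (\<lambda>x. j1 x - k1 x) (\<lambda>x. j2 x - k2 x)"
proof -
  have "AE x in cell_measure. j2 x - k2 x = transpose (m x) *v (j1 x - k1 x)"
  proof -
    have "AE x in cell_measure. j2 x = transpose (m x) *v j1 x" "AE x in cell_measure. k2 x = transpose (m x) *v k1 x"
      using j k by (auto simp: current_pair_def)
    then show ?thesis by eventually_elim (simp add: matrix_vector_mult_diff_distrib)
  qed
  with j k show ?thesis
    by (auto simp: current_pair_def intro: square_integrable_diff divergence_free_diff)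
qed

lemma current_pair_unique:
  assumes j: "current_pair m j1 j2" and k: "current_pair m k1 k2"
    and "integral\<^sup>L cell_measure j1 = integral\<^sup>L cell_measure k1"
  shows "AE x in cell_measure. j1 x = k1 x"
proof -
  have "integrable cell_measure j1" "integrable cell_measure k1"
    using j k by (auto simp: current_pair_def intro: square_integrable_integrable)
  then have "AE x in cell_measure. j1 x - k1 x = 0"
    using assms(3) by (intro current_pair_zero[OF current_pair_diff[OF j k]]) simp
  then show ?thesis by eventually_elim simp
qed

lemma current_pair_swap:
  assumes j: "current_pair m j1 j2"
  shows "current_pair m j2 (\<lambda>x. - j1 x)"
proof -
  have s: "square_integrable cell_measure j1" "divergence_free j1"
    and a: "AE x in cell_measure. j2 x = transpose (m x) *v j1 x"
    using j by (auto simp: current_pair_def)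
  have "AE x in cell_measure. - j1 x = transpose (m x) *v j2 x"
    using a params
  proof eventually_elim
    case (elim x)
    then have "m x ** m x = - mat 1" by (simp add: params19_def)
    from complex_structure_mult(2)[OF this] show ?case by (simp add: elim)
  qed
  moreover have "square_integrable cell_measure (\<lambda>x. - j1 x)" "divergence_free (\<lambda>x. - j1 x)"
    using square_integrable_diff[OF square_integrable_zero s(1)] divergence_free_scaleR[OF s(2), of "-1"] by simp_all
  ultimately show ?thesis using j by (simp add: current_pair_def)
qed

text \<open>Currents of one solution are paired with fields of another. The mean comes from
  solenoidal against gradient; pointwise, \<open>j\<^sub>2 = M\<^sup>T j\<^sub>1\<close> gathers the
  sum into \<open>j\<^sub>1 \<bullet> (f\<^sub>1 + M f\<^sub>2)\<close>, and the second factor is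
  \<open>X k\<^sub>1\<close>.\<close>

lemma energy:
  assumes "cell_solution l m a b e1 e2 j1 j2" and "cell_solution l m c d f1 f2 k1 k2"
  shows "integrable cell_measure (\<lambda>x. j1 x \<bullet> f1 x + j2 x \<bullet> f2 x)"
    "(\<integral>x. j1 x \<bullet> f1 x + j2 x \<bullet> f2 x \<partial>cell_measure) = integral\<^sup>L cell_measure j1 \<bullet> c + integral\<^sup>L cell_measure j2 \<bullet> d"
    "AE x in cell_measure. j1 x \<bullet> f1 x + j2 x \<bullet> f2 x = j1 x \<bullet> (matrix_inv (l x) *v k1 x)"
proof -
  have g: "grad_field c f1" "grad_field d f2"
    and s: "square_integrable cell_measure j1" "square_integrable cell_measure j2" "divergence_free j1" "divergence_free j2"
    and a: "AE x in cell_measure. j2 x = transpose (m x) *v j1 x" "AE x in cell_measure. k1 x = l x *v (f1 x + m x *v f2 x)"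
    using assms by (auto simp: cell_solution_def current_pair_def)
  note i = square_integrable_inner[OF s(1) grad_field_properties(1)[OF g(1)]]
    square_integrable_inner[OF s(2) grad_field_properties(1)[OF g(2)]]
  show "integrable cell_measure (\<lambda>x. j1 x \<bullet> f1 x + j2 x \<bullet> f2 x)" using i by simp
  show "(\<integral>x. j1 x \<bullet> f1 x + j2 x \<bullet> f2 x \<partial>cell_measure) = integral\<^sup>L cell_measure j1 \<bullet> c + integral\<^sup>L cell_measure j2 \<bullet> d"
    using i integral_grad_field[OF g(1) s(1,3)] integral_grad_field[OF g(2) s(2,4)] by simp
  show "AE x in cell_measure. j1 x \<bullet> f1 x + j2 x \<bullet> f2 x = j1 x \<bullet> (matrix_inv (l x) *v k1 x)"
    using a params
    by eventually_elim (simp add: params19_def inner_transpose inner_add_right)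
qed

text \<open>The energy density is \<open>j\<^sub>1 \<bullet> X j\<^sub>1\<close>, so zero energy
  kills the current but not the field: what survives is a field with
  \<open>e\<^sub>1 + M e\<^sub>2 = 0\<close>.\<close>

lemma zero_energy:
  assumes sol: "cell_solution l m a b e1 e2 j1 j2"
    and 0: "integral\<^sup>L cell_measure j1 \<bullet> a + integral\<^sup>L cell_measure j2 \<bullet> b = 0"
  shows "AE x in cell_measure. j1 x = 0 \<and> j2 x = 0 \<and> e1 x = - (m x *v e2 x)"
    "integral\<^sup>L cell_measure j1 = 0" "integral\<^sup>L cell_measure j2 = 0"
proof -
  note e = energy[OF sol sol]
  have n: "AE x in cell_measure. 0 \<le> j1 x \<bullet> e1 x + j2 x \<bullet> e2 x \<and> (j1 x \<bullet> e1 x + j2 x \<bullet> e2 x = 0 \<longrightarrow> j1 x = 0)"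
    using e(3) params
  proof eventually_elim
    case (elim x)
    have "pos_def (matrix_inv (l x))" using elim(2) by (simp add: params19_def pos_def_matrix_inv)
    then show ?case unfolding elim(1) pos_def_def by (cases "j1 x = 0") (auto simp: less_imp_le)
  qed
  have z0: "AE x in cell_measure. j1 x \<bullet> e1 x + j2 x \<bullet> e2 x = 0"
    using integral_nonneg_eq_0_iff_AE[OF e(1)] e(2) 0 n by auto
  have j: "AE x in cell_measure. j2 x = transpose (m x) *v j1 x" "AE x in cell_measure. j1 x = l x *v (e1 x + m x *v e2 x)"
    "square_integrable cell_measure j1" "square_integrable cell_measure j2"
    using sol by (auto simp: cell_solution_def current_pair_def)
  show z: "AE x in cell_measure. j1 x = 0 \<and> j2 x = 0 \<and> e1 x = - (m x *v e2 x)"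
    using z0 n j(1,2) params
  proof eventually_elim
    case (elim x)
    then have "j1 x = 0" by blast
    moreover have "e1 x + m x *v e2 x = matrix_inv (l x) *v j1 x"
      using elim(4,5) by (metis params19_def pos_def_inverse_mult(1))
    ultimately show ?case using elim(3) by (simp add: eq_neg_iff_add_eq_0)
  qed
  have "integral\<^sup>L cell_measure j1 = integral\<^sup>L cell_measure (\<lambda>x. 0)" "integral\<^sup>L cell_measure j2 = integral\<^sup>L cell_measure (\<lambda>x. 0)"
    by (intro integral_cong_AE; use z j(3,4) in \<open>auto simp: square_integrable_def\<close>)+
  then show "integral\<^sup>L cell_measure j1 = 0" "integral\<^sup>L cell_measure j2 = 0" by simp_all
qed

text \<open>Reciprocity: by symmetry of \<open>X\<close> the mutual energy density of two solutions
  does not depend on their order.\<close>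

lemma B_symmetric:
  "(B11 *v a + B12 *v b) \<bullet> c + (B21 *v a + B22 *v b) \<bullet> d = (B11 *v c + B12 *v d) \<bullet> a + (B21 *v c + B22 *v d) \<bullet> b"
proof -
  obtain e1 e2 j1 j2 where e: "cell_solution l m a b e1 e2 j1 j2" using solution_exists by blast
  obtain f1 f2 k1 k2 where f: "cell_solution l m c d f1 f2 k1 k2" using solution_exists by blast
  note ef = energy[OF e f] and fe = energy[OF f e]
  have "(\<integral>x. j1 x \<bullet> f1 x + j2 x \<bullet> f2 x \<partial>cell_measure) = (\<integral>x. k1 x \<bullet> e1 x + k2 x \<bullet> e2 x \<partial>cell_measure)"
  proof (rule integral_cong_AE)
    show "AE x in cell_measure. j1 x \<bullet> f1 x + j2 x \<bullet> f2 x = k1 x \<bullet> e1 x + k2 x \<bullet> e2 x"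
      using ef(3) fe(3) params
    proof eventually_elim
      case (elim x)
      have "sym_mat (matrix_inv (l x))" using elim(3) by (simp add: params19_def sym_mat_matrix_inv)
      from sym_mat_inner[OF this] show ?case unfolding elim(1,2) by (simp add: inner_commute)
    qed
  qed (use ef(1) fe(1) in auto)
  then show ?thesis using ef(2) fe(2) solution_mean[OF e] solution_mean[OF f] by simp
qed

lemma B_blocks: "sym_mat B11" "B21 = transpose B12"
proof -
  have "B11 = transpose B11"
    by (rule matrix_eq_transposeI) (use B_symmetric[of _ 0 _ 0] in \<open>simp add: inner_commute\<close>)
  then show "sym_mat B11" by (simp add: sym_mat_def)
  show "B21 = transpose B12"
    by (rule matrix_eq_transposeI) (use B_symmetric[of _ 0 0 _] in \<open>simp add: inner_commute\<close>)
qed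

text \<open>Gradients with \<open>e\<^sub>1 + M e\<^sub>2 = 0\<close> are, after rotation, solenoidal pairs \<open>(j, M\<^sup>T j)\<close>; this is
  where the potentials of \<open>R\<^sub>\<bottom> j\<close> come from.\<close>

lemma kernel_current_pair:
  assumes sol: "cell_solution l m a b e1 e2 j1 j2" and z: "AE x in cell_measure. e1 x = - (m x *v e2 x)"
  shows "current_pair m (\<lambda>x. R_perp *v e2 x) (\<lambda>x. R_perp *v e1 x)"
    "(\<integral>x. R_perp *v e2 x \<partial>cell_measure) = R_perp *v b"
proof -
  have g: "grad_field a e1" "grad_field b e2" using sol by (auto simp: cell_solution_def)
  note p = grad_field_properties[OF g(1)] grad_field_properties[OF g(2)]
  have "AE x in cell_measure. R_perp *v e1 x = transpose (m x) *v (R_perp *v e2 x)"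
    using z params
  proof eventually_elim
    case (elim x)
    then have "m x ** m x = - mat 1" by (simp add: params19_def)
    from complex_structure_mult(3)[OF this, of "e2 x"] show ?case
      by (simp add: elim matrix_vector_mult_minus_right)
  qed
  then show "current_pair m (\<lambda>x. R_perp *v e2 x) (\<lambda>x. R_perp *v e1 x)" using p by (simp add: current_pair_def)
  show "(\<integral>x. R_perp *v e2 x \<partial>cell_measure) = R_perp *v b"
    using integral_bounded_linear_cell[OF matrix_vector_mul_bounded_linear p(6), of R_perp] p(7) by simp
qed

text \<open>If the energy of the data \<open>(v, 0)\<close> vanished,
  \<open>R\<^sub>\<bottom> e\<^sub>2\<close> would be the first member of a solenoidal pair with
  mean zero, hence zero; then \<open>e\<^sub>1 = - M e\<^sub>2\<close> would vanish too, although
  its mean is \<open>v\<close>.\<close>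

lemma B11_pos_def: "pos_def B11"
  unfolding pos_def_def
proof (intro allI impI)
  fix v :: vec2 assume v: "v \<noteq> 0"
  obtain e1 e2 j1 j2 where e: "cell_solution l m v 0 e1 e2 j1 j2" using solution_exists by blast
  have mean: "integral\<^sup>L cell_measure j1 = B11 *v v" using solution_mean[OF e] by simp
  have "AE x in cell_measure. 0 \<le> j1 x \<bullet> e1 x + j2 x \<bullet> e2 x"
    using energy(3)[OF e e] params
  proof eventually_elim
    case (elim x)
    have "pos_def (matrix_inv (l x))" using elim(2) by (simp add: params19_def pos_def_matrix_inv)
    then show ?case unfolding elim(1) pos_def_def by (cases "j1 x = 0") (auto simp: less_imp_le)
  qed
  then have "0 \<le> (\<integral>x. j1 x \<bullet> e1 x + j2 x \<bullet> e2 x \<partial>cell_measure)" by (rule integral_nonneg_AE)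
  then have "0 \<le> v \<bullet> (B11 *v v)" using energy(2)[OF e e] mean by (simp add: inner_commute)
  moreover have "v \<bullet> (B11 *v v) \<noteq> 0"
  proof
    assume "v \<bullet> (B11 *v v) = 0"
    then have z: "AE x in cell_measure. j1 x = 0 \<and> j2 x = 0 \<and> e1 x = - (m x *v e2 x)"
      using mean by (intro zero_energy(1)[OF e]) (simp add: inner_commute)
    then have z': "AE x in cell_measure. e1 x = - (m x *v e2 x)" by eventually_elim simp
    note k = kernel_current_pair[OF e z']
    have "AE x in cell_measure. R_perp *v e2 x = 0"
      by (rule current_pair_zero[OF k(1)]) (simp add: k(2))
    with z' have "AE x in cell_measure. e1 x = 0"
    proof eventually_elim
      case (elim x)
      then have "R_perp *v (R_perp *v e2 x) = 0" by simp
      then show ?case using elim(1) by simp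
    qed
    moreover have g: "grad_field v e1" using e by (simp add: cell_solution_def)
    ultimately have "integral\<^sup>L cell_measure e1 = integral\<^sup>L cell_measure (\<lambda>x. 0)"
      using grad_field_properties(1)[OF g] by (intro integral_cong_AE) (auto simp: square_integrable_def)
    then show False using grad_field_properties(2)[OF g] v by simp
  qed
  ultimately show "0 < v \<bullet> (B11 *v v)" by linarith
qed

text \<open>Invertibility of \<open>B11\<close> turns \<open>B12 = B11 ** Meff\<close> into a
  definition, and symmetry settles \<open>B21\<close>. The substance lies in the form of
  \<open>B22\<close> and in the square of \<open>Meff\<close>.\<close>

definition "Xeff = matrix_inv B11"
definition "Meff = Xeff ** B12"

lemma B12_eq: "B12 = B11 ** Meff"
  by (simp add: Meff_def Xeff_def matrix_mul_assoc pos_def_inverse[OF B11_pos_def])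

lemma B12_mult: "B12 *v v = B11 *v (Meff *v v)"
  by (subst (1) B12_eq) (simp only: matrix_vector_mul_assoc)

lemma B21_eq: "B21 = transpose Meff ** B11"
  using B_blocks by (simp add: B12_eq[symmetric] sym_mat_def flip: matrix_transpose_mul)
    (metis B12_eq matrix_transpose_mul)

lemma Meff_transpose: "B21 *v (Xeff *v u) = transpose Meff *v u"
  by (simp add: B21_eq Xeff_def matrix_vector_mul_assoc[symmetric] B11_pos_def)

lemma current_exists:
  obtains e1 e2 j1 j2 where "cell_solution l m (Xeff *v u) 0 e1 e2 j1 j2"
    "integral\<^sup>L cell_measure j1 = u" "integral\<^sup>L cell_measure j2 = transpose Meff *v u"
proof -
  obtain e1 e2 j1 j2 where e: "cell_solution l m (Xeff *v u) 0 e1 e2 j1 j2" using solution_exists by blast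
  show ?thesis
    using solution_mean[OF e] by (intro that[OF e], simp add: Xeff_def B11_pos_def, simp add: Meff_transpose)
qed

text \<open>The data are chosen so that \<open>R\<^sub>\<bottom> g\<^sub>2\<close> and
  \<open>R\<^sub>\<bottom> g\<^sub>1\<close> have the means \<open>u\<close> and
  \<open>Meff\<^sup>T u\<close> of an actual current \<open>(j\<^sub>1, j\<^sub>2)\<close>. The
  energy of the solution is then, up to sign, the expression that \<open>current_pair_sym\<close>
  shows to be 0.\<close>

lemma kernel_exists:
  obtains g1 g2 k1 k2 where "cell_solution l m (- (R_perp *v (transpose Meff *v u))) (- (R_perp *v u)) g1 g2 k1 k2"
    "AE x in cell_measure. g1 x = - (m x *v g2 x)" "integral\<^sup>L cell_measure k1 = 0" "integral\<^sup>L cell_measure k2 = 0"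
proof -
  obtain e1 e2 j1 j2 where e: "cell_solution l m (Xeff *v u) 0 e1 e2 j1 j2"
    "integral\<^sup>L cell_measure j1 = u" "integral\<^sup>L cell_measure j2 = transpose Meff *v u"
    by (rule current_exists)
  obtain g1 g2 k1 k2 where g: "cell_solution l m (- (R_perp *v (transpose Meff *v u))) (- (R_perp *v u)) g1 g2 k1 k2"
    using solution_exists by blast
  have "current_pair m j1 j2" "current_pair m k1 k2" using e(1) g by (auto simp: cell_solution_def)
  from current_pair_sym[OF this(2,1)]
  have 0: "integral\<^sup>L cell_measure k1 \<bullet> (- (R_perp *v (transpose Meff *v u)))
      + integral\<^sup>L cell_measure k2 \<bullet> (- (R_perp *v u)) = 0"
    by (simp add: e)
  have "AE x in cell_measure. g1 x = - (m x *v g2 x)"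
    using zero_energy(1)[OF g 0] by eventually_elim simp
  then show ?thesis using that[OF g] zero_energy(2,3)[OF g 0] by blast
qed

text \<open>The first mean current of the kernel solution is \<open>B11 (a + Meff b)\<close> for its
  data \<open>(a, b)\<close>, and it vanishes.\<close>

lemma Meff_R_perp: "Meff *v (R_perp *v u) = - (R_perp *v (transpose Meff *v u))"
proof -
  obtain g1 g2 k1 k2 where g: "cell_solution l m (- (R_perp *v (transpose Meff *v u))) (- (R_perp *v u)) g1 g2 k1 k2"
    "AE x in cell_measure. g1 x = - (m x *v g2 x)" "integral\<^sup>L cell_measure k1 = 0" "integral\<^sup>L cell_measure k2 = 0"
    by (rule kernel_exists)
  have "B11 *v (- (R_perp *v (transpose Meff *v u)) - Meff *v (R_perp *v u)) = 0"
    using solution_mean[OF g(1)] g(3)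
    by (simp add: B12_mult matrix_vector_mult_minus_right matrix_vector_mult_diff_distrib)
  then have "matrix_inv B11 *v (B11 *v (- (R_perp *v (transpose Meff *v u)) - Meff *v (R_perp *v u))) = 0" by simp
  then show ?thesis by (simp add: B11_pos_def algebra_simps)
qed

text \<open>Kernel data satisfy \<open>a = - Meff b\<close>, and their second mean current vanishes
  too, so \<open>B22 b = B21 (Meff b)\<close>. Here \<open>b\<close> is arbitrary because
  \<open>R_perp\<close> is onto.\<close>

lemma B22_eq: "B22 = transpose Meff ** B11 ** Meff"
proof -
  have "B22 *v (R_perp *v u) = (transpose Meff ** B11 ** Meff) *v (R_perp *v u)" for u
  proof -
    obtain g1 g2 k1 k2 where g: "cell_solution l m (- (R_perp *v (transpose Meff *v u))) (- (R_perp *v u)) g1 g2 k1 k2"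
      "AE x in cell_measure. g1 x = - (m x *v g2 x)" "integral\<^sup>L cell_measure k1 = 0" "integral\<^sup>L cell_measure k2 = 0"
      by (rule kernel_exists)
    then show ?thesis
      using solution_mean[OF g(1)] g(4)
      by (simp add: B21_eq matrix_vector_mul_assoc[symmetric] matrix_vector_mult_minus_right Meff_R_perp[symmetric])
  qed
  from this[of "- (R_perp *v _)"] have "B22 *v v = (transpose Meff ** B11 ** Meff) *v v" for v
    by (simp add: matrix_vector_mult_minus_right)
  then show ?thesis by (simp add: matrix_eq)
qed

text \<open>If \<open>(g\<^sub>1, g\<^sub>2)\<close> is a gradient field annihilated by the local tensor, then so is \<open>(- g\<^sub>2, g\<^sub>1)\<close>.\<close>

lemma Meff_squared: "Meff ** Meff = - mat 1"
proof -
  have "R_perp *v u + Meff *v (Meff *v (R_perp *v u)) = 0" for u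
  proof -
    obtain g1 g2 k1 k2 where g: "cell_solution l m (- (R_perp *v (transpose Meff *v u))) (- (R_perp *v u)) g1 g2 k1 k2"
      "AE x in cell_measure. g1 x = - (m x *v g2 x)" "integral\<^sup>L cell_measure k1 = 0" "integral\<^sup>L cell_measure k2 = 0"
      by (rule kernel_exists)
    have gg: "grad_field (Meff *v (R_perp *v u)) g1" "grad_field (- (R_perp *v u)) g2"
      using g(1) by (auto simp: cell_solution_def Meff_R_perp)
    have "AE x in cell_measure. (0::vec2) = l x *v (- g2 x + m x *v g1 x)"
      using g(2) params
    proof eventually_elim
      case (elim x)
      then have "m x ** m x = - mat 1" by (simp add: params19_def)
      from complex_structure_mult(1)[OF this] show ?case by (simp add: elim matrix_vector_mult_minus_right)
    qed
    moreover have "current_pair m (\<lambda>x. 0) (\<lambda>x. 0)"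
      by (simp add: current_pair_def divergence_free_const)
    ultimately have "cell_solution l m (R_perp *v u) (Meff *v (R_perp *v u)) (\<lambda>x. - g2 x) g1 (\<lambda>x. 0) (\<lambda>x. 0)"
      using gg(1) grad_field_scaleR[OF gg(2), of "-1"] by (simp add: cell_solution_def)
    from solution_mean[OF this] have "B11 *v (R_perp *v u + Meff *v (Meff *v (R_perp *v u))) = 0"
      by (simp add: B12_mult matrix_vector_right_distrib)
    then have "matrix_inv B11 *v (B11 *v (R_perp *v u + Meff *v (Meff *v (R_perp *v u)))) = 0" by simp
    then show ?thesis by (simp add: B11_pos_def)
  qed
  from this[of "- (R_perp *v _)"] have "v + Meff *v (Meff *v v) = 0" for v
    by (simp add: matrix_vector_mult_minus_right)
  then have "(Meff ** Meff) *v v = (- mat 1) *v v" for v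
    by (simp add: matrix_vector_mult_minus_left matrix_vector_mul_assoc eq_neg_iff_add_eq_0 add.commute)
  then show ?thesis by (simp add: matrix_eq)
qed

text \<open>It is not clear beforehand that the swapped pair \<open>(j\<^sub>2, - j\<^sub>1)\<close>
  is the current of some cell field. But there is a solution whose current has the same mean, and
  solenoidal pairs with equal means agree.\<close>

lemma paired_solutions:
  obtains e1 e2 f1 f2 j1 j2 where "cell_solution l m (Xeff *v u) 0 e1 e2 j1 j2"
    "cell_solution l m (Xeff *v (transpose Meff *v u)) 0 f1 f2 j2 (\<lambda>x. - j1 x)"
    "integral\<^sup>L cell_measure j1 = u" "integral\<^sup>L cell_measure j2 = transpose Meff *v u"
proof -
  obtain e1 e2 j1 j2 where e: "cell_solution l m (Xeff *v u) 0 e1 e2 j1 j2"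
    "integral\<^sup>L cell_measure j1 = u" "integral\<^sup>L cell_measure j2 = transpose Meff *v u"
    by (rule current_exists)
  obtain f1 f2 k1 k2 where f: "cell_solution l m (Xeff *v (transpose Meff *v u)) 0 f1 f2 k1 k2"
    "integral\<^sup>L cell_measure k1 = transpose Meff *v u"
    by (rule current_exists)
  have j: "current_pair m j1 j2" and k: "current_pair m k1 k2"
    using e(1) f(1) by (auto simp: cell_solution_def)
  note sw = current_pair_swap[OF j]
  have "AE x in cell_measure. j2 x = k1 x"
    by (rule current_pair_unique[OF sw k]) (simp add: e f)
  moreover have "AE x in cell_measure. k1 x = l x *v (f1 x + m x *v f2 x)"
    using f(1) by (simp add: cell_solution_def)
  ultimately have "AE x in cell_measure. j2 x = l x *v (f1 x + m x *v f2 x)" by eventually_elim simp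
  then have "cell_solution l m (Xeff *v (transpose Meff *v u)) 0 f1 f2 j2 (\<lambda>x. - j1 x)"
    using f(1) sw by (simp add: cell_solution_def)
  with e that show ?thesis by blast
qed

text \<open>At \<open>j\<^sub>1\<close> the local form is a combination of the energies of the two
  paired solutions and of the null Lagrangian
  \<open>j\<^sub>2 \<bullet> R\<^sub>\<bottom> j\<^sub>1\<close>, so its mean is the effective form
  at \<open>u\<close>. The sign stays strict: mean 0 would force \<open>j\<^sub>1 = 0\<close> a.e.,
  against the mean \<open>u\<close>.\<close>

lemma qform_pos:
  assumes pos: "AE x in cell_measure. \<forall>v. v \<noteq> 0 \<longrightarrow> qform \<alpha> \<beta> \<delta> (matrix_inv (l x)) (m x) v > 0"
    and u: "u \<noteq> 0"
  shows "qform \<alpha> \<beta> \<delta> Xeff Meff u > 0"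
proof -
  obtain e1 e2 f1 f2 j1 j2 where e: "cell_solution l m (Xeff *v u) 0 e1 e2 j1 j2"
    and f: "cell_solution l m (Xeff *v (transpose Meff *v u)) 0 f1 f2 j2 (\<lambda>x. - j1 x)"
    and mean: "integral\<^sup>L cell_measure j1 = u" "integral\<^sup>L cell_measure j2 = transpose Meff *v u"
    by (rule paired_solutions)
  have s: "square_integrable cell_measure j1" "square_integrable cell_measure j2"
    and d: "divergence_free j1" "divergence_free j2"
    and a: "AE x in cell_measure. j2 x = transpose (m x) *v j1 x"
    using e by (auto simp: current_pair_def cell_solution_def)
  have R: "square_integrable cell_measure (\<lambda>x. R_perp *v j1 x)"
    by (intro square_integrable_bounded_linear[OF _ matrix_vector_mul_bounded_linear] s)
  note i = energy(1)[OF e e] energy(1)[OF f f] square_integrable_inner[OF s(2) R]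
  define q where "q x = \<alpha> * (j1 x \<bullet> e1 x + j2 x \<bullet> e2 x) + \<beta> * (j2 x \<bullet> f1 x + (- j1 x) \<bullet> f2 x)
    + \<delta> * (j2 x \<bullet> (R_perp *v j1 x))" for x
  have qi: "integrable cell_measure q"
    unfolding q_def by (intro Bochner_Integration.integrable_add integrable_mult_right i)
  have "integral\<^sup>L cell_measure q = \<alpha> * (\<integral>x. j1 x \<bullet> e1 x + j2 x \<bullet> e2 x \<partial>cell_measure)
      + \<beta> * (\<integral>x. j2 x \<bullet> f1 x + (- j1 x) \<bullet> f2 x \<partial>cell_measure) + \<delta> * (\<integral>x. j2 x \<bullet> (R_perp *v j1 x) \<partial>cell_measure)"
    unfolding q_def
    by (subst Bochner_Integration.integral_add, intro Bochner_Integration.integrable_add integrable_mult_right i,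
        intro integrable_mult_right i, subst Bochner_Integration.integral_add,
        intro integrable_mult_right i, intro integrable_mult_right i, simp only: integral_mult_right_zero)
  also have "\<dots> = qform \<alpha> \<beta> \<delta> Xeff Meff u"
    unfolding energy(2)[OF e e] energy(2)[OF f f] div_curl[OF s(2) d(2) s(1) d(1)] mean
    by (simp add: qform_def)
  finally have qI: "integral\<^sup>L cell_measure q = qform \<alpha> \<beta> \<delta> Xeff Meff u" .
  have n: "AE x in cell_measure. 0 \<le> q x \<and> (q x = 0 \<longrightarrow> j1 x = 0)"
    using energy(3)[OF e e] energy(3)[OF f f] a pos
  proof eventually_elim
    case (elim x)
    have "q x = qform \<alpha> \<beta> \<delta> (matrix_inv (l x)) (m x) (j1 x)"
      unfolding q_def elim(1,2) unfolding qform_def elim(3) ..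
    then show ?case using elim(4) by (cases "j1 x = 0") (auto simp: qform_def less_imp_le)
  qed
  have "0 \<le> integral\<^sup>L cell_measure q" using n by (intro integral_nonneg_AE) (auto elim: eventually_mono)
  moreover have "integral\<^sup>L cell_measure q \<noteq> 0"
  proof
    assume "integral\<^sup>L cell_measure q = 0"
    then have "AE x in cell_measure. q x = 0"
      using integral_nonneg_eq_0_iff_AE[OF qi] n by auto
    with n have "AE x in cell_measure. j1 x = 0" by eventually_elim simp
    then have "integral\<^sup>L cell_measure j1 = integral\<^sup>L cell_measure (\<lambda>x. 0)"
      using s(1) by (intro integral_cong_AE) (auto simp: square_integrable_def)
    then show False using mean u by simp
  qed
  ultimately show ?thesis using qI by simp
qed

lemma params19_eff: "params19 B11 Meff"
proof -
  \<comment> \<open>The negated triple of \<open>(1, 0, 2)\<close>; \<open>- 0\<close> is left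
    unsimplified so that \<open>qform_neg\<close> matches.\<close>
  have "AE x in cell_measure. \<forall>v. v \<noteq> 0 \<longrightarrow> qform (-1) (-0) (-2) (matrix_inv (l x)) (m x) v > 0"
    using params by eventually_elim (simp add: params19_iff_qform qform_neg del: minus_zero)
  from qform_pos[OF this] show ?thesis
    unfolding params19_iff_qform Xeff_def[symmetric] qform_neg
    using B_blocks(1) Meff_squared B11_pos_def by simp
qed

lemma Phi_params_eff:
  assumes "AE x in cell_measure. Phi_params \<gamma> (l x) (m x)"
  shows "Phi_params \<gamma> B11 Meff"
proof -
  have "AE x in cell_measure. \<forall>v. v \<noteq> 0 \<longrightarrow> qform (1 + \<gamma>) \<gamma> (2 * \<gamma>) (matrix_inv (l x)) (m x) v > 0"
    "AE x in cell_measure. \<forall>v. v \<noteq> 0 \<longrightarrow> qform (- (1 + \<gamma>)) (- \<gamma>) (- (2 * \<gamma> + 2)) (matrix_inv (l x)) (m x) v > 0"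
    using assms by (eventually_elim, simp only: Phi_params_iff_qform qform_neg, simp)+
  from qform_pos[OF this(1)] qform_pos[OF this(2)] show ?thesis
    unfolding Phi_params_iff_qform Xeff_def[symmetric] qform_neg using params19_eff by simp
qed

text \<open>Both composites share the current \<open>(j\<^sub>1, j\<^sub>2)\<close>. Only new fields
  are needed, with prescribed means \<open>a\<close>, \<open>b\<close> and with
  \<open>e\<^sub>1' + M e\<^sub>2'\<close> equal to \<open>P j\<^sub>1\<close>; the mean
  \<open>u\<close> of the current is what the expected effective tensor dictates.\<close>

lemma linked_solution:
  assumes Phi: "AE x in cell_measure. Phi_params \<gamma> (l x) (m x)"
  defines "L0 \<equiv> matrix_inv (P_mat \<gamma> B11 Meff)"
  shows "\<exists>e1 e2 j1 j2. cell_solution (\<lambda>x. matrix_inv (P_mat \<gamma> (l x) (m x))) m a b e1 e2 j1 j2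
    \<and> integral\<^sup>L cell_measure j1 = L0 *v (a + Meff *v b)
    \<and> integral\<^sup>L cell_measure j2 = transpose Meff *v (L0 *v (a + Meff *v b))"
proof -
  define u where "u = L0 *v (a + Meff *v b)"
  have "pos_def (P_mat \<gamma> B11 Meff)" using Phi_params_eff[OF Phi] by (simp add: Phi_params_def)
  then have Pu: "P_mat \<gamma> B11 Meff *v u = a + Meff *v b" by (simp add: u_def L0_def)
  obtain e1 e2 f1 f2 j1 j2 where e: "cell_solution l m (Xeff *v u) 0 e1 e2 j1 j2"
    and f: "cell_solution l m (Xeff *v (transpose Meff *v u)) 0 f1 f2 j2 (\<lambda>x. - j1 x)"
    and mean: "integral\<^sup>L cell_measure j1 = u" "integral\<^sup>L cell_measure j2 = transpose Meff *v u"
    by (rule paired_solutions)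
  obtain g1 g2 k1 k2 where g: "cell_solution l m (- (R_perp *v (transpose Meff *v u))) (- (R_perp *v u)) g1 g2 k1 k2"
    "AE x in cell_measure. g1 x = - (m x *v g2 x)"
    by (rule kernel_exists)
  note kg = kernel_current_pair[OF g]
  have jp: "current_pair m j1 j2" using e by (simp add: cell_solution_def)
  have gj: "AE x in cell_measure. R_perp *v g2 x = j1 x"
    by (rule current_pair_unique[OF kg(1) jp]) (simp add: kg(2) mean matrix_vector_mult_minus_right)
  \<comment> \<open>The means of the fields read off from the three terms of
    \<open>P j\<^sub>1\<close>. In general they differ from \<open>a\<close> and \<open>b\<close>;
    only the combination with \<open>Meff\<close> agrees.\<close>
  define a0 b0 where "a0 = (1 + \<gamma>) *\<^sub>R (Xeff *v u)"
    and "b0 = \<gamma> *\<^sub>R (Xeff *v (transpose Meff *v u)) + (2 * \<gamma>) *\<^sub>R (R_perp *v u)"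
  have ab0: "a0 + Meff *v b0 = a + Meff *v b"
    unfolding Pu[symmetric] P_mat_mult a0_def b0_def Xeff_def
    by (simp add: matrix_vector_right_distrib matrix_vector_mult_scaleR algebra_simps)
  \<comment> \<open>The discrepancy is data with zero energy, so \<open>h1 + m h2 = 0\<close>
    locally: adding \<open>h\<close> corrects the means and leaves \<open>P j\<^sub>1\<close>
    unchanged.\<close>
  obtain h1 h2 i1 i2 where h: "cell_solution l m (a - a0) (b - b0) h1 h2 i1 i2" using solution_exists by blast
  have "a - a0 + Meff *v (b - b0) = 0"
    using ab0 by (simp add: matrix_vector_mult_diff_distrib algebra_simps)
  then have "integral\<^sup>L cell_measure i1 = B11 *v 0" "integral\<^sup>L cell_measure i2 = transpose Meff *v (B11 *v 0)"
    using solution_mean[OF h]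
    by (simp_all only: B12_mult B21_eq B22_eq matrix_vector_mul_assoc[symmetric] matrix_vector_right_distrib[symmetric])
  then have "integral\<^sup>L cell_measure i1 \<bullet> (a - a0) + integral\<^sup>L cell_measure i2 \<bullet> (b - b0) = 0" by simp
  note zh = zero_energy(1)[OF h this]
  \<comment> \<open>\<open>(1 + \<gamma>) (e\<^sub>1 + M e\<^sub>2) + \<gamma> (M f\<^sub>1 -
    f\<^sub>2) - 2 \<gamma> M g\<^sub>2\<close>, sorted into the terms without and with the factor
    \<open>M\<close>, plus the correction.\<close>
  define e1' where "e1' x = (1 + \<gamma>) *\<^sub>R e1 x + (- \<gamma>) *\<^sub>R f2 x + h1 x" for x
  define e2' where "e2' x = (1 + \<gamma>) *\<^sub>R e2 x + \<gamma> *\<^sub>R f1 x + (- (2 * \<gamma>)) *\<^sub>R g2 x + h2 x" for x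
  have ge: "grad_field (Xeff *v u) e1" "grad_field 0 e2" and gf: "grad_field (Xeff *v (transpose Meff *v u)) f1" "grad_field 0 f2"
    and gg: "grad_field (- (R_perp *v u)) g2" and gh: "grad_field (a - a0) h1" "grad_field (b - b0) h2"
    using e f g h by (auto simp: cell_solution_def)
  have "grad_field ((1 + \<gamma>) *\<^sub>R (Xeff *v u) + (- \<gamma>) *\<^sub>R 0 + (a - a0)) e1'"
    unfolding e1'_def by (intro grad_field_add grad_field_scaleR ge gf gh)
  then have 1: "grad_field a e1'" by (simp add: a0_def)
  have "grad_field ((1 + \<gamma>) *\<^sub>R 0 + \<gamma> *\<^sub>R (Xeff *v (transpose Meff *v u)) + (- (2 * \<gamma>)) *\<^sub>R (- (R_perp *v u)) + (b - b0)) e2'"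
    unfolding e2'_def by (intro grad_field_add grad_field_scaleR ge gf gg gh)
  then have 2: "grad_field b e2'" by (simp add: b0_def)
  have "AE x in cell_measure. j1 x = l x *v (e1 x + m x *v e2 x)" "AE x in cell_measure. j2 x = l x *v (f1 x + m x *v f2 x)"
    "AE x in cell_measure. j2 x = transpose (m x) *v j1 x"
    using e f by (auto simp: cell_solution_def current_pair_def)
  with zh gj Phi have "AE x in cell_measure. j1 x = matrix_inv (P_mat \<gamma> (l x) (m x)) *v (e1' x + m x *v e2' x)"
  proof eventually_elim
    case (elim x)
    have pd: "pos_def (l x)" "pos_def (P_mat \<gamma> (l x) (m x))" and mm: "m x ** m x = - mat 1"
      using elim(3) by (auto simp: Phi_params_def params19_def)
    have Xj: "matrix_inv (l x) *v j1 x = e1 x + m x *v e2 x" "matrix_inv (l x) *v j2 x = f1 x + m x *v f2 x"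
      using elim(4,5) pd(1) by (metis pos_def_inverse_mult(1))+
    have Rj: "R_perp *v j1 x = - g2 x" unfolding elim(2)[symmetric] by simp
    have "P_mat \<gamma> (l x) (m x) *v j1 x
        = \<gamma> *\<^sub>R (m x *v (f1 x + m x *v f2 x)) + (1 + \<gamma>) *\<^sub>R (e1 x + m x *v e2 x) + (2 * \<gamma>) *\<^sub>R (m x *v (- g2 x))"
      unfolding P_mat_mult elim(6)[symmetric] Xj Rj ..
    also have "\<dots> = e1' x + m x *v e2' x"
      using elim(1) complex_structure_mult(1)[OF mm]
      by (simp add: e1'_def e2'_def matrix_vector_right_distrib matrix_vector_mult_scaleR matrix_vector_mult_minus_right algebra_simps)
    finally show ?case using pd(2) by (metis pos_def_inverse_mult(1))
  qed
  then have "cell_solution (\<lambda>x. matrix_inv (P_mat \<gamma> (l x) (m x))) m a b e1' e2' j1 j2"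
    using 1 2 jp by (simp add: cell_solution_def)
  then show ?thesis using mean unfolding u_def[symmetric] by blast
qed

end

subsection \<open>The link\<close>

lemma effective_tensor_link:
  assumes L: "composite L" and S: "AE x in lebesgue. L x \<in> Phi_dom \<gamma>"
    and L': "composite L'" and Phi: "AE x in lebesgue. L' x = Phi \<gamma> (L x)"
    and A: "is_effective_tensor L A"
  shows "A \<in> Phi_dom \<gamma> \<and> is_effective_tensor L' (Phi \<gamma> A)"
proof -
  \<comment> \<open>Parameters are chosen point by point. Where \<open>L x\<close> lies outside the
    domain they are arbitrary, which happens on a null set only.\<close>
  have "\<forall>x. \<exists>p. L x \<in> Phi_dom \<gamma> \<longrightarrow> L x = frakL (fst p) (snd p) \<and> Phi_params \<gamma> (fst p) (snd p)"
    by (auto simp: Phi_dom_def)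
  then obtain p where p: "\<And>x. L x \<in> Phi_dom \<gamma> \<Longrightarrow> L x = frakL (fst (p x)) (snd (p x)) \<and> Phi_params \<gamma> (fst (p x)) (snd (p x))"
    by metis
  define l m where "l x = fst (p x)" and "m x = snd (p x)" for x
  have "AE x in cell_measure. L x \<in> Phi_dom \<gamma>" "AE x in cell_measure. L' x = Phi \<gamma> (L x)"
    unfolding AE_cell_iff using S Phi by (auto elim: eventually_mono)
  then have all: "AE x in cell_measure. L x = frakL (l x) (m x) \<and> Phi_params \<gamma> (l x) (m x) \<and> params19 (l x) (m x)
      \<and> L' x = frakL (matrix_inv (P_mat \<gamma> (l x) (m x))) (m x)"
  proof eventually_elim
    case (elim x)
    then have "L x = frakL (l x) (m x)" "Phi_params \<gamma> (l x) (m x)" using p[of x] by (simp_all add: l_def m_def)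
    then show ?case using elim(2) Phi_frakL by (simp add: Phi_params_def)
  qed
  have ae: "AE x in cell_measure. L x = frakL (l x) (m x)" "AE x in cell_measure. Phi_params \<gamma> (l x) (m x)"
    "AE x in cell_measure. params19 (l x) (m x)"
    "AE x in cell_measure. L' x = frakL (matrix_inv (P_mat \<gamma> (l x) (m x))) (m x)"
    using all by (eventually_elim, blast)+
  let ?B = "block (A - T_mat)"
  interpret homogenization l m "?B 1 1" "?B 1 2" "?B 2 1" "?B 2 2"
    by unfold_locales (use ae(3) effective_tensorD[OF L ae(1) A] in auto)
  have A_eq: "A = frakL (?B 1 1) Meff"
    by (rule frakL_eqI[OF refl B12_eq B21_eq B22_eq])
  note params = Phi_params_eff[OF ae(2)]
  have "is_effective_tensor L' (frakL (matrix_inv (P_mat \<gamma> (?B 1 1) Meff)) Meff)"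
    by (rule effective_tensorI[OF L' ae(4) linked_solution[OF ae(2)]])
  moreover have "Phi \<gamma> A = frakL (matrix_inv (P_mat \<gamma> (?B 1 1) Meff)) Meff"
    by (subst A_eq) (rule Phi_frakL[OF params])
  moreover have "A \<in> Phi_dom \<gamma>"
    unfolding Phi_dom_def using A_eq params by blast
  ultimately show ?thesis by simp
qed

text \<open>The terms with \<open>matrix_inv L\<close> are symmetric because \<open>L\<close> is,
  and \<open>M ** R_perp\<close> is symmetric because \<open>M\<close> has trace zero.\<close>

lemma P_mat_symmetric:
  assumes "params19 L M"
  shows "sym_mat (P_mat \<gamma> L M)"
proof -
  have X: "sym_mat (matrix_inv L)" and M: "M ** M = - mat 1"
    using assms by (simp_all add: params19_def sym_mat_matrix_inv)
  have "P_mat \<gamma> L M = transpose (P_mat \<gamma> L M)"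
  proof (rule matrix_eq_transposeI)
    fix x y
    have "y \<bullet> (M *v (R_perp *v x)) = x \<bullet> (M *v (R_perp *v y))"
      unfolding complex_structure_mult(4)[OF M, of x] inner_minus_right inner_R_perp
      by (simp add: inner_commute[of "R_perp *v y"] inner_transpose)
    moreover have "y \<bullet> (M *v (matrix_inv L *v (transpose M *v x))) = x \<bullet> (M *v (matrix_inv L *v (transpose M *v y)))"
      by (metis X inner_commute inner_transpose sym_mat_inner)
    moreover have "y \<bullet> (matrix_inv L *v x) = x \<bullet> (matrix_inv L *v y)"
      by (metis X inner_commute sym_mat_inner)
    ultimately show "y \<bullet> (P_mat \<gamma> L M *v x) = x \<bullet> (P_mat \<gamma> L M *v y)"
      by (simp add: P_mat_mult inner_add_right)
  qed
  then show ?thesis by (simp add: sym_mat_def)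
qed

text \<open>The new \<open>L\<close> has inverse \<open>P\<close>, so the two inequalities of the
  domain are literally the positivity and the negativity required of the new parameters.\<close>

lemma Phi_params_image:
  assumes "Phi_params \<gamma> L M"
  shows "params19 (matrix_inv (P_mat \<gamma> L M)) M"
proof -
  have "pos_def (P_mat \<gamma> L M)" "params19 L M" "neg_def (P_mat \<gamma> L M + 2 *\<^sub>R (M ** R_perp))"
    using assms by (auto simp: Phi_params_def)
  then show ?thesis
    using P_mat_symmetric[of L M \<gamma>]
    by (simp add: params19_def sym_mat_matrix_inv pos_def_matrix_inv matrix_inv_matrix_inv)
qed

lemma Phi_image: "Phi \<gamma> ` Phi_dom \<gamma> \<subseteq> M19"
proof
  fix B assume "B \<in> Phi \<gamma> ` Phi_dom \<gamma>"
  then obtain L M where "Phi_params \<gamma> L M" "B = frakL (matrix_inv (P_mat \<gamma> L M)) M"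
    by (auto simp: Phi_dom_def Phi_frakL)
  then show "B \<in> M19" using Phi_params_image unfolding M19_def by blast
qed

lemma link_Phi:
  assumes "Phi \<gamma> ` Phi_dom \<gamma> \<subseteq> N"
  shows "is_link (Phi \<gamma>) (Phi_dom \<gamma>) N"
  unfolding is_link_def using assms effective_tensor_link by blast

text \<open>With \<open>w = M\<^sup>T v\<close> put \<open>p = v \<bullet> X v\<close>,
  \<open>q = w \<bullet> X w\<close>, \<open>t = w \<bullet> R\<^sub>\<bottom> v\<close>. The
  hypothesis at \<open>v\<close> and at \<open>w\<close> gives \<open>p + 2 t < 0\<close> and
  \<open>q + 2 t < 0\<close>, the latter because \<open>M\<^sup>T w = - v\<close>. Together with
  \<open>p, q > 0\<close> this yields \<open>p / 2 - q / 2 - t > 0\<close> and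
  \<open>p / 2 - q / 2 + t < 0\<close>.\<close>

lemma params19_imp_Phi_params_half:
  assumes LM: "params19 L M"
  shows "Phi_params (-1/2) L M"
proof -
  let ?X = "matrix_inv L"
  have M: "M ** M = - mat 1" and X: "pos_def ?X" and n: "\<And>v. v \<noteq> 0 \<Longrightarrow> qform 1 0 2 ?X M v < 0"
    using LM by (auto simp: params19_iff_qform pos_def_matrix_inv)
  have "qform (1/2) (-1/2) (-1) ?X M v > 0 \<and> qform (1/2) (-1/2) 1 ?X M v < 0" if v: "v \<noteq> 0" for v
  proof -
    define w where "w = transpose M *v v"
    have Mw: "transpose M *v w = - v" unfolding w_def by (rule complex_structure_mult(2)[OF M])
    then have w: "w \<noteq> 0" using v by auto
    have "(- v) \<bullet> (R_perp *v w) = w \<bullet> (R_perp *v v)" using inner_R_perp[of v w] by (simp add: inner_commute)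
    then have "w \<bullet> (?X *v w) + 2 * (w \<bullet> (R_perp *v v)) < 0"
      using n[OF w] unfolding qform_def Mw by simp
    moreover have "v \<bullet> (?X *v v) + 2 * (w \<bullet> (R_perp *v v)) < 0"
      using n[OF v] unfolding qform_def w_def by simp
    moreover have "0 < v \<bullet> (?X *v v)" "0 < w \<bullet> (?X *v w)" using X v w by (auto simp: pos_def_def)
    ultimately show ?thesis unfolding qform_def w_def[symmetric] by simp
  qed
  then show ?thesis using LM by (simp add: Phi_params_iff_qform)
qed

lemma Phi_dom_half: "Phi_dom (-1/2) = M19"
  using params19_imp_Phi_params_half by (auto simp: Phi_dom_def M19_def Phi_params_def)

text \<open>For general \<open>\<gamma>\<close> the terms with \<open>X\<close> contribute
  \<open>(1 + 2 \<gamma>) (M X - X M\<^sup>T)\<close> and the rotation term contributes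
  \<open>- 4 \<gamma> R\<^sub>\<bottom>\<close>. At \<open>\<gamma> = -1/2\<close> the former
  disappears and the latter is the right side.\<close>

lemma P_mat_half_commutator:
  assumes M: "M ** M = - mat 1"
  shows "M ** P_mat (-1/2) L M - P_mat (-1/2) L M ** transpose M = 2 *\<^sub>R R_perp"
proof -
  let ?X = "matrix_inv L"
  note c = complex_structure_mult[OF M]
  have "(M ** P_mat (-1/2) L M - P_mat (-1/2) L M ** transpose M) *v v = (2 *\<^sub>R R_perp) *v v" for v
  proof -
    have 1: "M *v (P_mat (-1/2) L M *v v) = (1/2) *\<^sub>R (?X *v (transpose M *v v)) + (1/2) *\<^sub>R (M *v (?X *v v)) + R_perp *v v"
      unfolding P_mat_mult by (simp add: matrix_vector_right_distrib matrix_vector_mult_diff_distrib matrix_vector_mult_scaleR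
          matrix_vector_mult_minus_right c(1))
    have 2: "P_mat (-1/2) L M *v (transpose M *v v) = (1/2) *\<^sub>R (M *v (?X *v v)) + (1/2) *\<^sub>R (?X *v (transpose M *v v)) - R_perp *v v"
      unfolding P_mat_mult by (simp add: matrix_vector_mult_minus_right c(2,4))
    show ?thesis
      unfolding matrix_vector_mult_diff_rdistrib matrix_vector_mul_assoc[symmetric] 1 2
      by (simp add: vec_eq_iff forall_2 scaleR_matrix_vector_assoc[symmetric])
  qed
  then show ?thesis by (simp add: matrix_eq)
qed

lemma Phi_half_image: "Phi (-1/2) ` M19 \<subseteq> M18"
proof
  fix B assume "B \<in> Phi (-1/2) ` M19"
  then obtain L M where LM: "Phi_params (-1/2) L M" and B: "B = frakL (matrix_inv (P_mat (-1/2) L M)) M"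
    unfolding Phi_dom_half[symmetric] by (auto simp: Phi_dom_def Phi_frakL)
  have "params19 (matrix_inv (P_mat (-1/2) L M)) M" "pos_def (P_mat (-1/2) L M)"
    using Phi_params_image[OF LM] LM by (auto simp: Phi_params_def)
  then show "B \<in> M18"
    unfolding M18_def B using P_mat_half_commutator[of M L]
    by (intro CollectI exI[of _ M] exI[of _ "matrix_inv (P_mat (-1/2) L M)"])
      (simp add: params19_def matrix_inv_matrix_inv)
qed

text \<open>The witness against surjectivity of the map on \<open>M19\<close>, whose image lies in
  \<open>M18\<close>. For \<open>L = c *\<^sub>R mat 1\<close> and \<open>M = R_perp\<close>
  membership in \<open>M19\<close> requires \<open>1 / c < 2\<close>, whereas the commutator is
  \<open>(2 / c) *\<^sub>R R_perp\<close>, so among \<open>c > 0\<close> membership in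
  \<open>M18\<close> requires \<open>c = 1\<close>.\<close>

lemma M19_not_subset_M18: "frakL (2 *\<^sub>R mat 1) R_perp \<in> M19" "frakL (2 *\<^sub>R mat 1) R_perp \<notin> M18"
proof -
  let ?L = "2 *\<^sub>R mat 1 :: mat2"
  have RR: "R_perp ** R_perp = - mat 1"
    by (simp add: vec_eq_iff forall_2 matrix_matrix_mult_def sum_2 mat_def)
  have sc: "(c *\<^sub>R mat 1 :: mat2) *v v = c *\<^sub>R v" for c v
    by (simp add: scaleR_matrix_vector_assoc[symmetric])
  have pd: "pos_def ?L" by (simp add: pos_def_def sc)
  have inv: "matrix_inv ?L = (1/2) *\<^sub>R mat 1"
    by (rule matrix_inv_eqI) (simp_all add: matrix_eq sc flip: matrix_vector_mul_assoc)
  have "sym_mat ?L" by (simp add: sym_mat_def vec_eq_iff transpose_def mat_def)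
  moreover have "matrix_inv ?L + 2 *\<^sub>R (R_perp ** R_perp) = (- 3/2) *\<^sub>R mat 1"
    unfolding inv RR by (simp add: vec_eq_iff mat_def)
  then have "neg_def (matrix_inv ?L + 2 *\<^sub>R (R_perp ** R_perp))"
    by (simp only: neg_def_def sc) simp
  ultimately have "params19 ?L R_perp" using pd RR by (simp add: params19_def)
  then show "frakL ?L R_perp \<in> M19" unfolding M19_def by blast
  show "frakL ?L R_perp \<notin> M18"
  proof
    assume "frakL ?L R_perp \<in> M18"
    then obtain L M where "frakL ?L R_perp = frakL L M" "M ** matrix_inv L - matrix_inv L ** transpose M = 2 *\<^sub>R R_perp"
      by (auto simp: M18_def)
    then have "R_perp ** matrix_inv ?L - matrix_inv ?L ** transpose R_perp = 2 *\<^sub>R R_perp"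
      using frakL_inj[OF _ pd] by metis
    from arg_cong[OF this[unfolded inv], of "\<lambda>A. A $ 2 $ 1"] show False
      by (simp add: matrix_matrix_mult_def sum_2 mat_def transpose_def)
  qed
qed

theorem mainTheorem3:
  shows "(\<forall>\<gamma>0. is_link (Phi \<gamma>0) (Phi_dom \<gamma>0) M19)
    \<and> Phi_dom (-1/2) = M19
    \<and> \<not> bij_betw (Phi (-1/2)) M19 M19
    \<and> is_link (Phi (-1/2)) M19 M18"
proof (intro conjI allI)
  show "is_link (Phi \<gamma>0) (Phi_dom \<gamma>0) M19" for \<gamma>0 by (rule link_Phi[OF Phi_image])
  show "Phi_dom (-1/2) = M19" by (rule Phi_dom_half)
  show "\<not> bij_betw (Phi (-1/2)) M19 M19"
    using Phi_half_image M19_not_subset_M18 unfolding bij_betw_def by blast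
  show "is_link (Phi (-1/2)) M19 M18"
    using link_Phi[of "-1/2" M18] Phi_half_image unfolding Phi_dom_half .
qed

end
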